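(* Let $\bar u\in U_{ad}\cap BV(\Omega)$ be a solution of problem $(P_\gamma)$ with associated state $\bar y=S\bar u+y_f$, and let $\{\bar u_h\}_{h>0}$, with $h\to 0$, be a sequence of global solutions $\bar u_h$ of the discrete problems $(P^h_\gamma)$, with associated discrete states $\bar y_h=S_h\bar u_h+y_f$, such that $\lim_{h\to0}\|\bar u_h-\bar u\|_{L^\infty(\Omega)}=0$. Assume: (A) there is a constant $C>1$ such that $|\bar u(x)|\ge C s^*+\frac{1-q}{\gamma}$ for almost all $x\in\Omega$ with $\bar u(x)\neq0$, where $s^*=\big(\frac{\beta}{\alpha}q(1-q)\big)^{\frac1{2-q}}$; (B) with $\mathcal T_h^0=\{T\in\mathcal T_h:\ \frac1{|T|}\int_T\bar u\,dx=0\}$, $\mathcal T_h^{\#}=\{T\in\mathcal T_h:\ |\bar u(x)|>0 \text{ for a.a. }x\in T\}$ and $\mathcal T_h^*=\mathcal T_h\setminus(\mathcal T_h^0\cup\mathcal T_h^{\#})$, there is a constant $c^*>0$ such that the total area $|\mathcal T_h^*|$ of the triangles in $\mathcal T_h^*$ satisfies $|\mathcal T_h^*|\le c^*h$ for all $h>0$. Then there is a constant $c>0$ independent of $h$ such that, for all sufficiently small $h$, $$\|\bar u-\bar u_h\|_{L^2(\Omega)}+\|\bar y-\bar y_h\|_{L^2(\Omega)}\le c\,h^{\frac12}.$$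
   Context: Setting. $\Omega\subset\mathbb R^2$ is a bounded star-shaped domain with boundary $\Gamma$; $y_d\in L^p(\Omega)$ with $p>2$; $f\in L^2(\Omega)$; $\alpha,\beta>0$, $q\in(0,1)$, $\gamma>1$ (large) are fixed reals; $u_a<0<u_b$ are reals. $A$ is the operator $Ay=-\sum_{i,j=1}^2\partial_{x_i}(a_{ij}\partial_{x_j}y)+c_0y$ with $a_{ij}\in C(\bar\Omega)$, $(a_{ij})$ symmetric and uniformly elliptic, $0\le c_0\in L^\infty(\Omega)$; $a(\cdot,\cdot)$ is its bilinear form on $H_0^1(\Omega)$. $S:L^2(\Omega)\to H_0^1(\Omega)$ is the solution operator: $y=Sw$ iff $a(y,v)=(w,v)_{L^2(\Omega)}$ for all $v\in H_0^1(\Omega)$; $S$ and its adjoint $S^*$ are continuous from $L^2(\Omega)$ to $L^\infty(\Omega)$. Put $y_f=Sf$. Let $U_{ad}=\{u\in L^2(\Omega):u_a\le u(x)\le u_b \text{ a.e.}\}$, $\Upsilon_{q,\gamma}(u)=\int_\Omega h_{q,\gamma}(u(x))^q\,dx$ with $h_{q,\gamma}(t)=q\gamma^{\frac{1-q}{q}}|t|^{\frac1q}$ if $|t|\le\frac1\gamma$ and $h_{q,\gamma}(t)=|t|-\frac{1-q}{\gamma}$ otherwise. Problem $(P_\gamma)$: minimize $J_\gamma(u)=\frac12\|Su+y_f-y_d\|_{L^2(\Omega)}^2+\frac\alpha2\|u\|_{L^2(\Omega)}^2+\beta\Upsilon_{q,\gamma}(u)$ over $u\in U_{ad}\cap BV(\Omega)$.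 Discretization. $(\mathcal T_h)_{h>0}$ is a family of conforming triangulations with $\bigcup_{T\in\mathcal T_h}T=\bar\Omega$ (two distinct triangles share a vertex, a side, or are disjoint), $h=\max_{T}\rho(T)$, where $\rho(T)$ is the diameter of $T$ and $\sigma(T)$ the diameter of the largest ball contained in $T$; there are constants $\rho,\sigma>0$ with $\rho(T)/\sigma(T)\le\sigma$ and $h/\rho(T)\le\rho$ for all $T\in\mathcal T_h$ and all $h>0$. $Y_h$ is the space of continuous functions on $\bar\Omega$ that are affine on each $T$ and vanish on $\Gamma$; $U_h$ is the space of functions constant on each $T$. $S_h$ is the discrete solution operator: $S_hw\in Y_h$ with $a(S_hw,v_h)=(w,v_h)_{L^2(\Omega)}$ for all $v_h\in Y_h$. It is assumed that $S_hf=y_f$ (exact computation of the part of the state due to $f$). The finite element error estimate is taken as known: for each $u\in L^2(\Omega)$ there is $c_A>0$ independent of $h$ with $\|Su-S_hu\|_{L^2(\Omega)}+h\|Su-S_hu\|_{H^1(\Omega)}\le c_Ah^2$. Problem $(P^h_\gamma)$: minimize $J^h_\gamma(u)=\frac12\|S_hu+S_hf-y_d\|_{L^2(\Omega)}^2+\frac\alpha2\|u\|_{L^2(\Omega)}^2+\beta\Upsilon_{q,\gamma}(u)$ over $u\in U_{ad}^h=U_{ad}\cap U_h$. *)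

theory Defs
  imports "HOL-Analysis.Analysis" "HOL-Probability.Essential_Supremum"
begin

text \<open>
  Elements of Lebesgue and Sobolev spaces are represented by functions on the whole plane; only
  their values on \<open>\<Omega>\<close>, up to null sets, matter.
\<close>

section \<open>Lebesgue spaces\<close>

definition Lp :: "real \<Rightarrow> (real^2) set \<Rightarrow> (real^2 \<Rightarrow> real) set" where
  "Lp p \<Omega> = {u \<in> borel_measurable (lebesgue_on \<Omega>).
     integrable (lebesgue_on \<Omega>) (\<lambda>x. \<bar>u x\<bar> powr p)}"

definition Lp_norm :: "real \<Rightarrow> (real^2) set \<Rightarrow> (real^2 \<Rightarrow> real) \<Rightarrow> real" where
  "Lp_norm p \<Omega> u = (\<integral>x. \<bar>u x\<bar> powr p \<partial>lebesgue_on \<Omega>) powr (1 / p)"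

abbreviation "L2 \<equiv> Lp 2"
abbreviation "L2_norm \<equiv> Lp_norm 2"

definition L2_inner :: "(real^2) set \<Rightarrow> (real^2 \<Rightarrow> real) \<Rightarrow> (real^2 \<Rightarrow> real) \<Rightarrow> real" where
  "L2_inner \<Omega> u v = (\<integral>x. u x * v x \<partial>lebesgue_on \<Omega>)"

definition Linf_norm :: "(real^2) set \<Rightarrow> (real^2 \<Rightarrow> real) \<Rightarrow> ereal" where
  "Linf_norm \<Omega> u = esssup (lebesgue_on \<Omega>) (\<lambda>x. ereal \<bar>u x\<bar>)"

definition Linf :: "(real^2) set \<Rightarrow> (real^2 \<Rightarrow> real) set" where
  "Linf \<Omega> = {u \<in> borel_measurable (lebesgue_on \<Omega>). Linf_norm \<Omega> u < \<infinity>}"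

section \<open>Sobolev spaces and functions of bounded variation\<close>

definition grad :: "(real^2 \<Rightarrow> real) \<Rightarrow> real^2 \<Rightarrow> real^2" where
  "grad \<phi> x = (\<chi> i. frechet_derivative \<phi> (at x) (axis i 1))"

primrec Ck :: "nat \<Rightarrow> (real^2 \<Rightarrow> real) \<Rightarrow> bool" where
  "Ck 0 \<phi> \<longleftrightarrow> continuous_on UNIV \<phi>"
| "Ck (Suc k) \<phi> \<longleftrightarrow> (\<forall>x. \<phi> differentiable (at x)) \<and> (\<forall>i. Ck k (\<lambda>x. grad \<phi> x $ i))"

definition compactly_supported_in :: "(real^2) set \<Rightarrow> (real^2 \<Rightarrow> 'b::zero) \<Rightarrow> bool" where
  "compactly_supported_in \<Omega> \<phi> \<longleftrightarrow> compact (closure {x. \<phi> x \<noteq> 0}) \<and> closure {x. \<phi> x \<noteq> 0} \<subseteq> \<Omega>"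

definition test_functions :: "(real^2) set \<Rightarrow> (real^2 \<Rightarrow> real) set" where
  "test_functions \<Omega> = {\<phi>. (\<forall>k. Ck k \<phi>) \<and> compactly_supported_in \<Omega> \<phi>}"

definition has_weak_gradient ::
  "(real^2) set \<Rightarrow> (real^2 \<Rightarrow> real) \<Rightarrow> (real^2 \<Rightarrow> real^2) \<Rightarrow> bool" where
  "has_weak_gradient \<Omega> u g \<longleftrightarrow>
     u \<in> L2 \<Omega> \<and> (\<forall>i. (\<lambda>x. g x $ i) \<in> L2 \<Omega>) \<and>
     (\<forall>\<phi>\<in>test_functions \<Omega>. \<forall>i.
        (\<integral>x. u x * grad \<phi> x $ i \<partial>lebesgue_on \<Omega>) = - (\<integral>x. g x $ i * \<phi> x \<partial>lebesgue_on \<Omega>))"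

definition H1 :: "(real^2) set \<Rightarrow> (real^2 \<Rightarrow> real) set" where
  "H1 \<Omega> = {u. \<exists>g. has_weak_gradient \<Omega> u g}"

text \<open>The weak gradient is determined up to a null set, so the choice below is immaterial.\<close>

definition weak_grad :: "(real^2) set \<Rightarrow> (real^2 \<Rightarrow> real) \<Rightarrow> real^2 \<Rightarrow> real^2" where
  "weak_grad \<Omega> u = (SOME g. has_weak_gradient \<Omega> u g)"

definition H1_norm :: "(real^2) set \<Rightarrow> (real^2 \<Rightarrow> real) \<Rightarrow> real" where
  "H1_norm \<Omega> u =
     sqrt ((L2_norm \<Omega> u)\<^sup>2 + (\<integral>x. (norm (weak_grad \<Omega> u x))\<^sup>2 \<partial>lebesgue_on \<Omega>))"

definition H10 :: "(real^2) set \<Rightarrow> (real^2 \<Rightarrow> real) set" where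
  "H10 \<Omega> = {u \<in> H1 \<Omega>. \<exists>\<phi>. (\<forall>n::nat. \<phi> n \<in> test_functions \<Omega>) \<and>
     (\<lambda>n. H1_norm \<Omega> (\<lambda>x. u x - \<phi> n x)) \<longlonglongrightarrow> 0}"

definition BV :: "(real^2) set \<Rightarrow> (real^2 \<Rightarrow> real) set" where
  "BV \<Omega> = {u. integrable (lebesgue_on \<Omega>) u \<and>
     bdd_above {\<integral>x. u x * (\<Sum>i\<in>UNIV. grad (\<lambda>y. \<psi> y $ i) x $ i) \<partial>lebesgue_on \<Omega> | \<psi> :: real^2 \<Rightarrow> real^2.
       (\<forall>i. Ck 1 (\<lambda>y. \<psi> y $ i)) \<and> compactly_supported_in \<Omega> \<psi> \<and> (\<forall>x. norm (\<psi> x) \<le> 1)}}"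

section \<open>The elliptic operator and its solution operators\<close>

definition elliptic_coefficients ::
  "(real^2) set \<Rightarrow> (real^2 \<Rightarrow> real^2^2) \<Rightarrow> (real^2 \<Rightarrow> real) \<Rightarrow> bool" where
  "elliptic_coefficients \<Omega> a c\<^sub>0 \<longleftrightarrow>
     continuous_on (closure \<Omega>) a \<and>
     (\<forall>x\<in>closure \<Omega>. transpose (a x) = a x) \<and>
     (\<exists>\<theta>>0. \<forall>x\<in>closure \<Omega>. \<forall>\<xi>. \<theta> * (norm \<xi>)\<^sup>2 \<le> \<xi> \<bullet> (a x *v \<xi>)) \<and>
     c\<^sub>0 \<in> Linf \<Omega> \<and> (AE x in lebesgue_on \<Omega>. 0 \<le> c\<^sub>0 x)"

definition bilinear_form ::
  "(real^2) set \<Rightarrow> (real^2 \<Rightarrow> real^2^2) \<Rightarrow> (real^2 \<Rightarrow> real) \<Rightarrow>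
     (real^2 \<Rightarrow> real) \<Rightarrow> (real^2 \<Rightarrow> real) \<Rightarrow> real" where
  "bilinear_form \<Omega> a c\<^sub>0 y v =
     (\<integral>x. (\<Sum>i\<in>UNIV. \<Sum>j\<in>UNIV. a x $ i $ j * weak_grad \<Omega> y x $ j * weak_grad \<Omega> v x $ i)
          + c\<^sub>0 x * y x * v x \<partial>lebesgue_on \<Omega>)"

text \<open>
  The variational solution operator on the space \<open>V\<close>, which is either all of \<open>H\<^sub>0\<^sup>1(\<Omega>)\<close> or a finite
  element space. The condition determines \<open>S w\<close> up to a null set.
\<close>

definition solution_operator ::
  "(real^2) set \<Rightarrow> (real^2 \<Rightarrow> real^2^2) \<Rightarrow> (real^2 \<Rightarrow> real) \<Rightarrow> (real^2 \<Rightarrow> real) set \<Rightarrow>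
     ((real^2 \<Rightarrow> real) \<Rightarrow> (real^2 \<Rightarrow> real)) \<Rightarrow> bool" where
  "solution_operator \<Omega> a c\<^sub>0 V S \<longleftrightarrow>
     (\<forall>w\<in>L2 \<Omega>. S w \<in> V \<and>
        (\<forall>y\<in>V. (AE x in lebesgue_on \<Omega>. y x = S w x) \<longleftrightarrow>
                (\<forall>v\<in>V. bilinear_form \<Omega> a c\<^sub>0 y v = L2_inner \<Omega> w v)))"

definition L2_adjoint ::
  "(real^2) set \<Rightarrow> ((real^2 \<Rightarrow> real) \<Rightarrow> (real^2 \<Rightarrow> real)) \<Rightarrow>
     ((real^2 \<Rightarrow> real) \<Rightarrow> (real^2 \<Rightarrow> real)) \<Rightarrow> bool" where
  "L2_adjoint \<Omega> S S' \<longleftrightarrow>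
     (\<forall>z\<in>L2 \<Omega>. S' z \<in> L2 \<Omega> \<and> (\<forall>w\<in>L2 \<Omega>. L2_inner \<Omega> (S w) z = L2_inner \<Omega> w (S' z)))"

text \<open>Boundedness, that is, continuity for operators that are linear up to null sets.\<close>

definition bounded_L2_Linf ::
  "(real^2) set \<Rightarrow> ((real^2 \<Rightarrow> real) \<Rightarrow> (real^2 \<Rightarrow> real)) \<Rightarrow> bool" where
  "bounded_L2_Linf \<Omega> S \<longleftrightarrow>
     (\<exists>K. \<forall>w\<in>L2 \<Omega>. S w \<in> Linf \<Omega> \<and> Linf_norm \<Omega> (S w) \<le> ereal (K * L2_norm \<Omega> w))"

section \<open>The control problem\<close>

definition h_fun :: "real \<Rightarrow> real \<Rightarrow> real \<Rightarrow> real" where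
  "h_fun q \<gamma> t =
     (if \<bar>t\<bar> \<le> 1 / \<gamma> then q * \<gamma> powr ((1 - q) / q) * \<bar>t\<bar> powr (1 / q) else \<bar>t\<bar> - (1 - q) / \<gamma>)"

definition Upsilon :: "(real^2) set \<Rightarrow> real \<Rightarrow> real \<Rightarrow> (real^2 \<Rightarrow> real) \<Rightarrow> real" where
  "Upsilon \<Omega> q \<gamma> u = (\<integral>x. h_fun q \<gamma> (u x) powr q \<partial>lebesgue_on \<Omega>)"

definition cost ::
  "(real^2) set \<Rightarrow> (real^2 \<Rightarrow> real) \<Rightarrow> (real^2 \<Rightarrow> real) \<Rightarrow> real \<Rightarrow> real \<Rightarrow> real \<Rightarrow> real \<Rightarrow>
     ((real^2 \<Rightarrow> real) \<Rightarrow> (real^2 \<Rightarrow> real)) \<Rightarrow> (real^2 \<Rightarrow> real) \<Rightarrow> real" where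
  "cost \<Omega> f y\<^sub>d \<alpha> \<beta> q \<gamma> S u =
     1 / 2 * (L2_norm \<Omega> (\<lambda>x. S u x + S f x - y\<^sub>d x))\<^sup>2
     + \<alpha> / 2 * (L2_norm \<Omega> u)\<^sup>2 + \<beta> * Upsilon \<Omega> q \<gamma> u"

definition U_ad :: "(real^2) set \<Rightarrow> real \<Rightarrow> real \<Rightarrow> (real^2 \<Rightarrow> real) set" where
  "U_ad \<Omega> u\<^sub>a u\<^sub>b = {u \<in> L2 \<Omega>. AE x in lebesgue_on \<Omega>. u\<^sub>a \<le> u x \<and> u x \<le> u\<^sub>b}"

section \<open>Discretization\<close>

definition inball_diameter :: "(real^2) set \<Rightarrow> real" where
  "inball_diameter T = Sup {diameter (ball x r) | x r. ball x r \<subseteq> T}"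

text \<open>
  Since \<open>h\<close> is the mesh size, it cannot exceed the diameter of \<open>\<Omega>\<close>; the meshes are therefore
  indexed by a set \<open>H\<close> of positive reals rather than by all of them. The condition that distinct
  triangles share a vertex, share a side or are disjoint is part of \<^const>\<open>triangulation\<close>.
\<close>

definition mesh_family :: "(real^2) set \<Rightarrow> real set \<Rightarrow> (real \<Rightarrow> (real^2) set set) \<Rightarrow> bool" where
  "mesh_family \<Omega> H \<T> \<longleftrightarrow>
     (\<forall>h\<in>H. triangulation (\<T> h) \<and> (\<forall>T\<in>\<T> h. 2 simplex T) \<and> \<Union>(\<T> h) = closure \<Omega> \<and>
        h = Max (diameter ` \<T> h)) \<and>
     (\<exists>\<rho>>0. \<exists>\<sigma>>0. \<forall>h\<in>H. \<forall>T\<in>\<T> h.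
        diameter T / inball_diameter T \<le> \<sigma> \<and> h / diameter T \<le> \<rho>)"

definition Y_space :: "(real^2) set \<Rightarrow> (real^2) set set \<Rightarrow> (real^2 \<Rightarrow> real) set" where
  "Y_space \<Omega> \<T> = {v. continuous_on (closure \<Omega>) v \<and>
     (\<forall>T\<in>\<T>. \<exists>b c. \<forall>x\<in>T. v x = b \<bullet> x + c) \<and> (\<forall>x\<in>frontier \<Omega>. v x = 0)}"

text \<open>
  Constancy holds almost everywhere on each triangle: the triangles are closed and overlap along
  their sides.
\<close>

definition U_space :: "(real^2) set \<Rightarrow> (real^2) set set \<Rightarrow> (real^2 \<Rightarrow> real) set" where
  "U_space \<Omega> \<T> = {u. \<forall>T\<in>\<T>. \<exists>c. AE x in lebesgue_on \<Omega>. x \<in> T \<longrightarrow> u x = c}"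

definition T_zero :: "(real^2) set \<Rightarrow> (real^2 \<Rightarrow> real) \<Rightarrow> (real^2) set set \<Rightarrow> (real^2) set set" where
  "T_zero \<Omega> u \<T> =
     {T\<in>\<T>. 1 / measure lebesgue T * set_lebesgue_integral (lebesgue_on \<Omega>) T u = 0}"

definition T_sharp :: "(real^2) set \<Rightarrow> (real^2 \<Rightarrow> real) \<Rightarrow> (real^2) set set \<Rightarrow> (real^2) set set" where
  "T_sharp \<Omega> u \<T> = {T\<in>\<T>. AE x in lebesgue_on \<Omega>. x \<in> T \<longrightarrow> \<bar>u x\<bar> > 0}"

definition T_star :: "(real^2) set \<Rightarrow> (real^2 \<Rightarrow> real) \<Rightarrow> (real^2) set set \<Rightarrow> (real^2) set set" where
  "T_star \<Omega> u \<T> = \<T> - (T_zero \<Omega> u \<T> \<union> T_sharp \<Omega> u \<T>)"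

end

theory Submission
  imports Defs
begin

text \<open>
  Write \<open>J\<close> and \<open>J\<^sub>h\<close> for the continuous and the discrete cost, \<open>u\<close> and \<open>u\<^sub>h\<close> for their minimizers, and
  \<open>Pu\<close> for the piecewise constant function of the cell means of \<open>u\<close>. The order \<open>h\<^sup>1\<^sup>/\<^sup>2\<close> comes from

  \<open>2 \<kappa> \<parallel>u - u\<^sub>h\<parallel>\<^sup>2 \<le> J(u\<^sub>h) - J(u) \<le> (J - J\<^sub>h)(u\<^sub>h) + (J\<^sub>h - J)(Pu) + (J(Pu) - J(u)) \<le> C h\<close>,

  where the middle step is the minimality \<open>J\<^sub>h(u\<^sub>h) \<le> J\<^sub>h(Pu)\<close>.

  Quadratic growth (\<open>cost_growth\<close>). The density \<open>F(t) = \<alpha>/2 t\<^sup>2 + \<beta> h(t)\<^sup>q\<close> of the control cost is not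
  convex, but it is strongly convex near \<open>0\<close>, where the penalty is linear in \<open>\<bar>t\<bar>\<close>, and beyond a
  threshold that \<open>\<bar>u\<bar>\<close> exceeds with some room wherever \<open>u \<noteq> 0\<close>. Uniform closeness of \<open>u\<^sub>h\<close> to \<open>u\<close> keeps
  the segment between them in these regions, so comparing \<open>J\<close> at its midpoint and at its ends gives
  the growth. The midpoint competes with \<open>u\<close> because step functions on a triangulation have bounded
  variation (\<open>U_space_BV\<close>).

  Discretization of the state. The operators \<open>S\<close> and \<open>S\<^sub>h\<close> inherit symmetry from the bilinear form,
  so linearity comes for free, and the finite element estimate, given with a constant that
  depends on the control, becomes uniform by the uniform boundedness principle
  (\<open>L2_uniform_boundedness\<close>, \<open>pointwise_order_implies_uniform_order\<close>). This bounds \<open>J - J\<^sub>h\<close> on bounded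
  sets by \<open>C h\<^sup>2\<close>.

  The competitor \<open>Pu\<close>. Its control cost is at most that of \<open>u\<close>: closeness to the step function \<open>u\<^sub>h\<close>
  prevents \<open>u\<close> from crossing the gap around \<open>0\<close> inside a cell, and Jensen's inequality applies on
  each cell (\<open>cell_projection_density_le\<close>). Its tracking cost differs from that of \<open>u\<close> by \<open>O(h)\<close>
  because \<open>\<parallel>S r\<parallel> \<le> K h \<parallel>r\<parallel>\<close> for \<open>r = u - Pu\<close>, as for every \<open>r\<close> with zero cell means. Up to \<open>O(h\<^sup>2)\<close> it suffices
  to bound \<open>(S\<^sub>h w, r)\<close>; here \<open>S\<^sub>h w\<close> is affine on each cell, hence constant up to \<open>h\<close> times its
  gradient, and ellipticity bounds the gradient in \<open>L\<^sup>2\<close> (\<open>Y_space_zero_mean_pairing\<close>). For the last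
  point, finite element functions are shown to have a weak gradient, and their gradient on a cell is
  recovered from it by a smooth bump supported there.
\<close>

section \<open>The Hilbert space of square-integrable functions\<close>

lemma abs_powr_2: "\<bar>x::real\<bar> powr 2 = x\<^sup>2"
  by (cases "x = 0") (simp_all add: powr_numeral)

lemma L2_iff: "u \<in> L2 \<Omega> \<longleftrightarrow>
    u \<in> borel_measurable (lebesgue_on \<Omega>) \<and> integrable (lebesgue_on \<Omega>) (\<lambda>x. (u x)\<^sup>2)"
  by (simp add: Lp_def abs_powr_2)

lemma L2_norm_eq: "L2_norm \<Omega> u = sqrt (\<integral>x. (u x)\<^sup>2 \<partial>lebesgue_on \<Omega>)"
  by (simp add: Lp_norm_def abs_powr_2 powr_half_sqrt)

lemma L2_norm_nonneg: "0 \<le> L2_norm \<Omega> u"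
  by (simp add: L2_norm_eq)

lemma L2_norm_sq: "(L2_norm \<Omega> u)\<^sup>2 = (\<integral>x. (u x)\<^sup>2 \<partial>lebesgue_on \<Omega>)"
  by (simp add: L2_norm_eq)

lemma L2_norm_sq_inner: "(L2_norm \<Omega> u)\<^sup>2 = L2_inner \<Omega> u u"
  unfolding L2_norm_sq L2_inner_def by (simp add: power2_eq_square)

lemma L2_inner_commute: "L2_inner \<Omega> u v = L2_inner \<Omega> v u"
  by (simp add: L2_inner_def mult.commute)

lemma L2_measurable: "u \<in> L2 \<Omega> \<Longrightarrow> u \<in> borel_measurable (lebesgue_on \<Omega>)"
  by (simp add: L2_iff)

lemma L2_mult_integrable:
  assumes "u \<in> L2 \<Omega>" "v \<in> L2 \<Omega>"
  shows "integrable (lebesgue_on \<Omega>) (\<lambda>x. u x * v x)"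
proof (rule Bochner_Integration.integrable_bound)
  show "integrable (lebesgue_on \<Omega>) (\<lambda>x. (u x)\<^sup>2 + (v x)\<^sup>2)"
    using assms by (simp add: L2_iff)
  show "(\<lambda>x. u x * v x) \<in> borel_measurable (lebesgue_on \<Omega>)"
    using assms by (intro borel_measurable_times L2_measurable)
  have "\<bar>a * b\<bar> \<le> a\<^sup>2 + b\<^sup>2" for a b :: real
  proof -
    have "0 \<le> (\<bar>a\<bar> - \<bar>b\<bar>)\<^sup>2" by simp
    then have "2 * (\<bar>a\<bar> * \<bar>b\<bar>) \<le> a\<^sup>2 + b\<^sup>2" by (simp add: power2_diff)
    moreover have "0 \<le> \<bar>a\<bar> * \<bar>b\<bar>" by simp
    ultimately show ?thesis unfolding abs_mult by linarith
  qed
  then show "AE x in lebesgue_on \<Omega>. norm (u x * v x) \<le> norm ((u x)\<^sup>2 + (v x)\<^sup>2)"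
    by auto
qed

lemma L2_lin:
  assumes "u \<in> L2 \<Omega>" "v \<in> L2 \<Omega>"
  shows "(\<lambda>x. a * u x + b * v x) \<in> L2 \<Omega>"
proof -
  have "integrable (lebesgue_on \<Omega>) (\<lambda>x. a\<^sup>2 * (u x)\<^sup>2 + (2 * a * b) * (u x * v x) + b\<^sup>2 * (v x)\<^sup>2)"
    using assms L2_mult_integrable[OF assms] by (simp add: L2_iff)
  also have "(\<lambda>x. a\<^sup>2 * (u x)\<^sup>2 + (2 * a * b) * (u x * v x) + b\<^sup>2 * (v x)\<^sup>2)
      = (\<lambda>x. (a * u x + b * v x)\<^sup>2)"
    by (auto simp: power2_sum power_mult_distrib algebra_simps)
  finally have "integrable (lebesgue_on \<Omega>) (\<lambda>x. (a * u x + b * v x)\<^sup>2)" .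
  moreover have "(\<lambda>x. a * u x + b * v x) \<in> borel_measurable (lebesgue_on \<Omega>)"
    using assms by (intro borel_measurable_times borel_measurable_add L2_measurable
      borel_measurable_const)
  ultimately show ?thesis by (simp add: L2_iff)
qed

lemma L2_add: "u \<in> L2 \<Omega> \<Longrightarrow> v \<in> L2 \<Omega> \<Longrightarrow> (\<lambda>x. u x + v x) \<in> L2 \<Omega>"
  using L2_lin[of u \<Omega> v 1 1] by simp

lemma L2_diff: "u \<in> L2 \<Omega> \<Longrightarrow> v \<in> L2 \<Omega> \<Longrightarrow> (\<lambda>x. u x - v x) \<in> L2 \<Omega>"
  using L2_lin[of u \<Omega> v 1 "-1"] by simp

lemma L2_scale: "u \<in> L2 \<Omega> \<Longrightarrow> (\<lambda>x. a * u x) \<in> L2 \<Omega>"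
  using L2_lin[of u \<Omega> u a 0] by simp

lemma L2_inner_lin_left:
  assumes "u \<in> L2 \<Omega>" "v \<in> L2 \<Omega>" "w \<in> L2 \<Omega>"
  shows "L2_inner \<Omega> (\<lambda>x. a * u x + b * v x) w = a * L2_inner \<Omega> u w + b * L2_inner \<Omega> v w"
proof -
  have "L2_inner \<Omega> (\<lambda>x. a * u x + b * v x) w
      = (\<integral>x. a * (u x * w x) + b * (v x * w x) \<partial>lebesgue_on \<Omega>)"
    unfolding L2_inner_def by (rule arg_cong[where f = "integral\<^sup>L _"]) (auto simp: algebra_simps)
  then show ?thesis
    using L2_mult_integrable[OF assms(1,3)] L2_mult_integrable[OF assms(2,3)]
    by (simp add: L2_inner_def)
qed

lemma L2_inner_lin_right:
  assumes "u \<in> L2 \<Omega>" "v \<in> L2 \<Omega>" "w \<in> L2 \<Omega>"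
  shows "L2_inner \<Omega> w (\<lambda>x. a * u x + b * v x) = a * L2_inner \<Omega> w u + b * L2_inner \<Omega> w v"
  using L2_inner_lin_left[OF assms] by (simp add: L2_inner_commute)

lemma L2_inner_diff_left:
  "u \<in> L2 \<Omega> \<Longrightarrow> v \<in> L2 \<Omega> \<Longrightarrow> w \<in> L2 \<Omega> \<Longrightarrow>
    L2_inner \<Omega> (\<lambda>x. u x - v x) w = L2_inner \<Omega> u w - L2_inner \<Omega> v w"
  using L2_inner_lin_left[of u \<Omega> v w 1 "-1"] by simp

lemma L2_inner_scale_left: "L2_inner \<Omega> (\<lambda>x. a * u x) v = a * L2_inner \<Omega> u v"
  by (simp add: L2_inner_def mult.assoc)

lemma L2_norm_lin_sq:
  assumes "u \<in> L2 \<Omega>" "v \<in> L2 \<Omega>"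
  shows "(L2_norm \<Omega> (\<lambda>x. a * u x + b * v x))\<^sup>2
    = a\<^sup>2 * (L2_norm \<Omega> u)\<^sup>2 + 2 * a * b * L2_inner \<Omega> u v + b\<^sup>2 * (L2_norm \<Omega> v)\<^sup>2"
proof -
  have w: "(\<lambda>x. a * u x + b * v x) \<in> L2 \<Omega>" by (rule L2_lin[OF assms])
  show ?thesis
    unfolding L2_norm_sq_inner L2_inner_lin_left[OF assms w] L2_inner_lin_right[OF assms assms(1)]
      L2_inner_lin_right[OF assms assms(2)]
    by (simp add: L2_inner_commute[of _ v u] algebra_simps power2_eq_square)
qed

lemma L2_norm_scale: "L2_norm \<Omega> (\<lambda>x. a * u x) = \<bar>a\<bar> * L2_norm \<Omega> u"
  by (simp add: L2_norm_eq power_mult_distrib real_sqrt_mult)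

lemma L2_norm_minus_commute: "L2_norm \<Omega> (\<lambda>x. u x - v x) = L2_norm \<Omega> (\<lambda>x. v x - u x)"
  by (simp add: L2_norm_eq power2_commute)

lemma L2_norm_cong_AE:
  assumes "AE x in lebesgue_on \<Omega>. u x = v x" "u \<in> L2 \<Omega>" "v \<in> L2 \<Omega>"
  shows "L2_norm \<Omega> u = L2_norm \<Omega> v"
proof -
  have [measurable]: "u \<in> borel_measurable (lebesgue_on \<Omega>)" "v \<in> borel_measurable (lebesgue_on \<Omega>)"
    using assms by (auto simp: L2_iff)
  have "(\<integral>x. (u x)\<^sup>2 \<partial>lebesgue_on \<Omega>) = (\<integral>x. (v x)\<^sup>2 \<partial>lebesgue_on \<Omega>)"
    by (rule integral_cong_AE) (use assms in auto)
  then show ?thesis by (simp add: L2_norm_eq)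
qed

lemma L2_norm_zero_AE:
  assumes "u \<in> L2 \<Omega>" "L2_norm \<Omega> u = 0"
  shows "AE x in lebesgue_on \<Omega>. u x = 0"
proof -
  have "(\<integral>x. (u x)\<^sup>2 \<partial>lebesgue_on \<Omega>) = 0" using assms(2) by (simp add: L2_norm_eq)
  then have "AE x in lebesgue_on \<Omega>. (u x)\<^sup>2 = 0"
    using assms(1) by (subst (asm) integral_nonneg_eq_0_iff_AE) (auto simp: L2_iff)
  then show ?thesis by simp
qed

lemma L2_Cauchy_Schwarz:
  assumes "u \<in> L2 \<Omega>" "v \<in> L2 \<Omega>"
  shows "\<bar>L2_inner \<Omega> u v\<bar> \<le> L2_norm \<Omega> u * L2_norm \<Omega> v"
proof -
  let ?A = "(L2_norm \<Omega> u)\<^sup>2" and ?B = "L2_inner \<Omega> u v" and ?C = "(L2_norm \<Omega> v)\<^sup>2"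
  have q: "0 \<le> a\<^sup>2 * ?A + 2 * a * b * ?B + b\<^sup>2 * ?C" for a b
    using L2_norm_lin_sq[OF assms, of a b] by (metis zero_le_power2)
  have "?B\<^sup>2 \<le> ?A * ?C"
  proof (cases "?C = 0")
    case True
    have "?B = 0"
    proof (rule ccontr)
      assume n: "?B \<noteq> 0"
      have "0 \<le> ?A + 2 * (- (?A + 1) / (2 * ?B)) * ?B"
        using q[of 1 "- (?A + 1) / (2 * ?B)"] True by simp
      then show False using n by (simp add: field_simps)
    qed
    then show ?thesis by simp
  next
    case False
    then have C: "?C > 0" by (simp add: L2_norm_nonneg)
    have "0 \<le> ?C\<^sup>2 * ?A + 2 * ?C * (- ?B) * ?B + (- ?B)\<^sup>2 * ?C" by (rule q)
    also have "\<dots> = ?C * (?A * ?C - ?B\<^sup>2)" by (simp add: power2_eq_square algebra_simps)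
    finally show ?thesis using C by (simp add: zero_le_mult_iff)
  qed
  then have "?B\<^sup>2 \<le> (L2_norm \<Omega> u * L2_norm \<Omega> v)\<^sup>2" by (simp add: power_mult_distrib)
  then show ?thesis by (simp add: L2_norm_nonneg power2_le_iff_abs_le)
qed

lemma L2_triangle:
  assumes "u \<in> L2 \<Omega>" "v \<in> L2 \<Omega>"
  shows "L2_norm \<Omega> (\<lambda>x. u x + v x) \<le> L2_norm \<Omega> u + L2_norm \<Omega> v"
proof -
  have "(L2_norm \<Omega> (\<lambda>x. u x + v x))\<^sup>2 = (L2_norm \<Omega> u)\<^sup>2 + 2 * L2_inner \<Omega> u v + (L2_norm \<Omega> v)\<^sup>2"
    using L2_norm_lin_sq[OF assms, of 1 1] by simp
  also have "\<dots> \<le> (L2_norm \<Omega> u + L2_norm \<Omega> v)\<^sup>2"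
    using L2_Cauchy_Schwarz[OF assms] by (simp add: power2_sum)
  finally show ?thesis by (rule power2_le_imp_le) (simp add: L2_norm_nonneg)
qed

lemma L2_triangle_diff:
  assumes "u \<in> L2 \<Omega>" "v \<in> L2 \<Omega>"
  shows "L2_norm \<Omega> (\<lambda>x. u x - v x) \<le> L2_norm \<Omega> u + L2_norm \<Omega> v"
  using L2_triangle[OF assms(1) L2_scale[OF assms(2), of "-1"]] L2_norm_scale[of \<Omega> "-1" v] by simp

text \<open>
  The difference is paired with itself.
\<close>

lemma L2_eq_AE_if_inner_eq:
  assumes "u \<in> L2 \<Omega>" "v \<in> L2 \<Omega>" "\<And>z. z \<in> L2 \<Omega> \<Longrightarrow> L2_inner \<Omega> u z = L2_inner \<Omega> v z"
  shows "AE x in lebesgue_on \<Omega>. u x = v x"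
proof -
  define d where "d = (\<lambda>x. u x - v x)"
  have d: "d \<in> L2 \<Omega>" unfolding d_def by (rule L2_diff[OF assms(1,2)])
  have "(L2_norm \<Omega> d)\<^sup>2 = L2_inner \<Omega> u d - L2_inner \<Omega> v d"
    unfolding L2_norm_sq_inner by (subst d_def) (rule L2_inner_diff_left[OF assms(1,2) d])
  then have "L2_norm \<Omega> d = 0" using assms(3)[OF d] by simp
  from L2_norm_zero_AE[OF d this] show ?thesis by (auto simp: d_def)
qed

lemma L2_bounded:
  assumes "\<Omega> \<in> lmeasurable" "u \<in> borel_measurable (lebesgue_on \<Omega>)"
    "AE x in lebesgue_on \<Omega>. \<bar>u x\<bar> \<le> B" "0 \<le> B"
  shows "u \<in> L2 \<Omega>" "L2_norm \<Omega> u \<le> B * sqrt (measure lebesgue \<Omega>)"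
proof -
  interpret finite_measure "lebesgue_on \<Omega>"
    using assms(1) by (rule finite_measure_lebesgue_on)
  have s: "AE x in lebesgue_on \<Omega>. (u x)\<^sup>2 \<le> B\<^sup>2"
    using assms(3) by eventually_elim (metis abs_ge_zero power2_abs power_mono)
  have i: "integrable (lebesgue_on \<Omega>) (\<lambda>x. (u x)\<^sup>2)"
    by (rule integrable_const_bound[where B = "B\<^sup>2"]) (use s assms(2) in auto)
  then show "u \<in> L2 \<Omega>" using assms(2) by (simp add: L2_iff)
  have "(\<integral>x. (u x)\<^sup>2 \<partial>lebesgue_on \<Omega>) \<le> (\<integral>x. B\<^sup>2 \<partial>lebesgue_on \<Omega>)"
    by (rule integral_mono_AE[OF i _ s]) simp
  also have "\<dots> = B\<^sup>2 * measure lebesgue \<Omega>"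
    using assms(1) by (simp add: measure_restrict_space fmeasurableD)
  finally have "sqrt (\<integral>x. (u x)\<^sup>2 \<partial>lebesgue_on \<Omega>) \<le> sqrt (B\<^sup>2 * measure lebesgue \<Omega>)"
    by simp
  then show "L2_norm \<Omega> u \<le> B * sqrt (measure lebesgue \<Omega>)"
    using assms(4) by (simp add: L2_norm_eq real_sqrt_mult)
qed

lemma L2_integrable:
  assumes "\<Omega> \<in> lmeasurable" "u \<in> L2 \<Omega>"
  shows "integrable (lebesgue_on \<Omega>) u"
proof -
  have "(\<lambda>x. 1) \<in> L2 \<Omega>" using L2_bounded(1)[OF assms(1), of "\<lambda>x. 1" 1] by simp
  from L2_mult_integrable[OF assms(2) this] show ?thesis by simp
qed

lemma L1_le_L2:
  assumes "\<Omega> \<in> lmeasurable" "u \<in> L2 \<Omega>"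
  shows "(\<integral>x. \<bar>u x\<bar> \<partial>lebesgue_on \<Omega>) \<le> sqrt (measure lebesgue \<Omega>) * L2_norm \<Omega> u"
proof -
  have o: "(\<lambda>x. 1) \<in> L2 \<Omega>" "L2_norm \<Omega> (\<lambda>x. 1) \<le> sqrt (measure lebesgue \<Omega>)"
    using L2_bounded[OF assms(1), of "\<lambda>x. 1" 1] by simp_all
  have a: "(\<lambda>x. \<bar>u x\<bar>) \<in> L2 \<Omega>" using assms(2) borel_measurable_abs by (auto simp: L2_iff)
  have "(\<integral>x. \<bar>u x\<bar> \<partial>lebesgue_on \<Omega>) = L2_inner \<Omega> (\<lambda>x. \<bar>u x\<bar>) (\<lambda>x. 1)"
    by (simp add: L2_inner_def)
  also have "\<dots> \<le> L2_norm \<Omega> (\<lambda>x. \<bar>u x\<bar>) * L2_norm \<Omega> (\<lambda>x. 1)"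
    using L2_Cauchy_Schwarz[OF a o(1)] by simp
  also have "L2_norm \<Omega> (\<lambda>x. \<bar>u x\<bar>) = L2_norm \<Omega> u" by (simp add: L2_norm_eq)
  also have "L2_norm \<Omega> u * L2_norm \<Omega> (\<lambda>x. 1) \<le> L2_norm \<Omega> u * sqrt (measure lebesgue \<Omega>)"
    by (rule mult_left_mono[OF o(2) L2_norm_nonneg])
  finally show ?thesis by (simp add: mult.commute)
qed

lemma L2_sum:
  assumes "finite I" "\<And>i. i \<in> I \<Longrightarrow> g i \<in> L2 \<Omega>"
  shows "(\<lambda>x. \<Sum>i\<in>I. g i x) \<in> L2 \<Omega>"
  using assms
proof (induction I rule: finite_induct)
  case empty
  then show ?case by (simp add: L2_iff)
next
  case (insert i I)
  then have "(\<lambda>x. g i x + (\<Sum>i\<in>I. g i x)) \<in> L2 \<Omega>" by (intro L2_add) auto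
  then show ?case using insert by simp
qed

lemma L2_norm_sum_le:
  assumes "finite I" "\<And>i. i \<in> I \<Longrightarrow> g i \<in> L2 \<Omega>"
  shows "L2_norm \<Omega> (\<lambda>x. \<Sum>i\<in>I. g i x) \<le> (\<Sum>i\<in>I. L2_norm \<Omega> (g i))"
  using assms
proof (induction I rule: finite_induct)
  case empty
  then show ?case by (simp add: L2_norm_eq)
next
  case (insert i I)
  have "L2_norm \<Omega> (\<lambda>x. g i x + (\<Sum>i\<in>I. g i x))
      \<le> L2_norm \<Omega> (g i) + L2_norm \<Omega> (\<lambda>x. \<Sum>i\<in>I. g i x)"
    using insert by (intro L2_triangle L2_sum) auto
  then show ?case using insert by simp
qed

text \<open>
  Completeness of \<open>L\<^sup>2\<close>, in the form of the Weierstrass test: the series converges almost everywhere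
  because it converges absolutely in \<open>L\<^sup>1\<close>, and Fatou's lemma turns the bound on the Cauchy
  differences into a bound on the remainder.
\<close>

lemma L2_series:
  assumes \<Omega>: "\<Omega> \<in> lmeasurable" and g: "\<And>k::nat. g k \<in> L2 \<Omega>"
    and gc: "\<And>k. L2_norm \<Omega> (g k) \<le> c k" and c: "summable c"
  obtains x where "x \<in> L2 \<Omega>"
    "\<And>n. L2_norm \<Omega> (\<lambda>t. x t - (\<Sum>k<n. g k t)) \<le> (\<Sum>k. c (k + n))"
proof -
  let ?M = "lebesgue_on \<Omega>"
  have c0: "0 \<le> c k" for k using gc[of k] L2_norm_nonneg[of \<Omega> "g k"] by linarith
  have [measurable]: "g k \<in> borel_measurable ?M" for k by (rule L2_measurable[OF g])
  define s where "s n t = (\<Sum>k<n. g k t)" for n t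
  define x where "x t = (\<Sum>k. g k t)" for t
  define \<rho> where "\<rho> n = (\<Sum>k. c (k + n))" for n
  have [measurable]: "s n \<in> borel_measurable ?M" for n unfolding s_def by measurable
  have [measurable]: "x \<in> borel_measurable ?M" unfolding x_def by measurable
  have sL: "s n \<in> L2 \<Omega>" for n unfolding s_def by (rule L2_sum) (auto intro: g)
  have \<rho>0: "0 \<le> \<rho> n" for n
    unfolding \<rho>_def by (rule suminf_nonneg) (use c c0 summable_iff_shift in auto)
  have Cauchy: "L2_norm \<Omega> (\<lambda>t. s m t - s n t) \<le> \<rho> n" if "n \<le> m" for m n
  proof -
    have "s m t - s n t = (\<Sum>k\<in>{n..<m}. g k t)" for t
      unfolding s_def using that
      by (metis atLeast0LessThan sum_diff_nat_ivl zero_le)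
    then have "L2_norm \<Omega> (\<lambda>t. s m t - s n t) = L2_norm \<Omega> (\<lambda>t. \<Sum>k\<in>{n..<m}. g k t)" by simp
    also have "\<dots> \<le> (\<Sum>k\<in>{n..<m}. L2_norm \<Omega> (g k))" by (rule L2_norm_sum_le) (auto intro: g)
    also have "\<dots> \<le> (\<Sum>k\<in>{n..<m}. c k)" by (rule sum_mono[OF gc])
    also have "\<dots> = (\<Sum>k<m-n. c (k + n))"
      using that sum.shift_bounds_nat_ivl[of c 0 n "m - n"] by (simp add: atLeast0LessThan)
    also have "\<dots> \<le> \<rho> n"
      unfolding \<rho>_def by (rule sum_le_suminf) (use c c0 summable_iff_shift in auto)
    finally show ?thesis .
  qed
  have "(\<integral>\<^sup>+t. (\<Sum>k. ennreal \<bar>g k t\<bar>) \<partial>?M) = (\<Sum>k. (\<integral>\<^sup>+t. ennreal \<bar>g k t\<bar> \<partial>?M))"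
    by (rule nn_integral_suminf) measurable
  also have "\<dots> = (\<Sum>k. ennreal (\<integral>t. \<bar>g k t\<bar> \<partial>?M))"
    by (subst nn_integral_eq_integral) (auto intro: integrable_abs L2_integrable[OF \<Omega> g])
  also have "\<dots> \<noteq> \<infinity>"
  proof -
    have "summable (\<lambda>k. \<integral>t. \<bar>g k t\<bar> \<partial>?M)"
    proof (rule summable_comparison_test')
      show "summable (\<lambda>k. sqrt (measure lebesgue \<Omega>) * c k)" using c by (rule summable_mult)
      have "(\<integral>t. \<bar>g k t\<bar> \<partial>?M) \<le> sqrt (measure lebesgue \<Omega>) * c k" for k
        using L1_le_L2[OF \<Omega> g, of k] mult_left_mono[OF gc[of k], of "sqrt (measure lebesgue \<Omega>)"]
        by simp
      then show "norm (\<integral>t. \<bar>g k t\<bar> \<partial>?M) \<le> sqrt (measure lebesgue \<Omega>) * c k" if "k \<ge> 0" for k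
        by simp
    qed
    then show ?thesis by (simp add: suminf_ennreal_eq[OF _ summable_sums])
  qed
  finally have "AE t in ?M. (\<Sum>k. ennreal \<bar>g k t\<bar>) \<noteq> \<infinity>"
    by (intro nn_integral_noteq_infinite) measurable
  then have lim: "AE t in ?M. (\<lambda>n. s n t) \<longlonglongrightarrow> x t"
  proof eventually_elim
    case (elim t)
    then have "summable (\<lambda>k. \<bar>g k t\<bar>)" by (intro summable_suminf_not_top) auto
    then have "summable (\<lambda>k. g k t)" by (rule summable_rabs_cancel)
    then show ?case unfolding s_def x_def by (rule summable_LIMSEQ)
  qed
  have nn: "(\<integral>\<^sup>+t. ennreal ((x t - s n t)\<^sup>2) \<partial>?M) \<le> ennreal ((\<rho> n)\<^sup>2)" for n
  proof -
    have "(\<integral>\<^sup>+t. ennreal ((x t - s n t)\<^sup>2) \<partial>?M)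
        = (\<integral>\<^sup>+t. liminf (\<lambda>m. ennreal ((s m t - s n t)\<^sup>2)) \<partial>?M)"
    proof (rule nn_integral_cong_AE, use lim in eventually_elim)
      case (elim t)
      have "(\<lambda>m. ennreal ((s m t - s n t)\<^sup>2)) \<longlonglongrightarrow> ennreal ((x t - s n t)\<^sup>2)"
        by (intro tendsto_intros tendsto_ennrealI elim)
      then show ?case by (intro lim_imp_Liminf[symmetric]) simp_all
    qed
    also have "\<dots> \<le> liminf (\<lambda>m. \<integral>\<^sup>+t. ennreal ((s m t - s n t)\<^sup>2) \<partial>?M)"
      by (rule nn_integral_liminf) measurable
    also have "\<dots> \<le> ennreal ((\<rho> n)\<^sup>2)"
    proof (rule Liminf_le, simp, rule eventually_sequentiallyI)
      fix m assume m: "n \<le> m"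
      have "(\<integral>\<^sup>+t. ennreal ((s m t - s n t)\<^sup>2) \<partial>?M) = ennreal (\<integral>t. (s m t - s n t)\<^sup>2 \<partial>?M)"
        using L2_diff[OF sL sL, of m n] by (intro nn_integral_eq_integral) (auto simp: L2_iff)
      also have "(\<integral>t. (s m t - s n t)\<^sup>2 \<partial>?M) = (L2_norm \<Omega> (\<lambda>t. s m t - s n t))\<^sup>2"
        by (simp add: L2_norm_sq)
      also have "\<dots> \<le> (\<rho> n)\<^sup>2" by (rule power_mono[OF Cauchy[OF m] L2_norm_nonneg])
      finally show "(\<integral>\<^sup>+t. ennreal ((s m t - s n t)\<^sup>2) \<partial>?M) \<le> ennreal ((\<rho> n)\<^sup>2)"
        by (simp add: ennreal_leI)
    qed
    finally show ?thesis .
  qed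
  have int: "integrable ?M (\<lambda>t. (x t - s n t)\<^sup>2)" for n
    using nn[of n] by (intro integrableI_nonneg) (auto simp: le_less_trans)
  have "(\<integral>t. (x t - s n t)\<^sup>2 \<partial>?M) \<le> (\<rho> n)\<^sup>2" for n
    using nn[of n] nn_integral_eq_integral[OF int[of n]] by (simp add: ennreal_le_iff)
  then have le: "L2_norm \<Omega> (\<lambda>t. x t - s n t) \<le> \<rho> n" for n
    using \<rho>0[of n] by (simp add: L2_norm_eq real_le_lsqrt)
  have "x \<in> L2 \<Omega>" using int[of 0] by (simp add: L2_iff s_def)
  with le show ?thesis by (intro that[of x]) (simp_all add: s_def \<rho>_def)
qed

text \<open>
  The uniform boundedness principle for functionals on \<open>L\<^sup>2\<close>. If the norms were unbounded, take
  \<open>b n\<close> of norm at least \<open>4\<^sup>n\<close> and add the unit vectors along the \<open>b n\<close> with weights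
  \<open>\<plusminus>3\<^sup>-\<^sup>n\<close>. The sign keeps the partial sum up to \<open>n\<close> from being nearly orthogonal to \<open>b n\<close>, and
  the remaining terms are too small to undo this, so the sum of the series is not weakly bounded.
\<close>

lemma L2_uniform_boundedness:
  assumes \<Omega>: "\<Omega> \<in> lmeasurable" and B: "B \<subseteq> L2 \<Omega>"
    and weak: "\<And>z. z \<in> L2 \<Omega> \<Longrightarrow> \<exists>C. \<forall>b\<in>B. \<bar>L2_inner \<Omega> b z\<bar> \<le> C"
  shows "\<exists>K. \<forall>b\<in>B. L2_norm \<Omega> b \<le> K"
proof (rule ccontr)
  assume "\<not> ?thesis"
  then have "\<exists>b. b \<in> B \<and> 4 ^ n < L2_norm \<Omega> b" for n :: nat by (meson not_le)
  then obtain b where b: "\<And>n::nat. b n \<in> B" "\<And>n::nat. 4 ^ n < L2_norm \<Omega> (b n)" by metis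
  have bL: "b n \<in> L2 \<Omega>" for n using b B by auto
  define e where "e n = (\<lambda>t. (1 / (3 ^ n * L2_norm \<Omega> (b n))) * b n t)" for n
  have eL: "e n \<in> L2 \<Omega>" for n unfolding e_def by (rule L2_scale[OF bL])
  have pos: "L2_norm \<Omega> (b n) > 0" for n
    using b(2)[of n] by (meson less_trans zero_less_numeral zero_less_power)
  have en: "L2_norm \<Omega> (e n) = (1/3) ^ n" for n
    unfolding e_def L2_norm_scale using pos[of n] by (simp add: power_divide)
  have eb: "L2_inner \<Omega> (e n) (b n) = (1/3) ^ n * L2_norm \<Omega> (b n)" for n
    unfolding e_def L2_inner_scale_left L2_norm_sq_inner[symmetric]
    using pos[of n] by (simp add: power_divide power2_eq_square)
  \<comment> \<open>Each sign is chosen to agree with that of the pairing of \<open>b n\<close> with the earlier partial sum.\<close>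
  define P where "P = rec_nat (\<lambda>t. 0 :: real)
    (\<lambda>n p t. p t + (if L2_inner \<Omega> p (b n) \<ge> 0 then 1 else -1) * e n t)"
  define \<epsilon> where "\<epsilon> n = (if L2_inner \<Omega> (P n) (b n) \<ge> 0 then 1 else -1 :: real)" for n
  have P0: "P 0 = (\<lambda>t. 0)" and PS: "P (Suc n) = (\<lambda>t. P n t + \<epsilon> n * e n t)" for n
    by (simp_all add: P_def \<epsilon>_def)
  have Ps: "P n = (\<lambda>t. \<Sum>k<n. \<epsilon> k * e k t)" for n
    by (induction n) (simp_all add: P0 PS)
  have gL: "(\<lambda>t. \<epsilon> k * e k t) \<in> L2 \<Omega>" for k by (rule L2_scale[OF eL])
  have PL: "P n \<in> L2 \<Omega>" for n unfolding Ps by (rule L2_sum) (auto intro: gL)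
  have Pb: "\<bar>L2_inner \<Omega> (P (Suc n)) (b n)\<bar> \<ge> (1/3) ^ n * L2_norm \<Omega> (b n)" for n
  proof -
    have "L2_inner \<Omega> (P (Suc n)) (b n)
        = L2_inner \<Omega> (P n) (b n) + \<epsilon> n * ((1/3) ^ n * L2_norm \<Omega> (b n))"
      unfolding PS using L2_inner_lin_left[OF PL eL bL, of 1 n "\<epsilon> n" n n] by (simp add: eb)
    moreover have "0 \<le> (1/3) ^ n * L2_norm \<Omega> (b n)" using pos[of n] by simp
    ultimately show ?thesis by (auto simp: \<epsilon>_def)
  qed
  have gn: "L2_norm \<Omega> (\<lambda>t. \<epsilon> k * e k t) \<le> (1/3) ^ k" for k
    unfolding L2_norm_scale en by (simp add: \<epsilon>_def)
  have "summable (\<lambda>k. (1/3::real) ^ k)" by simp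
  from L2_series[where g = "\<lambda>k t. \<epsilon> k * e k t", OF \<Omega> gL gn this] obtain x where x: "x \<in> L2 \<Omega>"
    and xP: "\<And>n. L2_norm \<Omega> (\<lambda>t. x t - P n t) \<le> (\<Sum>k. (1/3) ^ (k + n))"
    by (auto simp: Ps)
  have tail: "(\<Sum>k. (1/3::real) ^ (k + Suc n)) = (1/2) * (1/3) ^ n" for n
  proof -
    have "(\<Sum>k. (1/3::real) ^ (k + Suc n)) = (\<Sum>k. (1/3) ^ k * (1/3) ^ Suc n)"
      by (simp add: power_add)
    also have "\<dots> = (\<Sum>k. (1/3) ^ k) * (1/3) ^ Suc n"
      by (rule suminf_mult2[symmetric]) simp
    also have "\<dots> = (1/2) * (1/3) ^ n" by (simp add: suminf_geometric)
    finally show ?thesis .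
  qed
  have large: "\<bar>L2_inner \<Omega> (b n) x\<bar> \<ge> (1/2) * (4/3) ^ n" for n
  proof -
    have d: "(\<lambda>t. x t - P (Suc n) t) \<in> L2 \<Omega>" by (rule L2_diff[OF x PL])
    have "\<bar>L2_inner \<Omega> (\<lambda>t. x t - P (Suc n) t) (b n)\<bar>
        \<le> L2_norm \<Omega> (\<lambda>t. x t - P (Suc n) t) * L2_norm \<Omega> (b n)"
      by (rule L2_Cauchy_Schwarz[OF d bL])
    also have "\<dots> \<le> (1/2) * (1/3) ^ n * L2_norm \<Omega> (b n)"
      using xP[of "Suc n"] unfolding tail by (rule mult_right_mono) (rule L2_norm_nonneg)
    finally have "\<bar>L2_inner \<Omega> x (b n) - L2_inner \<Omega> (P (Suc n)) (b n)\<bar>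
        \<le> (1/2) * (1/3) ^ n * L2_norm \<Omega> (b n)"
      by (simp add: L2_inner_diff_left[OF x PL bL])
    with Pb[of n] have "\<bar>L2_inner \<Omega> x (b n)\<bar> \<ge> (1/2) * (1/3) ^ n * L2_norm \<Omega> (b n)" by linarith
    moreover have "(1/2) * (1/3) ^ n * L2_norm \<Omega> (b n) \<ge> (1/2) * (1/3) ^ n * 4 ^ n"
      using b(2)[of n] by (intro mult_left_mono) auto
    moreover have "(1/2) * (1/3) ^ n * 4 ^ n = (1/2) * (4/3::real) ^ n" by (simp add: power_divide)
    ultimately have "(1/2) * (4/3) ^ n \<le> \<bar>L2_inner \<Omega> x (b n)\<bar>" by linarith
    then show ?thesis by (simp only: L2_inner_commute)
  qed
  obtain C where C: "\<And>n. \<bar>L2_inner \<Omega> (b n) x\<bar> \<le> C" using weak[OF x] b(1) by blast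
  obtain n :: nat where "2 * C < (4/3) ^ n" using real_arch_pow[of "4/3" "2 * C"] by auto
  then show False using large[of n] C[of n] by linarith
qed

section \<open>Symmetric operators\<close>

text \<open>
  Only the pairings matter, as the operators act on functions that are determined up to null sets.
\<close>

definition symmetric_L2 :: "(real^2) set \<Rightarrow> ((real^2 \<Rightarrow> real) \<Rightarrow> (real^2 \<Rightarrow> real)) \<Rightarrow> bool" where
  "symmetric_L2 \<Omega> A \<longleftrightarrow> (\<forall>u\<in>L2 \<Omega>. A u \<in> L2 \<Omega>) \<and>
     (\<forall>u\<in>L2 \<Omega>. \<forall>v\<in>L2 \<Omega>. L2_inner \<Omega> (A u) v = L2_inner \<Omega> u (A v))"

lemma symmetric_L2_in: "symmetric_L2 \<Omega> A \<Longrightarrow> u \<in> L2 \<Omega> \<Longrightarrow> A u \<in> L2 \<Omega>"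
  by (simp add: symmetric_L2_def)

lemma symmetric_L2_inner:
  "symmetric_L2 \<Omega> A \<Longrightarrow> u \<in> L2 \<Omega> \<Longrightarrow> v \<in> L2 \<Omega> \<Longrightarrow> L2_inner \<Omega> (A u) v = L2_inner \<Omega> u (A v)"
  by (simp add: symmetric_L2_def)

text \<open>
  A symmetric operator that is defined everywhere is linear: both sides have the same pairing with
  every \<open>z\<close>, since \<open>A\<close> can be moved to \<open>z\<close>.
\<close>

lemma symmetric_L2_linear:
  assumes A: "symmetric_L2 \<Omega> A" and u: "u \<in> L2 \<Omega>" and v: "v \<in> L2 \<Omega>"
  shows "AE x in lebesgue_on \<Omega>. A (\<lambda>x. a * u x + b * v x) x = a * A u x + b * A v x"
proof (rule L2_eq_AE_if_inner_eq)
  note in_L2 = symmetric_L2_in[OF A]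
  show "A (\<lambda>x. a * u x + b * v x) \<in> L2 \<Omega>" "(\<lambda>x. a * A u x + b * A v x) \<in> L2 \<Omega>"
    using u v by (auto intro!: in_L2 L2_lin)
  fix z assume z: "z \<in> L2 \<Omega>"
  show "L2_inner \<Omega> (A (\<lambda>x. a * u x + b * v x)) z = L2_inner \<Omega> (\<lambda>x. a * A u x + b * A v x) z"
    using u v z in_L2
    by (simp add: symmetric_L2_inner[OF A] L2_lin L2_inner_lin_left)
qed

text \<open>
  For the normalized images \<open>A i u / \<parallel>u\<parallel>\<close>, boundedness of the pairings with \<open>z\<close> is, by symmetry, the
  pointwise boundedness of the operators at \<open>z\<close>.
\<close>

lemma symmetric_L2_uniformly_bounded:
  assumes \<Omega>: "\<Omega> \<in> lmeasurable" and A: "\<And>i. i \<in> I \<Longrightarrow> symmetric_L2 \<Omega> (A i)"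
    and pointwise: "\<And>u. u \<in> L2 \<Omega> \<Longrightarrow> \<exists>C. \<forall>i\<in>I. L2_norm \<Omega> (A i u) \<le> C"
  shows "\<exists>K>0. \<forall>i\<in>I. \<forall>u\<in>L2 \<Omega>. L2_norm \<Omega> (A i u) \<le> K * L2_norm \<Omega> u"
proof -
  define B where "B = {(\<lambda>x. (1 / L2_norm \<Omega> u) * A i u x) |i u. i \<in> I \<and> u \<in> L2 \<Omega> \<and> L2_norm \<Omega> u \<noteq> 0}"
  have "\<exists>K. \<forall>b\<in>B. L2_norm \<Omega> b \<le> K"
  proof (rule L2_uniform_boundedness[OF \<Omega>])
    show "B \<subseteq> L2 \<Omega>" by (auto simp: B_def simp del: times_divide_eq_left intro!: L2_scale symmetric_L2_in[OF A])
    fix z assume z: "z \<in> L2 \<Omega>"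
    then obtain C where C: "\<And>i. i \<in> I \<Longrightarrow> L2_norm \<Omega> (A i z) \<le> C" using pointwise by blast
    have "\<bar>L2_inner \<Omega> b z\<bar> \<le> C" if bB: "b \<in> B" for b
    proof -
      obtain i u where i: "i \<in> I" "u \<in> L2 \<Omega>" "L2_norm \<Omega> u \<noteq> 0"
        and b: "b = (\<lambda>x. (1 / L2_norm \<Omega> u) * A i u x)"
        using bB by (auto simp: B_def)
      have "\<bar>L2_inner \<Omega> b z\<bar> = (1 / L2_norm \<Omega> u) * \<bar>L2_inner \<Omega> u (A i z)\<bar>"
        unfolding b L2_inner_scale_left symmetric_L2_inner[OF A[OF i(1)] i(2) z] abs_mult
        using L2_norm_nonneg[of \<Omega> u] by simp
      also have "\<dots> \<le> (1 / L2_norm \<Omega> u) * (L2_norm \<Omega> u * L2_norm \<Omega> (A i z))"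
        using L2_norm_nonneg[of \<Omega> u]
        by (intro mult_left_mono L2_Cauchy_Schwarz i symmetric_L2_in[OF A] z) auto
      also have "\<dots> \<le> C" using i C[of i] by simp
      finally show ?thesis .
    qed
    then show "\<exists>C. \<forall>b\<in>B. \<bar>L2_inner \<Omega> b z\<bar> \<le> C" by blast
  qed
  then obtain K where K: "\<And>b. b \<in> B \<Longrightarrow> L2_norm \<Omega> b \<le> K" by blast
  have "L2_norm \<Omega> (A i u) \<le> max K 1 * L2_norm \<Omega> u" if i: "i \<in> I" "u \<in> L2 \<Omega>" for i u
  proof (cases "L2_norm \<Omega> u = 0")
    case True
    have "(L2_norm \<Omega> (A i u))\<^sup>2 = L2_inner \<Omega> u (A i (A i u))"
      unfolding L2_norm_sq_inner using i
      by (intro symmetric_L2_inner[OF A] symmetric_L2_in[OF A]) auto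
    also have "\<dots> \<le> L2_norm \<Omega> u * L2_norm \<Omega> (A i (A i u))"
      using L2_Cauchy_Schwarz[OF i(2), of "A i (A i u)"] i symmetric_L2_in[OF A] by fastforce
    finally show ?thesis using True by simp
  next
    case False
    then have "(\<lambda>x. (1 / L2_norm \<Omega> u) * A i u x) \<in> B" unfolding B_def using i by blast
    from K[OF this] have "(1 / L2_norm \<Omega> u) * L2_norm \<Omega> (A i u) \<le> max K 1"
      unfolding L2_norm_scale using L2_norm_nonneg[of \<Omega> u] by simp
    then show ?thesis using False L2_norm_nonneg[of \<Omega> u] by (simp add: field_simps)
  qed
  then show ?thesis by (intro exI[of _ "max K 1"]) auto
qed

section \<open>Smooth functions and integration by parts\<close>

lemma grad_eq: "(f has_derivative f') (at x) \<Longrightarrow> grad f x $ i = f' (axis i 1)"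
  by (simp add: grad_def frechet_derivative_at[symmetric])

lemma grad_add:
  assumes "f differentiable (at x)" "g differentiable (at x)"
  shows "grad (\<lambda>x. f x + g x) x $ i = grad f x $ i + grad g x $ i"
  using grad_eq[OF has_derivative_add[OF assms[unfolded frechet_derivative_works]]]
  by (simp add: grad_def)

lemma grad_mult:
  assumes "f differentiable (at x)" "g differentiable (at x)"
  shows "grad (\<lambda>x. f x * g x) x $ i = f x * grad g x $ i + g x * grad f x $ i"
  using grad_eq[OF has_derivative_mult[OF assms[unfolded frechet_derivative_works]]]
  by (simp add: grad_def mult.commute)

lemma Ck_continuous: "Ck k f \<Longrightarrow> continuous_on UNIV f"
  by (cases k) (auto simp: differentiable_imp_continuous_within intro!: differentiable_imp_continuous_on
      simp: differentiable_on_def)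

lemma Ck_SucD: "Ck (Suc k) f \<Longrightarrow> Ck k f"
proof (induction k arbitrary: f)
  case 0
  then show ?case using Ck_continuous by (metis Ck.simps(1))
next
  case (Suc k)
  then show ?case by (metis Ck.simps(2))
qed

lemma Ck_const: "Ck k (\<lambda>x. c)"
proof (induction k arbitrary: c)
  case (Suc k)
  have "grad (\<lambda>x. c) x $ i = 0" for x i by (subst grad_eq[OF has_derivative_const]) simp
  then show ?case using Suc by simp
qed auto

lemma Ck_add: "Ck k f \<Longrightarrow> Ck k g \<Longrightarrow> Ck k (\<lambda>x. f x + g x)"
  by (induction k arbitrary: f g) (auto intro!: continuous_intros simp: grad_add)

text \<open>
  The induction over \<open>k\<close> needs the product rule and the fact that the factors themselves, not only
  their gradients, are of class \<open>C\<^sup>k\<close>.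
\<close>

lemma Ck_mult: "Ck k f \<Longrightarrow> Ck k g \<Longrightarrow> Ck k (\<lambda>x. f x * g x)"
proof (induction k arbitrary: f g)
  case (Suc k)
  from Suc.prems have d: "f differentiable (at x)" "g differentiable (at x)" for x by auto
  have "Ck k (\<lambda>x. f x * grad g x $ i + g x * grad f x $ i)" for i
    using Suc.prems Ck_SucD[OF Suc.prems(1)] Ck_SucD[OF Suc.prems(2)]
    by (intro Ck_add Suc.IH) simp_all
  then show ?case using d by (simp add: grad_mult)
qed (auto intro!: continuous_intros)

lemma Ck_prod:
  assumes "finite I" "\<And>i. i \<in> I \<Longrightarrow> Ck k (f i)"
  shows "Ck k (\<lambda>x. \<Prod>i\<in>I. f i x)"
  using assms by (induction I rule: finite_induct) (auto intro: Ck_const Ck_mult)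

text \<open>
  The family \<open>t\<^sup>-\<^sup>n exp (-1/t)\<close> on the positive half-line, extended by zero, is closed under
  differentiation up to linear combinations; so each member is smooth.
\<close>

definition flat_exp :: "nat \<Rightarrow> real \<Rightarrow> real" where
  "flat_exp n t = (if t > 0 then inverse t ^ n * exp (- inverse t) else 0)"

lemma flat_exp_tendsto_0: "(flat_exp n \<longlongrightarrow> 0) (at 0)"
proof -
  have "((\<lambda>x::real. x ^ n / exp x) \<longlongrightarrow> 0) at_top" by (rule tendsto_power_div_exp_0)
  then have "((\<lambda>t. inverse t ^ n / exp (inverse t)) \<longlongrightarrow> (0::real)) (at_right 0)"
    by (rule filterlim_compose[OF _ filterlim_inverse_at_top_right])
  then have "(flat_exp n \<longlongrightarrow> 0) (at_right 0)"
    by (rule Lim_transform_eventually)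
      (auto simp: flat_exp_def eventually_at_right_field exp_minus divide_inverse intro: exI[of _ 1])
  moreover have "(flat_exp n \<longlongrightarrow> 0) (at_left 0)"
    by (rule Lim_transform_eventually[OF tendsto_const])
      (auto simp: flat_exp_def eventually_at_left_field intro: exI[of _ "-1"])
  ultimately show ?thesis by (simp add: filterlim_split_at)
qed

lemma flat_exp_has_derivative:
  "(flat_exp n has_real_derivative (flat_exp (n + 2) t - n * flat_exp (n + 1) t)) (at t)"
proof (cases t "0::real" rule: linorder_cases)
  case less
  have "((\<lambda>t. 0) has_real_derivative (flat_exp (n + 2) t - n * flat_exp (n + 1) t)) (at t)"
    using less by (simp add: flat_exp_def)
  then show ?thesis
    by (rule has_field_derivative_transform_within_open[where S = "{..<0}"])
      (use less in \<open>auto simp: flat_exp_def\<close>)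
next
  case equal
  have "(flat_exp n has_real_derivative 0) (at 0)"
    unfolding has_field_derivative_iff
  proof (rule Lim_transform_eventually[OF flat_exp_tendsto_0[of "Suc n"]])
    show "\<forall>\<^sub>F x in at 0. flat_exp (Suc n) x = (flat_exp n x - flat_exp n 0) / (x - 0)"
      by (auto simp: flat_exp_def divide_inverse eventually_at_filter)
  qed
  then show ?thesis using equal by (simp add: flat_exp_def)
next
  case greater
  have "((\<lambda>t. inverse t ^ n * exp (- inverse t)) has_real_derivative
     (flat_exp (n + 2) t - n * flat_exp (n + 1) t)) (at t)"
  proof -
    have 0: "(inverse has_real_derivative - (inverse t * 1 * inverse t)) (at t)"
      using greater DERIV_inverse'[OF DERIV_ident, of t] by simp
    have 1: "((\<lambda>t. inverse t ^ n) has_real_derivative - (n * inverse t ^ (n + 1))) (at t)"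
    proof (cases n)
      case (Suc m)
      have "((\<lambda>t. inverse t ^ Suc m) has_real_derivative
          real (Suc m) * (- (inverse t * 1 * inverse t) * inverse t ^ m)) (at t)"
        by (rule DERIV_cong[OF DERIV_power_Suc[OF 0]]) simp
      then show ?thesis unfolding Suc by (rule DERIV_cong) (simp add: mult_ac)
    qed simp
    have 2: "((\<lambda>t. exp (- inverse t)) has_real_derivative
        exp (- inverse t) * - (- (inverse t * 1 * inverse t))) (at t)"
      by (intro DERIV_fun_exp DERIV_minus 0)
    show ?thesis
      using greater
      by (intro DERIV_cong[OF DERIV_mult[OF 1 2]]) (simp add: flat_exp_def algebra_simps)
  qed
  then show ?thesis
    by (rule has_field_derivative_transform_within_open[where S = "{0<..}"])
      (use greater in \<open>auto simp: flat_exp_def\<close>)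
qed

lemma Ck_flat_exp: "Ck k (\<lambda>x. flat_exp n (c * x $ i + d))"
proof (induction k arbitrary: n)
  case 0
  have "continuous_on UNIV (flat_exp n)"
    by (rule DERIV_continuous_on[OF has_field_derivative_at_within[OF flat_exp_has_derivative]])
  moreover have "continuous_on UNIV (\<lambda>x::real^2. c * x $ i + d)"
    by (rule continuous_on_add[OF continuous_on_mult_left[OF continuous_on_component[OF continuous_on_id]]
          continuous_on_const])
  ultimately have "continuous_on UNIV (\<lambda>x::real^2. flat_exp n (c * x $ i + d))"
    by (rule continuous_on_compose2) simp
  then show ?case by simp
next
  case (Suc k)
  let ?D = "\<lambda>x. flat_exp (n + 2) (c * x $ i + d) - n * flat_exp (n + 1) (c * x $ i + d)"
  have der: "((\<lambda>x. flat_exp n (c * x $ i + d)) has_derivative (\<lambda>v. (c * v $ i) * ?D x)) (at x)" for x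
  proof (rule DERIV_compose_FDERIV[OF flat_exp_has_derivative])
    show "((\<lambda>x. c * x $ i + d) has_derivative (\<lambda>v. c * v $ i)) (at x)"
      by (intro has_derivative_add_const bounded_linear_imp_has_derivative
          bounded_linear_const_mult bounded_linear_vec_nth)
  qed
  have g: "grad (\<lambda>x. flat_exp n (c * x $ i + d)) x $ j
      = (if j = i then c else 0) * flat_exp (n + 2) (c * x $ i + d)
        + (if j = i then - c * n else 0) * flat_exp (n + 1) (c * x $ i + d)" for x j
    by (subst grad_eq[OF der]) (simp add: axis_def algebra_simps)
  have "Ck k (\<lambda>x. (if j = i then c else 0) * flat_exp (n + 2) (c * x $ i + d)
        + (if j = i then - c * n else 0) * flat_exp (n + 1) (c * x $ i + d))" for j
    by (rule Ck_add[OF Ck_mult[OF Ck_const Suc.IH] Ck_mult[OF Ck_const Suc.IH]])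
  moreover have "(\<lambda>x. flat_exp n (c * x $ i + d)) differentiable (at x)" for x
    using der by (rule differentiableI)
  ultimately show ?case unfolding Ck.simps g by blast
qed

text \<open>A product over the coordinates, so that smoothness reduces to functions of one variable.\<close>

definition bump :: "real^2 \<Rightarrow> real \<Rightarrow> real^2 \<Rightarrow> real" where
  "bump z \<rho> x = (\<Prod>i\<in>UNIV. flat_exp 0 (1 + (x $ i - z $ i) / \<rho>) * flat_exp 0 (1 - (x $ i - z $ i) / \<rho>))"

lemma flat_exp_0_bounds: "0 \<le> flat_exp 0 t" "flat_exp 0 t \<le> 1"
  by (auto simp: flat_exp_def)

lemma Ck_bump: "Ck k (bump z \<rho>)"
proof -
  have "(\<lambda>x::real^2. flat_exp 0 (1 + (x $ i - z $ i) / \<rho>)) = (\<lambda>x. flat_exp 0 ((1/\<rho>) * x $ i + (1 - z $ i / \<rho>)))"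
    "(\<lambda>x::real^2. flat_exp 0 (1 - (x $ i - z $ i) / \<rho>)) = (\<lambda>x. flat_exp 0 ((-1/\<rho>) * x $ i + (1 + z $ i / \<rho>)))" for i
    by (auto simp: diff_divide_distrib algebra_simps)
  then have "Ck k (\<lambda>x. \<Prod>i\<in>UNIV. flat_exp 0 (1 + (x $ i - z $ i) / \<rho>) * flat_exp 0 (1 - (x $ i - z $ i) / \<rho>))"
    by (intro Ck_prod Ck_mult) (simp_all only: Ck_flat_exp finite)
  then show ?thesis by (simp add: bump_def[abs_def])
qed

lemma bump_bounds: "0 \<le> bump z \<rho> x" "bump z \<rho> x \<le> 1"
  unfolding bump_def
  by (auto intro!: prod_nonneg prod_le_1 mult_le_one mult_nonneg_nonneg flat_exp_0_bounds)

lemma bump_support: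
  assumes "0 < \<rho>" "bump z \<rho> x \<noteq> 0"
  shows "x \<in> cbox (\<chi> i. z $ i - \<rho>) (\<chi> i. z $ i + \<rho>)"
proof -
  have "z $ i - \<rho> \<le> x $ i \<and> x $ i \<le> z $ i + \<rho>" for i
  proof -
    have "flat_exp 0 (1 + (x $ i - z $ i) / \<rho>) * flat_exp 0 (1 - (x $ i - z $ i) / \<rho>) \<noteq> 0"
      using assms(2) by (simp add: bump_def prod_zero_iff)
    then have "0 < 1 + (x $ i - z $ i) / \<rho>" "0 < 1 - (x $ i - z $ i) / \<rho>"
      by (auto simp: flat_exp_def split: if_splits)
    then show ?thesis using assms(1) by (simp add: field_simps)
  qed
  then show ?thesis by (simp add: mem_box_cart)
qed

lemma bump_lower:
  assumes "0 < \<rho>" "x \<in> cbox (\<chi> i. z $ i - \<rho> / 2) (\<chi> i. z $ i + \<rho> / 2)"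
  shows "exp (-8) \<le> bump z \<rho> x"
proof -
  have low: "exp (-2) \<le> flat_exp 0 t" if "1/2 \<le> t" for t
    using that by (simp add: flat_exp_def field_simps)
  have "exp (-4) \<le> flat_exp 0 (1 + (x $ i - z $ i) / \<rho>) * flat_exp 0 (1 - (x $ i - z $ i) / \<rho>)" for i
  proof -
    have "z $ i - \<rho> / 2 \<le> x $ i" "x $ i \<le> z $ i + \<rho> / 2" using assms(2) by (auto simp: mem_box_cart)
    then have "1/2 \<le> 1 + (x $ i - z $ i) / \<rho>" "1/2 \<le> 1 - (x $ i - z $ i) / \<rho>"
      using assms(1) by (simp_all add: field_simps)
    from mult_mono[OF low[OF this(1)] low[OF this(2)]] show ?thesis
      by (simp add: flat_exp_0_bounds flip: exp_add)
  qed
  then have "(\<Prod>i\<in>(UNIV :: 2 set). exp (-4)) \<le> bump z \<rho> x"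
    unfolding bump_def by (intro prod_mono) auto
  moreover have "(\<Prod>i\<in>(UNIV :: 2 set). exp (-4)) = exp (-8 :: real)"
    by (simp add: power2_eq_square flip: exp_add)
  ultimately show ?thesis by simp
qed

lemma continuous_lebesgue_on_measurable:
  fixes f :: "real^2 \<Rightarrow> real"
  assumes "continuous_on UNIV f" "\<Omega> \<in> sets lebesgue"
  shows "f \<in> borel_measurable (lebesgue_on \<Omega>)"
  using continuous_imp_measurable_on_sets_lebesgue[OF continuous_on_subset[OF assms(1)] assms(2)] by simp

text \<open>
  The numerical constant only has to be independent of the disc: \<open>exp (-8)\<close> is the lower bound of
  the bump on the inner square, whose area is \<open>r\<^sup>2/4\<close>.
\<close>

lemma test_function_in_ball:
  assumes \<Omega>: "\<Omega> \<in> lmeasurable" and r: "0 < r" and sub: "ball z r \<subseteq> \<Omega>"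
  obtains \<phi> where "\<phi> \<in> test_functions \<Omega>" "\<And>x. 0 \<le> \<phi> x" "\<And>x. \<phi> x \<le> 1"
    "\<And>x. x \<notin> ball z r \<Longrightarrow> \<phi> x = 0" "exp (-8) / 4 * r\<^sup>2 \<le> (\<integral>x. \<phi> x \<partial>lebesgue_on \<Omega>)"
proof -
  define \<rho> where "\<rho> = r / 2"
  have \<rho>: "0 < \<rho>" using r by (simp add: \<rho>_def)
  define K where "K = cbox (\<chi> i. z $ i - \<rho>) (\<chi> i. z $ i + \<rho>)"
  define K' where "K' = cbox (\<chi> i. z $ i - \<rho> / 2) (\<chi> i. z $ i + \<rho> / 2)"
  have Kball: "K \<subseteq> ball z r"
  proof
    fix x assume "x \<in> K"
    then have "\<bar>(x - z) $ i\<bar> \<le> \<rho>" for i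
      by (simp add: K_def mem_box_cart abs_le_iff) (smt (verit))
    then have "((x - z) $ i)\<^sup>2 \<le> \<rho>\<^sup>2" for i by (metis abs_ge_zero power2_abs power_mono)
    from this[of 1] this[of 2] have "(norm (x - z))\<^sup>2 \<le> 2 * \<rho>\<^sup>2"
      by (simp add: norm_vec_def L2_set_def UNIV_2)
    also have "\<dots> < r\<^sup>2" using r by (simp add: \<rho>_def power2_eq_square)
    finally have "norm (x - z) < r" using r by (simp add: power2_less_imp_less)
    then show "x \<in> ball z r" by (simp add: dist_norm norm_minus_commute)
  qed
  have K'K: "K' \<subseteq> K" using \<rho> by (auto simp: K_def K'_def mem_box_cart) (smt (verit, best) field_sum_of_halves)+
  have supp: "closure {x. bump z \<rho> x \<noteq> 0} \<subseteq> K"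
    by (rule closure_minimal) (use bump_support[OF \<rho>] in \<open>auto simp: K_def\<close>)
  then have "compact (closure {x. bump z \<rho> x \<noteq> 0})"
    by (metis K_def bounded_cbox bounded_subset closed_closure compact_eq_bounded_closed)
  then have test: "bump z \<rho> \<in> test_functions \<Omega>"
    using supp Kball sub Ck_bump by (auto simp: test_functions_def compactly_supported_in_def)
  interpret finite_measure "lebesgue_on \<Omega>"
    using \<Omega> by (rule finite_measure_lebesgue_on)
  have [measurable]: "bump z \<rho> \<in> borel_measurable (lebesgue_on \<Omega>)"
    by (rule continuous_lebesgue_on_measurable[OF Ck_continuous[OF Ck_bump]])
      (use \<Omega> in auto)
  have int: "integrable (lebesgue_on \<Omega>) (bump z \<rho>)"
    by (rule integrable_const_bound[where B = 1]) (auto simp: bump_bounds)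
  have K's: "K' \<subseteq> \<Omega>" using K'K Kball sub by auto
  then have K'm: "K' \<in> sets (lebesgue_on \<Omega>)"
    using \<Omega> by (auto simp: sets_restrict_space_iff K'_def fmeasurableD)
  have "measure lebesgue K' = (\<Prod>i\<in>(UNIV::2 set). \<rho>)"
    unfolding K'_def using \<rho>
    by (subst measure_completion) (auto simp: content_cbox_cart interval_ne_empty_cart)
  then have mK': "measure (lebesgue_on \<Omega>) K' = \<rho>\<^sup>2"
    using K's \<Omega> by (simp add: measure_restrict_space fmeasurableD)
  have "exp (-8) * \<rho>\<^sup>2 = (\<integral>x. exp (-8) * indicator K' x \<partial>lebesgue_on \<Omega>)"
    using mK' by (simp add: Int_absorb2[OF K's])
  also have "\<dots> \<le> (\<integral>x. bump z \<rho> x \<partial>lebesgue_on \<Omega>)"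
  proof (rule integral_mono)
    show "integrable (lebesgue_on \<Omega>) (\<lambda>x. exp (-8) * indicator K' x :: real)"
      using K'm by (intro integrable_const_bound[where B = 1]) (auto simp: indicator_def)
    show "exp (-8) * indicator K' x \<le> bump z \<rho> x" if "x \<in> space (lebesgue_on \<Omega>)" for x
      using bump_lower[OF \<rho>, of x z] bump_bounds(1)[of z \<rho> x] by (auto simp: indicator_def K'_def)
  qed (rule int)
  finally have "exp (-8) / 4 * r\<^sup>2 \<le> (\<integral>x. bump z \<rho> x \<partial>lebesgue_on \<Omega>)"
    by (simp add: \<rho>_def power_divide)
  moreover have "bump z \<rho> x = 0" if "x \<notin> ball z r" for x
    using that bump_support[OF \<rho>, of z x] Kball unfolding K_def by blast
  ultimately show ?thesis
    by (intro that[of "bump z \<rho>"] test bump_bounds)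
qed

lemma bounded_support_integrable:
  fixes u :: "real^2 \<Rightarrow> real"
  assumes "u \<in> borel_measurable borel" "bounded K" "\<And>x. x \<notin> K \<Longrightarrow> u x = 0" "\<And>x. \<bar>u x\<bar> \<le> B"
  shows "integrable lborel u"
proof -
  obtain a b where ab: "K \<subseteq> cbox a b" using assms(2) bounded_subset_cbox_symmetric by meson
  show ?thesis
  proof (rule Bochner_Integration.integrable_bound)
    show "integrable lborel (\<lambda>x. B * indicator (cbox a b) x :: real)"
      by (intro integrable_mult_right integrable_real_indicator) (auto simp: emeasure_lborel_cbox_eq)
    show "u \<in> borel_measurable lborel" using assms(1) by simp
    show "AE x in lborel. norm (u x) \<le> norm (B * indicator (cbox a b) x :: real)"
    proof (rule AE_I2)
      fix x show "norm (u x) \<le> norm (B * indicator (cbox a b) x :: real)"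
        using assms(3)[of x] assms(4)[of x] ab by (auto simp: indicator_def)
    qed
  qed
qed

lemma grad_support:
  assumes "\<And>y. \<phi> differentiable (at y)" "x \<notin> closure {x. \<phi> x \<noteq> 0}"
  shows "grad \<phi> x $ i = 0"
proof -
  have "((\<lambda>x. 0) has_derivative (\<lambda>h. 0)) (at x)" by simp
  then have "(\<phi> has_derivative (\<lambda>h. 0)) (at x)"
    by (rule has_derivative_transform_within_open[where s = "- closure {x. \<phi> x \<noteq> 0}"])
      (use assms(2) closure_subset[of "{x. \<phi> x \<noteq> 0}"] in auto)
  from grad_eq[OF this] show ?thesis .
qed

text \<open>
  The partial derivative of a \<open>C\<^sup>1\<close> function as a limit of difference quotients under the integral,
  with the difference then moved to the other factor by translation invariance. The two kinds of
  integration by parts below, against Lipschitz functions and against convex sets, differ only in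
  how the difference quotients of that factor are controlled.
\<close>

lemma integral_difference_quotient_tendsto:
  fixes u \<phi> :: "real^2 \<Rightarrow> real"
  assumes u: "integrable lborel u" and \<phi>: "Ck 1 \<phi>" and K: "compact (closure {x. \<phi> x \<noteq> 0})"
  shows "(\<lambda>n::nat. \<integral>x. (u (x - (1 / (n + 1)) *\<^sub>R axis i 1) - u x) / (1 / (n + 1)) * \<phi> x \<partial>lborel)
           \<longlonglongrightarrow> (\<integral>x. u x * grad \<phi> x $ i \<partial>lborel)"
proof -
  have d: "\<phi> differentiable (at x)" and gc: "continuous_on UNIV (\<lambda>x. grad \<phi> x $ j)" for x j
    using \<phi> by auto
  have um [measurable]: "u \<in> borel_measurable borel" using u by auto
  have \<phi>c: "continuous_on UNIV \<phi>" by (rule Ck_continuous[OF \<phi>])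
  have \<phi>m [measurable]: "\<phi> \<in> borel_measurable borel" by (rule borel_measurable_continuous_onI[OF \<phi>c])
  have gm [measurable]: "(\<lambda>x. grad \<phi> x $ i) \<in> borel_measurable borel"
    by (rule borel_measurable_continuous_onI[OF gc])
  have der: "((\<lambda>s. \<phi> (x + s *\<^sub>R axis i 1)) has_real_derivative grad \<phi> (x + s *\<^sub>R axis i 1) $ i) (at s)" for x s
  proof -
    have "((\<lambda>s. \<phi> (x + s *\<^sub>R axis i 1)) has_derivative
        (\<lambda>h. frechet_derivative \<phi> (at (x + s *\<^sub>R axis i 1)) (h *\<^sub>R axis i 1))) (at s)"
      by (rule has_derivative_compose[of "\<lambda>s. x + s *\<^sub>R axis i 1" "\<lambda>h. h *\<^sub>R axis i 1" s UNIV \<phi>])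
        (use d in \<open>auto intro!: derivative_eq_intros simp: frechet_derivative_works[symmetric]\<close>)
    moreover have "(\<lambda>h. frechet_derivative \<phi> (at (x + s *\<^sub>R axis i 1)) (h *\<^sub>R axis i 1))
        = (*) (grad \<phi> (x + s *\<^sub>R axis i 1) $ i)"
      using linear_frechet_derivative[OF d]
      by (auto simp: grad_def linear_cmul mult.commute)
    ultimately show ?thesis by (simp add: has_field_derivative_def)
  qed
  have "bounded ((\<lambda>x. grad \<phi> x $ i) ` closure {x. \<phi> x \<noteq> 0})"
    by (intro compact_imp_bounded compact_continuous_image continuous_on_subset[OF gc] K) simp
  then obtain L where "\<And>x. x \<in> closure {x. \<phi> x \<noteq> 0} \<Longrightarrow> \<bar>grad \<phi> x $ i\<bar> \<le> L"
    by (force simp: bounded_iff)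
  then have L: "\<bar>grad \<phi> x $ i\<bar> \<le> max L 0" for x
    using grad_support[OF d, of x i] by (cases "x \<in> closure {x. \<phi> x \<noteq> 0}") force+
  have "bounded (\<phi> ` closure {x. \<phi> x \<noteq> 0})"
    by (intro compact_imp_bounded compact_continuous_image continuous_on_subset[OF \<phi>c] K) simp
  then obtain B where "\<And>x. x \<in> closure {x. \<phi> x \<noteq> 0} \<Longrightarrow> \<bar>\<phi> x\<bar> \<le> B"
    by (force simp: bounded_iff)
  then have B: "\<bar>\<phi> x\<bar> \<le> max B 0" for x
    using closure_subset[of "{x. \<phi> x \<noteq> 0}"] by (cases "x \<in> closure {x. \<phi> x \<noteq> 0}") force+
  let ?t = "\<lambda>n::nat. 1 / (real n + 1)"
  let ?e = "axis i 1 :: real^2"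
  have quot: "\<bar>(\<phi> (x + s *\<^sub>R ?e) - \<phi> x) / s\<bar> \<le> max L 0" if "s > 0" for x s
  proof -
    from MVT2[of 0 s "\<lambda>s. \<phi> (x + s *\<^sub>R ?e)" "\<lambda>s. grad \<phi> (x + s *\<^sub>R ?e) $ i", OF that der]
    obtain y where "\<phi> (x + s *\<^sub>R ?e) - \<phi> x = s * grad \<phi> (x + y *\<^sub>R ?e) $ i" by auto
    then show ?thesis using that L by simp
  qed
  have lim: "(\<lambda>n. \<integral>x. u x * ((\<phi> (x + ?t n *\<^sub>R ?e) - \<phi> x) / ?t n) \<partial>lborel)
           \<longlonglongrightarrow> (\<integral>x. u x * grad \<phi> x $ i \<partial>lborel)"
  proof (rule integral_dominated_convergence[where w = "\<lambda>x. \<bar>u x\<bar> * max L 0"])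
    show "AE x in lborel. (\<lambda>n. u x * ((\<phi> (x + ?t n *\<^sub>R ?e) - \<phi> x) / ?t n)) \<longlonglongrightarrow> u x * grad \<phi> x $ i"
    proof (rule AE_I2)
      fix x
      have "((\<lambda>s. (\<phi> (x + s *\<^sub>R ?e) - \<phi> x) / s) \<longlongrightarrow> grad \<phi> x $ i) (at 0)"
        using der[of x 0] by (simp add: has_field_derivative_iff)
      moreover have "filterlim ?t (at 0) sequentially"
        unfolding filterlim_at using LIMSEQ_inverse_real_of_nat
        by (auto simp: inverse_eq_divide add.commute)
      ultimately have "(\<lambda>n. (\<phi> (x + ?t n *\<^sub>R ?e) - \<phi> x) / ?t n) \<longlonglongrightarrow> grad \<phi> x $ i"
        by (rule filterlim_compose)
      then show "(\<lambda>n. u x * ((\<phi> (x + ?t n *\<^sub>R ?e) - \<phi> x) / ?t n)) \<longlonglongrightarrow> u x * grad \<phi> x $ i"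
        by (intro tendsto_intros)
    qed
    show "AE x in lborel. norm (u x * ((\<phi> (x + ?t n *\<^sub>R ?e) - \<phi> x) / ?t n)) \<le> \<bar>u x\<bar> * max L 0" for n
    proof (rule AE_I2)
      fix x
      show "norm (u x * ((\<phi> (x + ?t n *\<^sub>R ?e) - \<phi> x) / ?t n)) \<le> \<bar>u x\<bar> * max L 0"
        unfolding real_norm_def abs_mult by (intro mult_left_mono quot) auto
    qed
    show "integrable lborel (\<lambda>x. \<bar>u x\<bar> * max L 0)" using u by simp
  qed measurable
  have shift: "(\<integral>x. u x * ((\<phi> (x + s *\<^sub>R ?e) - \<phi> x) / s) \<partial>lborel)
      = (\<integral>x. (u (x - s *\<^sub>R ?e) - u x) / s * \<phi> x \<partial>lborel)" for s
  proof -
    have i1: "integrable lborel (\<lambda>x. v x * \<phi> (x + c))" if "integrable lborel v" for v c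
    proof (rule Bochner_Integration.integrable_bound)
      show "integrable lborel (\<lambda>x. \<bar>v x\<bar> * max B 0)" using that by simp
      have [measurable]: "v \<in> borel_measurable borel" using that by auto
      show "(\<lambda>x. v x * \<phi> (x + c)) \<in> borel_measurable lborel" by measurable
      show "AE x in lborel. norm (v x * \<phi> (x + c)) \<le> norm (\<bar>v x\<bar> * max B 0)"
      proof (rule AE_I2)
        fix x show "norm (v x * \<phi> (x + c)) \<le> norm (\<bar>v x\<bar> * max B 0)"
          using mult_left_mono[OF B[of "x + c"], of "\<bar>v x\<bar>"] by (simp add: abs_mult)
      qed
    qed
    have i2: "integrable lborel (\<lambda>x. u (x - c))" for c
    proof -
      have "integrable (distr lborel borel ((+) c)) (\<lambda>x. u x)" for c
        using u by (simp add: lborel_distr_plus)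
      then have "integrable lborel (\<lambda>x. u (c + x))" for c by (subst (asm) integrable_distr_eq) auto
      from this[of "-c"] show ?thesis by simp
    qed
    have "(\<integral>x. u x * \<phi> (x + c) \<partial>lborel) = (\<integral>x. u (x - c) * \<phi> x \<partial>lborel)" for c
    proof -
      have "(\<integral>x. u (x - c) * \<phi> x \<partial>lborel) = (\<integral>x. u (x - c) * \<phi> x \<partial>(distr lborel borel ((+) c)))"
        by (simp add: lborel_distr_plus)
      also have "\<dots> = (\<integral>x. u x * \<phi> (x + c) \<partial>lborel)"
        by (subst integral_distr) (auto simp: add.commute)
      finally show ?thesis by simp
    qed
    note sh = this[of "s *\<^sub>R ?e"]
    have "(\<integral>x. u x * ((\<phi> (x + s *\<^sub>R ?e) - \<phi> x) / s) \<partial>lborel)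
        = (\<integral>x. (u x * \<phi> (x + s *\<^sub>R ?e) - u x * \<phi> x) / s \<partial>lborel)"
      by (intro Bochner_Integration.integral_cong) (auto simp: algebra_simps)
    also have "\<dots> = ((\<integral>x. u x * \<phi> (x + s *\<^sub>R ?e) \<partial>lborel) - (\<integral>x. u x * \<phi> x \<partial>lborel)) / s"
      using i1[OF u] i1[OF u, of 0] by simp
    also have "\<dots> = ((\<integral>x. u (x - s *\<^sub>R ?e) * \<phi> x \<partial>lborel) - (\<integral>x. u x * \<phi> x \<partial>lborel)) / s"
      by (simp add: sh)
    also have "\<dots> = (\<integral>x. (u (x - s *\<^sub>R ?e) * \<phi> x - u x * \<phi> x) / s \<partial>lborel)"
      using i1[OF i2, of _ 0] i1[OF u, of 0] by simp
    also have "\<dots> = (\<integral>x. (u (x - s *\<^sub>R ?e) - u x) / s * \<phi> x \<partial>lborel)"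
      by (intro Bochner_Integration.integral_cong) (auto simp: algebra_simps)
    finally show ?thesis .
  qed
  show ?thesis using lim by (simp only: shift)
qed

lemma integral_lebesgue_on_lborel:
  fixes f :: "real^2 \<Rightarrow> real"
  assumes "f \<in> borel_measurable borel" "\<Omega> \<in> sets lebesgue" "\<And>x. x \<notin> \<Omega> \<Longrightarrow> f x = 0"
  shows "(\<integral>x. f x \<partial>lebesgue_on \<Omega>) = (\<integral>x. f x \<partial>lborel)"
proof -
  have "(\<integral>x. f x \<partial>lebesgue_on \<Omega>) = (\<integral>x. indicator \<Omega> x *\<^sub>R f x \<partial>lebesgue)"
    by (rule integral_restrict_space) (use assms in auto)
  also have "(\<lambda>x. indicator \<Omega> x *\<^sub>R f x) = f"
    by (rule ext) (use assms(3) in \<open>auto simp: indicator_def\<close>)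
  also have "integral\<^sup>L lebesgue f = (\<integral>x. f x \<partial>lborel)"
    by (rule integral_completion) (use assms in auto)
  finally show ?thesis .
qed

lemma AE_lborel_imp_lebesgue_on:
  assumes "AE x in lborel. P (x :: real^2)" "\<Omega> \<in> sets lebesgue"
  shows "AE x in lebesgue_on \<Omega>. P x"
  using AE_completion[OF assms(1)] assms(2) by (subst AE_restrict_space_iff) auto

section \<open>Weak gradients of Lipschitz functions\<close>

text \<open>
  Along the segment between two points, the pieces cut the parameter interval into finitely many
  closed sets on each of which the Lipschitz bound holds.
\<close>

lemma lipschitz_on_UNIV_pieces:
  fixes f :: "'a::real_normed_vector \<Rightarrow> 'b::metric_space"
  assumes fin: "finite I" and cl: "\<And>i. i \<in> I \<Longrightarrow> closed (U i)"
    and cover: "(\<Union>i\<in>I. U i) = UNIV" and lip: "\<And>i. i \<in> I \<Longrightarrow> L-lipschitz_on (U i) f"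
  shows "L-lipschitz_on UNIV f"
proof -
  obtain i where "i \<in> I" using cover by auto
  then have L: "0 \<le> L" using lip lipschitz_on_nonneg by blast
  show ?thesis
  proof (rule lipschitz_onI[OF _ L])
    fix x y :: 'a
    define g where "g s = x + s *\<^sub>R (y - x)" for s :: real
    have g: "dist (g s) (g t) = dist x y * dist s t" for s t
    proof -
      have "g s - g t = (s - t) *\<^sub>R (y - x)" by (simp add: g_def algebra_simps)
      then show ?thesis by (simp add: dist_norm norm_minus_commute)
    qed
    have gc: "continuous_on UNIV g" unfolding g_def by (intro continuous_intros)
    have "(L * dist x y)-lipschitz_on {0..1} (\<lambda>s. f (g s))"
    proof (rule lipschitz_on_closed_Union[where I = I and U = "\<lambda>i. g -` U i"])
      fix i assume i: "i \<in> I"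
      show "(L * dist x y)-lipschitz_on (g -` U i) (\<lambda>s. f (g s))"
        using L by (intro lipschitz_onI)
          (auto simp: g mult.assoc intro: lipschitz_onD[OF lip[OF i], THEN order_trans])
      show "closed (g -` U i)" using cl[OF i] gc by (simp add: continuous_closed_vimage continuous_on_eq_continuous_at)
    next
      have "g s \<in> (\<Union>i\<in>I. U i)" for s by (simp add: cover)
      then show "{0..1} \<subseteq> (\<Union>i\<in>I. g -` U i)" by blast
    qed (use fin L in auto)
    from lipschitz_onD[OF this, of 0 1] show "dist (f x) (f y) \<le> L * dist x y"
      by (simp add: g_def dist_commute)
  qed
qed

abbreviation quotient_step :: "nat \<Rightarrow> real" where
  "quotient_step n \<equiv> 1 / (real n + 1)"

lemma quotient_step_tendsto: "quotient_step \<longlonglongrightarrow> 0"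
  using LIMSEQ_inverse_real_of_nat by (simp add: inverse_eq_divide add.commute)

text \<open>
  The Lipschitz bound dominates the difference quotients, so the limit in
  \<open>integral_difference_quotient_tendsto\<close> may be taken under the integral also after the difference
  has moved to \<open>V\<close>.
\<close>

lemma lipschitz_has_weak_gradient:
  assumes \<Omega>: "open \<Omega>" "bounded \<Omega>"
    and lip: "L-lipschitz_on UNIV V" and V0: "\<And>x. x \<notin> \<Omega> \<Longrightarrow> V x = 0"
    and G: "\<And>i. (\<lambda>x. G x $ i) \<in> borel_measurable borel"
    and conv: "\<And>i. AE x in lborel.
      (\<lambda>n. (V (x - quotient_step n *\<^sub>R axis i 1) - V x) / quotient_step n) \<longlonglongrightarrow> - G x $ i"
  shows "has_weak_gradient \<Omega> V G"
proof -
  have lm: "\<Omega> \<in> lmeasurable" and ls: "\<Omega> \<in> sets lebesgue"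
    using \<Omega> by (auto intro: lmeasurable_open simp: fmeasurableD)
  have L: "0 \<le> L" by (rule lipschitz_on_nonneg[OF lip])
  have Vc: "continuous_on UNIV V" by (rule lipschitz_on_continuous_on[OF lip])
  have Vm [measurable]: "V \<in> borel_measurable borel" by (rule borel_measurable_continuous_onI[OF Vc])
  note G[measurable]
  have "compact (V ` closure \<Omega>)"
    by (intro compact_continuous_image continuous_on_subset[OF Vc]) (use \<Omega> in \<open>auto simp: compact_closure\<close>)
  then obtain B where "\<And>x. x \<in> closure \<Omega> \<Longrightarrow> \<bar>V x\<bar> \<le> B"
    by (force dest!: compact_imp_bounded simp: bounded_iff)
  then have B: "\<bar>V x\<bar> \<le> max B 0" for x
    using V0[of x] closure_subset[of \<Omega>] by (cases "x \<in> \<Omega>") force+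
  have quot: "\<bar>(V (x - s *\<^sub>R axis i 1) - V x) / s\<bar> \<le> L" if "s > 0" for x i s
  proof -
    have "dist (V (x - s *\<^sub>R axis i 1)) (V x) \<le> L * dist (x - s *\<^sub>R axis i 1) x"
      by (rule lipschitz_onD[OF lip]) auto
    also have "dist (x - s *\<^sub>R axis i 1) x = s" using that by (simp add: dist_norm norm_axis_1)
    finally show ?thesis using that by (simp add: dist_real_def field_simps)
  qed
  have Gb: "AE x in lborel. \<bar>G x $ i\<bar> \<le> L" for i
    using conv[of i]
  proof eventually_elim
    case (elim x)
    then have "(\<lambda>n. \<bar>(V (x - quotient_step n *\<^sub>R axis i 1) - V x) / quotient_step n\<bar>) \<longlonglongrightarrow> \<bar>- G x $ i\<bar>"
      by (rule tendsto_rabs)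
    then have "\<bar>- G x $ i\<bar> \<le> L" by (rule LIMSEQ_le_const2) (intro exI allI impI quot, simp)
    then show ?case by simp
  qed
  have VL: "V \<in> L2 \<Omega>"
    by (rule L2_bounded(1)[OF lm, where B = "max B 0"])
      (use B continuous_lebesgue_on_measurable[OF Vc ls] in auto)
  have "G' \<in> borel_measurable (lebesgue_on \<Omega>)" if "G' \<in> borel_measurable borel" for G' :: "real^2 \<Rightarrow> real"
    using that by (intro measurable_restrict_space1 measurable_completion) simp
  then have Gm: "(\<lambda>x. G x $ i) \<in> borel_measurable (lebesgue_on \<Omega>)" for i using G by blast
  have GL: "(\<lambda>x. G x $ i) \<in> L2 \<Omega>" for i
    by (rule L2_bounded(1)[OF lm Gm AE_lborel_imp_lebesgue_on[OF Gb ls] L])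
  have parts: "(\<integral>x. V x * grad \<phi> x $ i \<partial>lebesgue_on \<Omega>) = - (\<integral>x. G x $ i * \<phi> x \<partial>lebesgue_on \<Omega>)"
    if \<phi>: "\<phi> \<in> test_functions \<Omega>" for \<phi> i
  proof -
    have Ck: "Ck 1 \<phi>" and K: "compact (closure {x. \<phi> x \<noteq> 0})" and sub: "closure {x. \<phi> x \<noteq> 0} \<subseteq> \<Omega>"
      using \<phi> by (auto simp: test_functions_def compactly_supported_in_def simp del: Ck.simps)
    have \<phi>c: "continuous_on UNIV \<phi>" by (rule Ck_continuous[OF Ck])
    have [measurable]: "\<phi> \<in> borel_measurable borel" by (rule borel_measurable_continuous_onI[OF \<phi>c])
    have gm [measurable]: "(\<lambda>x. grad \<phi> x $ i) \<in> borel_measurable borel"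
      using Ck by (intro borel_measurable_continuous_onI) simp
    have \<phi>0: "\<phi> x = 0" if "x \<notin> \<Omega>" for x using that sub closure_subset[of "{x. \<phi> x \<noteq> 0}"] by auto
    have "compact (\<phi> ` closure \<Omega>)"
      by (intro compact_continuous_image continuous_on_subset[OF \<phi>c]) (use \<Omega> in \<open>auto simp: compact_closure\<close>)
    then obtain M where "\<And>x. x \<in> closure \<Omega> \<Longrightarrow> \<bar>\<phi> x\<bar> \<le> M"
      by (force dest!: compact_imp_bounded simp: bounded_iff)
    then have M: "\<bar>\<phi> x\<bar> \<le> max M 0" for x
      using \<phi>0[of x] closure_subset[of \<Omega>] by (cases "x \<in> \<Omega>") force+
    have i\<phi>: "integrable lborel \<phi>"
      by (rule bounded_support_integrable[OF _ \<Omega>(2) \<phi>0 M]) auto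
    have iV: "integrable lborel V"
      by (rule bounded_support_integrable[OF Vm \<Omega>(2) V0 B]) auto
    have "(\<lambda>n. \<integral>x. (V (x - quotient_step n *\<^sub>R axis i 1) - V x) / quotient_step n * \<phi> x \<partial>lborel)
        \<longlonglongrightarrow> (\<integral>x. - G x $ i * \<phi> x \<partial>lborel)"
    proof (rule integral_dominated_convergence[where w = "\<lambda>x. L * \<bar>\<phi> x\<bar>"])
      show "AE x in lborel. (\<lambda>n. (V (x - quotient_step n *\<^sub>R axis i 1) - V x) / quotient_step n * \<phi> x)
          \<longlonglongrightarrow> - G x $ i * \<phi> x"
        using conv[of i] by eventually_elim (intro tendsto_mult tendsto_const)
      show "AE x in lborel. norm ((V (x - quotient_step n *\<^sub>R axis i 1) - V x) / quotient_step n * \<phi> x)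
          \<le> L * \<bar>\<phi> x\<bar>" for n
        unfolding real_norm_def abs_mult by (intro AE_I2 mult_right_mono quot) auto
      show "integrable lborel (\<lambda>x. L * \<bar>\<phi> x\<bar>)" using i\<phi> by simp
    qed measurable
    with integral_difference_quotient_tendsto[OF iV Ck K, of i]
    have "(\<integral>x. V x * grad \<phi> x $ i \<partial>lborel) = (\<integral>x. - G x $ i * \<phi> x \<partial>lborel)"
      by (rule LIMSEQ_unique)
    also have "(\<integral>x. V x * grad \<phi> x $ i \<partial>lborel) = (\<integral>x. V x * grad \<phi> x $ i \<partial>lebesgue_on \<Omega>)"
      by (rule integral_lebesgue_on_lborel[symmetric]) (use ls V0 in auto)
    also have "(\<integral>x. - G x $ i * \<phi> x \<partial>lborel) = (\<integral>x. - G x $ i * \<phi> x \<partial>lebesgue_on \<Omega>)"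
      by (rule integral_lebesgue_on_lborel[symmetric]) (use ls \<phi>0 in auto)
    finally show ?thesis by simp
  qed
  show ?thesis unfolding has_weak_gradient_def using VL GL parts by blast
qed

lemma has_weak_gradient_cong:
  assumes "has_weak_gradient \<Omega> V G" "\<And>x. x \<in> \<Omega> \<Longrightarrow> v x = V x"
  shows "has_weak_gradient \<Omega> v G"
proof -
  have sp: "v x = V x" if "x \<in> space (lebesgue_on \<Omega>)" for x using that assms(2) by simp
  have "v \<in> L2 \<Omega>"
  proof -
    have "v \<in> borel_measurable (lebesgue_on \<Omega>) \<longleftrightarrow> V \<in> borel_measurable (lebesgue_on \<Omega>)"
      by (rule measurable_cong[OF sp])
    moreover have "integrable (lebesgue_on \<Omega>) (\<lambda>x. (v x)\<^sup>2) \<longleftrightarrow> integrable (lebesgue_on \<Omega>) (\<lambda>x. (V x)\<^sup>2)"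
      by (intro Bochner_Integration.integrable_cong) (auto simp: sp)
    ultimately show ?thesis using assms(1) by (simp add: has_weak_gradient_def L2_iff)
  qed
  moreover have "(\<integral>x. v x * grad \<phi> x $ i \<partial>lebesgue_on \<Omega>) = (\<integral>x. V x * grad \<phi> x $ i \<partial>lebesgue_on \<Omega>)"
    for \<phi> i
    by (intro Bochner_Integration.integral_cong) (auto simp: sp)
  ultimately show ?thesis using assms(1) by (simp add: has_weak_gradient_def)
qed

section \<open>Shape-regular meshes\<close>

text \<open>
  What is used of a mesh of size \<open>h\<close>: convex cells of diameter at most \<open>h\<close> that contain a disc of
  radius \<open>\<kappa> h\<close> and overlap only in null sets.
\<close>

locale regular_mesh =
  fixes \<Omega> :: "(real^2) set" and \<T> :: "(real^2) set set" and \<kappa> h :: real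
  assumes \<Omega>: "open \<Omega>" "bounded \<Omega>"
    and mesh_pos: "0 < \<kappa>" "0 < h"
    and mesh_finite: "finite \<T>"
    and mesh_Union: "\<Union>\<T> = closure \<Omega>"
    and mesh_disjoint: "\<And>T T'. T \<in> \<T> \<Longrightarrow> T' \<in> \<T> \<Longrightarrow> T \<noteq> T' \<Longrightarrow> interior T \<inter> interior T' = {}"
    and mesh_cell: "\<And>T. T \<in> \<T> \<Longrightarrow> compact T" "\<And>T. T \<in> \<T> \<Longrightarrow> convex T"
      "\<And>T x y. T \<in> \<T> \<Longrightarrow> x \<in> T \<Longrightarrow> y \<in> T \<Longrightarrow> dist x y \<le> h"
    and mesh_ball: "\<And>T. T \<in> \<T> \<Longrightarrow> \<exists>z. ball z (\<kappa> * h) \<subseteq> T"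

lemma simplex_interior_nonempty:
  assumes "2 simplex (T :: (real^2) set)"
  shows "interior T \<noteq> {}"
proof -
  have "aff_dim T = 2" using assms by (rule aff_dim_simplex)
  then have "interior T = rel_interior T" by (simp add: interior_rel_interior_gen)
  moreover have "T \<noteq> {}" using assms by auto
  ultimately show ?thesis using convex_simplex[OF assms] by (simp add: rel_interior_eq_empty)
qed

text \<open>
  In a quasi-uniform, shape-regular family, the radius of the inscribed disc is of order \<open>h\<close>. The
  supremum that defines its diameter need not be attained, which costs a factor two.
\<close>

lemma ball_in_large_inball:
  assumes T: "bounded (T :: (real^2) set)" "interior T \<noteq> {}"
    and s: "diameter T / inball_diameter T \<le> \<sigma>" and r: "h / diameter T \<le> \<rho>"
    and pos: "0 < h" "0 < \<sigma>" "0 < \<rho>"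
  shows "\<exists>z. ball z (1 / (4 * \<rho> * \<sigma>) * h) \<subseteq> T"
proof -
  let ?D = "{diameter (ball x r) | x r. ball x r \<subseteq> T}"
  have le: "d \<le> diameter T" if "d \<in> ?D" for d
    using that by (blast intro: diameter_subset[OF _ T(1)])
  then have bdd: "bdd_above ?D" by (intro bdd_aboveI)
  from T(2) obtain x e where e: "0 < e" "ball x e \<subseteq> T" by (auto simp: mem_interior)
  then have "2 * e \<in> ?D" by (auto intro!: exI[of _ x] exI[of _ e])
  then have "2 * e \<le> inball_diameter T" unfolding inball_diameter_def by (intro cSup_upper bdd)
  then have ip: "0 < inball_diameter T" using e by linarith
  have "0 < diameter T" using le[OF \<open>2 * e \<in> ?D\<close>] e by linarith
  then have "h \<le> \<rho> * diameter T" using r by (simp add: field_simps)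
  also have "\<dots> \<le> \<rho> * (\<sigma> * inball_diameter T)" using s ip pos by (intro mult_left_mono) (auto simp: field_simps)
  finally have h: "h / (\<rho> * \<sigma>) \<le> inball_diameter T" using pos by (simp add: field_simps)
  have "inball_diameter T / 2 < Sup ?D" using ip by (simp add: inball_diameter_def)
  then obtain d where d: "d \<in> ?D" "inball_diameter T / 2 < d"
    using \<open>2 * e \<in> ?D\<close> bdd by (metis (no_types, lifting) empty_iff less_cSup_iff)
  then obtain z r where z: "d = diameter (ball z r)" "ball z r \<subseteq> T" by auto
  have "0 < d" using d ip by linarith
  then have "0 < r" using z(1) by (auto split: if_splits)
  then have "d = 2 * r" using z(1) by simp
  then have "inball_diameter T / 4 \<le> r" using d by linarith
  moreover have "h / (\<rho> * \<sigma>) / 4 \<le> inball_diameter T / 4" using h by (rule divide_right_mono) simp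
  ultimately have "h / (\<rho> * \<sigma>) / 4 \<le> r" by (rule order_trans[rotated])
  then have "1 / (4 * \<rho> * \<sigma>) * h \<le> r" by (simp add: field_simps)
  then have "ball z (1 / (4 * \<rho> * \<sigma>) * h) \<subseteq> ball z r" by (simp add: subset_ball)
  then show ?thesis using z(2) by blast
qed

lemma mesh_family_regular:
  assumes \<Omega>: "open \<Omega>" "bounded \<Omega>"
    and mesh: "mesh_family \<Omega> H \<T>" and H: "H \<subseteq> {0<..}"
  obtains \<kappa> where "0 < \<kappa>" "\<And>h. h \<in> H \<Longrightarrow> regular_mesh \<Omega> (\<T> h) \<kappa> h"
proof -
  from mesh obtain \<rho> \<sigma> where pos: "0 < \<rho>" "0 < \<sigma>"
    and sh: "\<And>h T. h \<in> H \<Longrightarrow> T \<in> \<T> h \<Longrightarrow> diameter T / inball_diameter T \<le> \<sigma> \<and> h / diameter T \<le> \<rho>"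
    unfolding mesh_family_def by blast
  have "regular_mesh \<Omega> (\<T> h) (1 / (4 * \<rho> * \<sigma>)) h" if h: "h \<in> H" for h
  proof -
    have tri: "triangulation (\<T> h)" and simp: "\<And>T. T \<in> \<T> h \<Longrightarrow> 2 simplex T"
      and un: "\<Union>(\<T> h) = closure \<Omega>" and hmax: "h = Max (diameter ` \<T> h)"
      using mesh h unfolding mesh_family_def by blast+
    have h0: "0 < h" using h H by auto
    have fin: "finite (\<T> h)" using tri by (simp add: triangulation_def)
    \<comment> \<open>A common interior point would make the common face \<open>T \<inter> T'\<close> all of \<open>T\<close> and all of \<open>T'\<close>.\<close>
    have dj: "interior T \<inter> interior T' = {}" if T: "T \<in> \<T> h" "T' \<in> \<T> h" "T \<noteq> T'" for T T'
    proof (rule ccontr)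
      assume "interior T \<inter> interior T' \<noteq> {}"
      then obtain x where x: "x \<in> interior T" "x \<in> interior T'" by auto
      then have xT: "x \<in> T" "x \<in> T'" using interior_subset by auto
      have f: "(T \<inter> T') face_of T" "(T' \<inter> T) face_of T'"
        using tri T unfolding triangulation_def by blast+
      have "T \<inter> T' = T" using face_of_disjoint_interior[OF f(1)] x xT by blast
      moreover have "T' \<inter> T = T'" using face_of_disjoint_interior[OF f(2)] x xT by blast
      ultimately show False using T(3) by blast
    qed
    have cell: "compact T" "convex T" "x \<in> T \<Longrightarrow> y \<in> T \<Longrightarrow> dist x y \<le> h"
      "\<exists>z. ball z (1 / (4 * \<rho> * \<sigma>) * h) \<subseteq> T" if T: "T \<in> \<T> h" for T x y
    proof -
      show c: "compact T" "convex T" using simp[OF T] by (auto intro: compact_simplex convex_simplex)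
      have "diameter T \<le> Max (diameter ` \<T> h)" using fin T by (intro Max_ge) auto
      then have "diameter T \<le> h" by (simp only: hmax[symmetric])
      then show "dist x y \<le> h" if "x \<in> T" "y \<in> T"
        using diameter_bounded_bound[OF compact_imp_bounded[OF c(1)] that] by linarith
      show "\<exists>z. ball z (1 / (4 * \<rho> * \<sigma>) * h) \<subseteq> T"
        by (rule ball_in_large_inball[OF compact_imp_bounded[OF c(1)] simplex_interior_nonempty[OF simp[OF T]]])
          (use sh[OF h T] h0 pos in auto)
    qed
    show ?thesis
    proof
      show "0 < 1 / (4 * \<rho> * \<sigma>)" using pos by simp
    qed (rule \<Omega> h0 fin un dj cell; assumption)+
  qed
  with pos show ?thesis by (intro that[of "1 / (4 * \<rho> * \<sigma>)"]) auto
qed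

context regular_mesh
begin

lemma mesh_lmeasurable: "\<Omega> \<in> lmeasurable" and mesh_sets: "\<Omega> \<in> sets lebesgue"
  using \<Omega> by (auto intro: lmeasurable_open simp: fmeasurableD)

lemma mesh_frontiers_null: "AE x in lborel. \<forall>T\<in>\<T>. x \<notin> frontier T"
proof -
  have "AE x in lborel. x \<notin> frontier T" if "T \<in> \<T>" for T
  proof -
    have "negligible (frontier T)" by (rule negligible_convex_frontier[OF mesh_cell(2)[OF that]])
    then have "frontier T \<in> null_sets lborel"
      by (simp add: negligible_iff_null_sets null_sets_completion_iff)
    then show ?thesis by (rule AE_not_in)
  qed
  then show ?thesis using mesh_finite by (simp add: AE_finite_all)
qed

lemma mesh_unique_cell_AE:
  "AE x in lebesgue_on \<Omega>. \<exists>T\<in>\<T>. x \<in> interior T \<and> (\<forall>T'\<in>\<T>. x \<in> T' \<longrightarrow> T' = T)"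
proof -
  have "AE x in lebesgue_on \<Omega>. \<forall>T\<in>\<T>. x \<notin> frontier T"
    by (rule AE_lborel_imp_lebesgue_on[OF mesh_frontiers_null mesh_sets])
  then show ?thesis using AE_space
  proof eventually_elim
    case (elim x)
    have int: "x \<in> interior T" if "T \<in> \<T>" "x \<in> T" for T
      using elim(1) that closure_subset[of T] by (auto simp: frontier_def)
    have "x \<in> \<Union>\<T>" using elim(2) mesh_Union closure_subset by auto
    then obtain T where T: "T \<in> \<T>" "x \<in> T" by auto
    have "T' = T" if "T' \<in> \<T>" "x \<in> T'" for T'
      using mesh_disjoint[OF that(1) T(1)] int[OF that] int[OF T] by blast
    then show ?case using T int[OF T] by blast
  qed
qed

lemma mesh_sum_at_cell:
  fixes f :: "(real^2) set \<Rightarrow> real"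
  assumes T: "T \<in> \<T>" "x \<in> interior T"
  shows "(\<Sum>T\<in>\<T>. indicator (interior T) x * f T) = f T"
proof -
  have "(\<Sum>T\<in>\<T>. indicator (interior T) x * f T) = (\<Sum>T'\<in>{T}. indicator (interior T') x * f T')"
  proof (rule sum.mono_neutral_right[OF mesh_finite])
    show "{T} \<subseteq> \<T>" using T by simp
    have "x \<notin> interior T'" if "T' \<in> \<T> - {T}" for T' using mesh_disjoint[of T T'] T that by blast
    then show "\<forall>T'\<in>\<T> - {T}. indicator (interior T') x * f T' = 0" by (simp add: indicator_def)
  qed
  then show ?thesis using T(2) by simp
qed

lemma indicator_interior_measurable:
  "(\<lambda>x. indicator (interior T) x :: real) \<in> borel_measurable (lebesgue_on \<Omega>)"
  by (intro measurable_restrict_space1 measurable_completion) simp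

lemma mesh_integrable_cell:
  "integrable (lebesgue_on \<Omega>) f \<Longrightarrow> integrable (lebesgue_on \<Omega>) (\<lambda>x. indicator (interior T) x * f x)"
  for f :: "real^2 \<Rightarrow> real"
proof (rule Bochner_Integration.integrable_bound[of _ f])
  assume f: "integrable (lebesgue_on \<Omega>) f"
  then show "(\<lambda>x. indicator (interior T) x * f x) \<in> borel_measurable (lebesgue_on \<Omega>)"
    by (intro borel_measurable_times indicator_interior_measurable borel_measurable_integrable)
  show "AE x in lebesgue_on \<Omega>. norm (indicator (interior T) x * f x) \<le> norm (f x)"
    by (simp add: indicator_def)
qed

lemma mesh_integral_split:
  fixes f :: "real^2 \<Rightarrow> real"
  assumes "integrable (lebesgue_on \<Omega>) f"
  shows "(\<integral>x. f x \<partial>lebesgue_on \<Omega>) = (\<Sum>T\<in>\<T>. \<integral>x. indicator (interior T) x * f x \<partial>lebesgue_on \<Omega>)"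
proof -
  have "(\<Sum>T\<in>\<T>. \<integral>x. indicator (interior T) x * f x \<partial>lebesgue_on \<Omega>)
      = (\<integral>x. (\<Sum>T\<in>\<T>. indicator (interior T) x * f x) \<partial>lebesgue_on \<Omega>)"
    by (rule Bochner_Integration.integral_sum[symmetric]) (rule mesh_integrable_cell[OF assms])
  also have "\<dots> = (\<integral>x. f x \<partial>lebesgue_on \<Omega>)"
  proof (rule integral_cong_AE)
    show "AE x in lebesgue_on \<Omega>. (\<Sum>T\<in>\<T>. indicator (interior T) x * f x) = f x"
      using mesh_unique_cell_AE
    proof eventually_elim
      case (elim x)
      then obtain T where "T \<in> \<T>" "x \<in> interior T" by blast
      from mesh_sum_at_cell[OF this, of "\<lambda>_. f x"] show ?case .
    qed
    show "(\<lambda>x. \<Sum>T\<in>\<T>. indicator (interior T) x * f x) \<in> borel_measurable (lebesgue_on \<Omega>)"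
      by (intro borel_measurable_sum borel_measurable_integrable mesh_integrable_cell assms)
    show "f \<in> borel_measurable (lebesgue_on \<Omega>)" by (rule borel_measurable_integrable[OF assms])
  qed
  finally show ?thesis by simp
qed

lemma mesh_L2_cell: "u \<in> L2 \<Omega> \<Longrightarrow> (\<lambda>x. indicator (interior T) x * u x) \<in> L2 \<Omega>"
proof -
  assume u: "u \<in> L2 \<Omega>"
  have "(\<lambda>x. (indicator (interior T) x * u x)\<^sup>2) = (\<lambda>x. indicator (interior T) x * (u x)\<^sup>2)"
    by (rule ext) (simp add: indicator_def)
  moreover have "integrable (lebesgue_on \<Omega>) (\<lambda>x. indicator (interior T) x * (u x)\<^sup>2)"
    using u by (intro mesh_integrable_cell) (simp add: L2_iff)
  moreover have "(\<lambda>x. indicator (interior T) x * u x) \<in> borel_measurable (lebesgue_on \<Omega>)"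
    by (intro borel_measurable_times indicator_interior_measurable L2_measurable[OF u])
  ultimately show ?thesis by (simp only: L2_iff)
qed

section \<open>Finite element functions\<close>

text \<open>
  Extended by zero, a finite element function is Lipschitz: it is so on each cell and on the
  complement of the domain, and these finitely many closed sets cover the plane. Its piecewise
  gradient is therefore a weak gradient.
\<close>

lemma Y_space_weak_gradient:
  assumes v: "v \<in> Y_space \<Omega> \<T>"
  obtains G where "has_weak_gradient \<Omega> v G"
    "\<And>T b c x. T \<in> \<T> \<Longrightarrow> (\<And>x. x \<in> T \<Longrightarrow> v x = b \<bullet> x + c) \<Longrightarrow> x \<in> interior T \<Longrightarrow> G x = b"
proof -
  define V where "V x = (if x \<in> closure \<Omega> then v x else 0)" for x
  have "\<forall>T\<in>\<T>. \<exists>b c. \<forall>x\<in>T. v x = b \<bullet> x + c" using v by (simp add: Y_space_def)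
  then obtain b c where bc: "\<And>T x. T \<in> \<T> \<Longrightarrow> x \<in> T \<Longrightarrow> v x = b T \<bullet> x + c T" by metis
  have Vaff: "V x = b T \<bullet> x + c T" if "T \<in> \<T>" "x \<in> T" for T x
    using bc[OF that] that mesh_Union by (auto simp: V_def)
  have V0: "V x = 0" if "x \<notin> \<Omega>" for x
    using that v \<Omega> by (auto simp: V_def Y_space_def frontier_def interior_open)
  define L where "L = (\<Sum>T\<in>\<T>. norm (b T))"
  have Lb: "norm (b T) \<le> L" if "T \<in> \<T>" for T
    unfolding L_def by (rule member_le_sum[OF that]) (use mesh_finite in auto)
  have L0: "0 \<le> L" unfolding L_def by (rule sum_nonneg) simp
  have lip: "L-lipschitz_on UNIV V"
  proof (rule lipschitz_on_UNIV_pieces[where I = "insert (- \<Omega>) \<T>" and U = "\<lambda>T. T"])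
    show "L-lipschitz_on T V" if "T \<in> insert (- \<Omega>) \<T>" for T
    proof (cases "T \<in> \<T>")
      case True
      show ?thesis
      proof (rule lipschitz_onI[OF _ L0])
        fix x y assume "x \<in> T" "y \<in> T"
        then have "dist (V x) (V y) = \<bar>b T \<bullet> (x - y)\<bar>"
          using True by (simp add: Vaff dist_real_def inner_diff_right)
        also have "\<dots> \<le> norm (b T) * norm (x - y)" by (rule Cauchy_Schwarz_ineq2)
        also have "\<dots> \<le> L * dist x y"
          unfolding dist_norm by (rule mult_right_mono[OF Lb[OF True]]) simp
        finally show "dist (V x) (V y) \<le> L * dist x y" .
      qed
    next
      case False
      with that have "T = - \<Omega>" by auto
      then show ?thesis using L0 by (intro lipschitz_onI) (auto simp: V0)
    qed
    show "(\<Union>T\<in>insert (- \<Omega>) \<T>. T) = UNIV"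
      using mesh_Union closure_subset[of \<Omega>] by auto
  qed (use mesh_finite mesh_cell(1) \<Omega> in \<open>auto intro: compact_imp_closed\<close>)
  let ?q = "\<lambda>i n x. (V (x - quotient_step n *\<^sub>R axis i 1) - V x) / quotient_step n"
  define G where "G x = (\<chi> i. - lim (\<lambda>n. ?q i n x))" for x
  have Vm [measurable]: "V \<in> borel_measurable borel"
    by (rule borel_measurable_continuous_onI[OF lipschitz_on_continuous_on[OF lip]])
  have Gm: "(\<lambda>x. G x $ i) \<in> borel_measurable borel" for i
    unfolding G_def by simp
  have loc: "(\<lambda>n. ?q i n x) \<longlonglongrightarrow> - (b' $ i)"
    if U: "open U" "x \<in> U" and aff: "\<And>y. y \<in> U \<Longrightarrow> V y = b' \<bullet> y + c'" for U x b' c' i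
  proof -
    have "(\<lambda>n. x - quotient_step n *\<^sub>R axis i 1) \<longlonglongrightarrow> x - 0 *\<^sub>R axis i 1"
      by (intro tendsto_intros quotient_step_tendsto)
    then have "\<forall>\<^sub>F n in sequentially. x - quotient_step n *\<^sub>R axis i 1 \<in> U"
      using U by (auto dest: topological_tendstoD)
    then have "\<forall>\<^sub>F n in sequentially. - (b' $ i) = ?q i n x"
    proof eventually_elim
      case (elim n)
      have "V (x - quotient_step n *\<^sub>R axis i 1) - V x = - (quotient_step n * b' $ i)"
        unfolding aff[OF elim] aff[OF U(2)] by (simp add: inner_diff_right inner_axis)
      then show ?case by simp
    qed
    then show ?thesis by (rule Lim_transform_eventually[OF tendsto_const])
  qed
  have GT: "G x = b'" if T: "T \<in> \<T>" "\<And>x. x \<in> T \<Longrightarrow> v x = b' \<bullet> x + c'" "x \<in> interior T" for T b' c' x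
  proof -
    have "(\<lambda>n. ?q i n x) \<longlonglongrightarrow> - (b' $ i)" for i
    proof (rule loc[of "interior T" _ _ c'])
      fix y assume "y \<in> interior T"
      then have "y \<in> T" using interior_subset by auto
      then show "V y = b' \<bullet> y + c'" using T mesh_Union by (auto simp: V_def)
    qed (use T in auto)
    then have "lim (\<lambda>n. ?q i n x) = - (b' $ i)" for i by (rule limI)
    then show ?thesis by (simp only: G_def vec_eq_iff vec_lambda_beta minus_minus) simp
  qed
  have conv: "AE x in lborel. (\<lambda>n. ?q i n x) \<longlonglongrightarrow> - G x $ i" for i
    using mesh_frontiers_null
  proof eventually_elim
    case (elim x)
    have "convergent (\<lambda>n. ?q i n x)"
    proof (cases "x \<in> closure \<Omega>")
      case True
      then obtain T where T: "T \<in> \<T>" "x \<in> T" using mesh_Union by auto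
      then have "x \<in> interior T" using elim closure_subset[of T] by (auto simp: frontier_def)
      then have "(\<lambda>n. ?q i n x) \<longlonglongrightarrow> - (b T $ i)"
        by (intro loc[of "interior T" _ _ "c T"]) (use T(1) Vaff interior_subset in auto)
      then show ?thesis by (rule convergentI)
    next
      case False
      then have "(\<lambda>n. ?q i n x) \<longlonglongrightarrow> - (0 $ i)"
        by (intro loc[of "- closure \<Omega>" _ 0 0]) (auto simp: V_def)
      then show ?thesis by (rule convergentI)
    qed
    then show ?case by (simp add: G_def convergent_LIMSEQ_iff)
  qed
  have "has_weak_gradient \<Omega> v G"
    by (rule has_weak_gradient_cong[OF lipschitz_has_weak_gradient[OF \<Omega> lip V0 Gm conv]])
      (use closure_subset[of \<Omega>] in \<open>auto simp: V_def\<close>)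
  then show ?thesis by (rule that) (rule GT)
qed

text \<open>
  On a cell, the constant gradient \<open>b\<close> is recovered from any weak gradient \<open>g\<close> by testing with one
  bump function. The disc for the bump is the half of the inscribed one on which \<open>v\<close> does not
  vanish: a closed cell may contain boundary points of the domain in its interior, but \<open>v\<close> is zero
  there.
\<close>

lemma Y_space_gradient_on_cell:
  assumes v: "v \<in> Y_space \<Omega> \<T>" and g: "has_weak_gradient \<Omega> v g"
    and T: "T \<in> \<T>" and aff: "\<And>x. x \<in> T \<Longrightarrow> v x = b \<bullet> x + c"
  shows "exp (-8) / 16 * \<kappa>\<^sup>2 * h\<^sup>2 * (norm b)\<^sup>2
    \<le> (\<integral>x. indicator (interior T) x * (norm (g x))\<^sup>2 \<partial>lebesgue_on \<Omega>)"
proof (cases "b = 0")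
  case True
  then show ?thesis by (auto intro!: Bochner_Integration.integral_nonneg simp: indicator_def)
next
  case False
  obtain z where z: "ball z (\<kappa> * h) \<subseteq> T" using mesh_ball[OF T] by auto
  define r where "r = \<kappa> * h / 2"
  have r: "0 < r" using mesh_pos by (simp add: r_def)
  \<comment> \<open>Moving the centre by \<open>r\<close> in the direction in which \<open>\<bar>v\<bar>\<close> grows keeps \<open>v\<close> away from zero.\<close>
  define s :: real where "s = (if 0 \<le> v z then 1 else -1)"
  define z' where "z' = z + (s * r / norm b) *\<^sub>R b"
  have s: "\<bar>s\<bar> = 1" "s * s = 1" by (auto simp: s_def)
  have ns: "norm ((s * r / norm b) *\<^sub>R b) = r" using False r s by (simp add: abs_mult)
  have b1: "ball z' r \<subseteq> ball z (\<kappa> * h)"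
  proof
    fix x assume "x \<in> ball z' r"
    then have "dist z x < dist z z' + r" using dist_triangle[of z x z'] by simp
    also have "dist z z' = r" using ns by (simp add: z'_def dist_norm)
    finally show "x \<in> ball z (\<kappa> * h)" by (simp add: r_def)
  qed
  have zT: "z \<in> T" using z mesh_pos by (auto intro: subsetD)
  have b2: "ball z' r \<subseteq> interior T" using b1 z by (intro interior_maximal) auto
  have b3: "ball z' r \<subseteq> \<Omega>"
  proof
    fix x assume x: "x \<in> ball z' r"
    then have xT: "x \<in> T" using b1 z by auto
    have "s * (b \<bullet> (x - z')) \<ge> - (norm b * norm (x - z'))"
      using Cauchy_Schwarz_ineq2[of b "x - z'"] s(1) by (auto simp: s_def split: if_splits)
    moreover have "norm b * norm (x - z') < norm b * r"
      using x False by (simp add: dist_norm norm_minus_commute)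
    moreover have "s * (b \<bullet> (z' - z)) = norm b * r"
    proof -
      have "s * (b \<bullet> (z' - z)) = (s * s) * r * ((b \<bullet> b) / norm b)" by (simp add: z'_def mult_ac)
      then show ?thesis using s False by (simp add: power2_norm_eq_inner[symmetric] power2_eq_square mult_ac)
    qed
    moreover have "s * v x = s * v z + s * (b \<bullet> (z' - z)) + s * (b \<bullet> (x - z'))"
      using aff[OF xT] aff[OF zT] by (simp add: algebra_simps inner_diff_right)
    moreover have "0 \<le> s * v z" by (auto simp: s_def)
    ultimately have "0 < s * v x" by linarith
    then have "v x \<noteq> 0" by auto
    then have "x \<notin> frontier \<Omega>" using v by (auto simp: Y_space_def)
    moreover have "x \<in> closure \<Omega>" using xT T mesh_Union by auto
    ultimately show "x \<in> \<Omega>" using \<Omega> by (auto simp: frontier_def interior_open)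
  qed
  obtain \<phi> where \<phi>: "\<phi> \<in> test_functions \<Omega>" "\<And>x. 0 \<le> \<phi> x" "\<And>x. \<phi> x \<le> 1"
    "\<And>x. x \<notin> ball z' r \<Longrightarrow> \<phi> x = 0" "exp (-8) / 4 * r\<^sup>2 \<le> (\<integral>x. \<phi> x \<partial>lebesgue_on \<Omega>)"
    using test_function_in_ball[OF mesh_lmeasurable r b3] by blast
  let ?I = "\<integral>x. \<phi> x \<partial>lebesgue_on \<Omega>"
  have "0 < exp (-8) / 4 * r\<^sup>2" using r by simp
  then have I0: "0 < ?I" using \<phi>(5) by linarith
  have "Ck 0 \<phi>" using \<phi>(1) unfolding test_functions_def by blast
  then have \<phi>c: "continuous_on UNIV \<phi>" by simp
  have "\<bar>\<phi> x\<bar> \<le> 1" for x using \<phi>(2,3)[of x] by simp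
  then have \<phi>L: "\<phi> \<in> L2 \<Omega>"
    by (intro L2_bounded(1)[OF mesh_lmeasurable, where B = 1]
        continuous_lebesgue_on_measurable[OF \<phi>c mesh_sets]) simp_all
  have gL: "(\<lambda>x. g x $ i) \<in> L2 \<Omega>" for i using g by (simp add: has_weak_gradient_def)
  obtain G where G: "has_weak_gradient \<Omega> v G" and G_cell: "\<And>T b c x. T \<in> \<T> \<Longrightarrow>
      (\<And>x. x \<in> T \<Longrightarrow> v x = b \<bullet> x + c) \<Longrightarrow> x \<in> interior T \<Longrightarrow> G x = b"
    using Y_space_weak_gradient[OF v] by blast
  have GT: "G x = b" if "x \<in> interior T" for x by (rule G_cell[OF T aff that])
  have comp: "?I * (b $ i)\<^sup>2 \<le> (\<integral>x. indicator (interior T) x * (g x $ i)\<^sup>2 \<partial>lebesgue_on \<Omega>)" for i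
  proof -
    let ?gi = "\<lambda>x. indicator (interior T) x * g x $ i"
    have \<phi>T: "\<phi> x = 0" if "x \<notin> interior T" for x by (rule \<phi>(4)) (use b2 that in blast)
    have "(\<integral>x. v x * grad \<phi> x $ i \<partial>lebesgue_on \<Omega>) = - (\<integral>x. g x $ i * \<phi> x \<partial>lebesgue_on \<Omega>)"
      "(\<integral>x. v x * grad \<phi> x $ i \<partial>lebesgue_on \<Omega>) = - (\<integral>x. G x $ i * \<phi> x \<partial>lebesgue_on \<Omega>)"
      using g G \<phi>(1) unfolding has_weak_gradient_def by blast+
    then have gG: "(\<integral>x. G x $ i * \<phi> x \<partial>lebesgue_on \<Omega>) = (\<integral>x. g x $ i * \<phi> x \<partial>lebesgue_on \<Omega>)"
      by linarith
    have b_G: "b $ i * \<phi> x = G x $ i * \<phi> x" for x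
      using GT[of x] \<phi>T[of x] by (cases "x \<in> interior T") simp_all
    have "b $ i * ?I = (\<integral>x. b $ i * \<phi> x \<partial>lebesgue_on \<Omega>)" by simp
    also have "\<dots> = (\<integral>x. G x $ i * \<phi> x \<partial>lebesgue_on \<Omega>)"
      by (simp only: b_G)
    also have "\<dots> = (\<integral>x. g x $ i * \<phi> x \<partial>lebesgue_on \<Omega>)"
      by (rule gG)
    also have "\<dots> = L2_inner \<Omega> ?gi \<phi>"
      unfolding L2_inner_def
      by (intro Bochner_Integration.integral_cong refl) (use \<phi>T in \<open>auto simp: indicator_def\<close>)
    finally have "\<bar>b $ i * ?I\<bar> \<le> L2_norm \<Omega> ?gi * L2_norm \<Omega> \<phi>"
      using L2_Cauchy_Schwarz[OF mesh_L2_cell[OF gL] \<phi>L] by simp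
    then have "\<bar>b $ i * ?I\<bar>\<^sup>2 \<le> (L2_norm \<Omega> ?gi * L2_norm \<Omega> \<phi>)\<^sup>2"
      by (rule power_mono) simp
    then have "(b $ i * ?I)\<^sup>2 \<le> (L2_norm \<Omega> ?gi)\<^sup>2 * (L2_norm \<Omega> \<phi>)\<^sup>2"
      by (simp only: power2_abs power_mult_distrib)
    also have "\<dots> \<le> (L2_norm \<Omega> ?gi)\<^sup>2 * ?I"
      unfolding L2_norm_sq[of _ \<phi>]
    proof (intro mult_left_mono integral_mono)
      show "integrable (lebesgue_on \<Omega>) \<phi>" by (rule L2_integrable[OF mesh_lmeasurable \<phi>L])
      show "integrable (lebesgue_on \<Omega>) (\<lambda>x. (\<phi> x)\<^sup>2)" using \<phi>L by (simp add: L2_iff)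
      show "(\<phi> x)\<^sup>2 \<le> \<phi> x" for x using \<phi>(2,3)[of x] by (simp add: power2_eq_square mult_left_le)
    qed simp
    finally have "(b $ i)\<^sup>2 * ?I * ?I \<le> (L2_norm \<Omega> ?gi)\<^sup>2 * ?I"
      by (simp only: power_mult_distrib power2_eq_square[of ?I] mult.assoc)
    then have "(b $ i)\<^sup>2 * ?I \<le> (L2_norm \<Omega> ?gi)\<^sup>2" using I0 by simp
    also have "\<dots> = (\<integral>x. indicator (interior T) x * (g x $ i)\<^sup>2 \<partial>lebesgue_on \<Omega>)"
      unfolding L2_norm_sq by (intro Bochner_Integration.integral_cong) (auto simp: indicator_def)
    finally show ?thesis by (simp add: mult.commute)
  qed
  have n2: "(norm x)\<^sup>2 = (\<Sum>i\<in>UNIV. (x $ i)\<^sup>2)" for x :: "real^2"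
    by (simp add: norm_vec_def L2_set_def sum_nonneg)
  have "exp (-8) / 16 * \<kappa>\<^sup>2 * h\<^sup>2 * (norm b)\<^sup>2 = exp (-8) / 4 * r\<^sup>2 * (norm b)\<^sup>2"
    by (simp add: r_def power_mult_distrib power_divide)
  also have "\<dots> \<le> ?I * (norm b)\<^sup>2" by (rule mult_right_mono[OF \<phi>(5)]) simp
  also have "\<dots> = (\<Sum>i\<in>UNIV. ?I * (b $ i)\<^sup>2)" by (simp add: n2 sum_distrib_left)
  also have "\<dots> \<le> (\<Sum>i\<in>UNIV. \<integral>x. indicator (interior T) x * (g x $ i)\<^sup>2 \<partial>lebesgue_on \<Omega>)"
    by (rule sum_mono) (rule comp)
  also have "\<dots> = (\<integral>x. (\<Sum>i\<in>UNIV. indicator (interior T) x * (g x $ i)\<^sup>2) \<partial>lebesgue_on \<Omega>)"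
    by (rule Bochner_Integration.integral_sum[symmetric]) (use gL in \<open>auto intro!: mesh_integrable_cell simp: L2_iff\<close>)
  also have "\<dots> = (\<integral>x. indicator (interior T) x * (norm (g x))\<^sup>2 \<partial>lebesgue_on \<Omega>)"
    by (simp add: n2 sum_distrib_left)
  finally show ?thesis .
qed

end

context regular_mesh
begin

lemma mesh_cell_area:
  assumes "T \<in> \<T>"
  shows "(\<integral>x. indicator (interior T) x \<partial>lebesgue_on \<Omega>) \<le> 4 * h\<^sup>2"
proof (cases "T = {}")
  case False
  then obtain z where z: "z \<in> T" by auto
  define K :: "(real^2) set" where "K = cbox (\<chi> i. z $ i - h) (\<chi> i. z $ i + h)"
  have "interior T \<subseteq> K"
  proof
    fix x assume "x \<in> interior T"
    then have "x \<in> T" using interior_subset by auto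
    have "\<bar>(x - z) $ i\<bar> \<le> h" for i
      using component_le_norm_cart[of "x - z" i] mesh_cell(3)[OF assms \<open>x \<in> T\<close> z]
      by (simp add: dist_norm)
    then have "\<bar>x $ i - z $ i\<bar> \<le> h" for i by simp
    then have "z $ i - h \<le> x $ i \<and> x $ i \<le> z $ i + h" for i
    proof -
      have "\<bar>x $ i - z $ i\<bar> \<le> h" by fact
      then show ?thesis by linarith
    qed
    then show "x \<in> K" by (simp add: K_def mem_box_cart)
  qed
  then have sub: "interior T \<inter> \<Omega> \<subseteq> K" by auto
  have "(\<integral>x. indicator (interior T) x \<partial>lebesgue_on \<Omega>) = measure lebesgue (interior T \<inter> \<Omega>)"
    using mesh_sets by (simp add: measure_restrict_space Int_assoc)
  also have "\<dots> \<le> measure lebesgue K"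
    by (rule measure_mono_fmeasurable[OF sub]) (use \<Omega> in \<open>auto simp: K_def\<close>)
  also have "\<dots> = (2 * h)\<^sup>2"
    unfolding K_def using mesh_pos
    by (subst measure_completion) (auto simp: content_cbox_cart interval_ne_empty_cart power2_eq_square)
  finally show ?thesis by (simp add: power_mult_distrib)
qed (use mesh_pos in simp)

text \<open>
  A finite element function differs from a constant on each cell by at most \<open>h\<close> times the length of
  its gradient there, so its pairing with a function of zero cell means gains a factor \<open>h\<close>.
\<close>

lemma Y_space_zero_mean_pairing:
  assumes v: "v \<in> Y_space \<Omega> \<T>" and g: "has_weak_gradient \<Omega> v g" and vL: "v \<in> L2 \<Omega>"
    and r: "r \<in> L2 \<Omega>"
    and mean: "\<And>T. T \<in> \<T> \<Longrightarrow> (\<integral>x. indicator (interior T) x * r x \<partial>lebesgue_on \<Omega>) = 0"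
  shows "\<bar>L2_inner \<Omega> v r\<bar>
    \<le> 8 * exp 4 / \<kappa> * h * sqrt (\<integral>x. (norm (g x))\<^sup>2 \<partial>lebesgue_on \<Omega>) * L2_norm \<Omega> r"
proof -
  define g2 where "g2 T = (\<integral>x. indicator (interior T) x * (norm (g x))\<^sup>2 \<partial>lebesgue_on \<Omega>)" for T
  define r2 where "r2 T = (\<integral>x. indicator (interior T) x * (r x)\<^sup>2 \<partial>lebesgue_on \<Omega>)" for T
  have g20: "0 \<le> g2 T" for T unfolding g2_def by (intro Bochner_Integration.integral_nonneg) simp
  have r20: "0 \<le> r2 T" for T unfolding r2_def by (intro Bochner_Integration.integral_nonneg) simp
  have n2: "(norm x)\<^sup>2 = (\<Sum>i\<in>UNIV. (x $ i)\<^sup>2)" for x :: "real^2"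
    by (simp add: norm_vec_def L2_set_def sum_nonneg)
  have ig: "integrable (lebesgue_on \<Omega>) (\<lambda>x. (norm (g x))\<^sup>2)"
  proof -
    have "(\<lambda>x. g x $ i) \<in> L2 \<Omega>" for i using g unfolding has_weak_gradient_def by blast
    then show ?thesis unfolding n2 L2_iff by (intro Bochner_Integration.integrable_sum) blast
  qed
  have ir: "integrable (lebesgue_on \<Omega>) (\<lambda>x. (r x)\<^sup>2)" using r by (simp add: L2_iff)
  have i1: "integrable (lebesgue_on \<Omega>) r" by (rule L2_integrable[OF mesh_lmeasurable r])
  have ivr: "integrable (lebesgue_on \<Omega>) (\<lambda>x. v x * r x)" by (rule L2_mult_integrable[OF vL r])
  have cell: "\<bar>\<integral>x. indicator (interior T) x * (v x * r x) \<partial>lebesgue_on \<Omega>\<bar>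
      \<le> 8 * exp 4 / \<kappa> * h * (sqrt (g2 T) * sqrt (r2 T))" if T: "T \<in> \<T>" for T
  proof -
    obtain b c where aff: "\<And>x. x \<in> T \<Longrightarrow> v x = b \<bullet> x + c" using v T unfolding Y_space_def by blast
    obtain z where "ball z (\<kappa> * h) \<subseteq> T" using mesh_ball[OF T] by auto
    moreover have "z \<in> ball z (\<kappa> * h)" using mesh_pos by simp
    ultimately have zT: "z \<in> T" by blast
    have "(\<integral>x. indicator (interior T) x * (v x * r x) \<partial>lebesgue_on \<Omega>)
        = (\<integral>x. indicator (interior T) x * (v x * r x) - v z * (indicator (interior T) x * r x) \<partial>lebesgue_on \<Omega>)"
      using mesh_integrable_cell[OF ivr, of T] mesh_integrable_cell[OF i1, of T] mean[OF T]
      by simp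
    also have "\<bar>\<dots>\<bar> \<le> (\<integral>x. norm b * h * \<bar>indicator (interior T) x * r x\<bar> \<partial>lebesgue_on \<Omega>)"
    proof (rule integral_abs_bound[THEN order_trans], rule integral_mono)
      show "integrable (lebesgue_on \<Omega>)
          (\<lambda>x. \<bar>indicator (interior T) x * (v x * r x) - v z * (indicator (interior T) x * r x)\<bar>)"
        by (intro integrable_abs Bochner_Integration.integrable_diff integrable_mult_right mesh_integrable_cell ivr i1)
      show "integrable (lebesgue_on \<Omega>) (\<lambda>x. norm b * h * \<bar>indicator (interior T) x * r x\<bar>)"
        by (intro integrable_abs integrable_mult_right mesh_integrable_cell i1)
      fix x
      show "\<bar>indicator (interior T) x * (v x * r x) - v z * (indicator (interior T) x * r x)\<bar>
          \<le> norm b * h * \<bar>indicator (interior T) x * r x\<bar>"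
      proof (cases "x \<in> interior T")
        case True
        then have xT: "x \<in> T" using interior_subset by auto
        have "\<bar>v x - v z\<bar> = \<bar>b \<bullet> (x - z)\<bar>" using aff[OF xT] aff[OF zT] by (simp add: inner_diff_right)
        also have "\<dots> \<le> norm b * norm (x - z)" by (rule Cauchy_Schwarz_ineq2)
        also have "\<dots> \<le> norm b * h"
          using mesh_cell(3)[OF T xT zT] by (intro mult_left_mono) (auto simp: dist_norm)
        finally have "\<bar>v x - v z\<bar> * \<bar>r x\<bar> \<le> norm b * h * \<bar>r x\<bar>" by (rule mult_right_mono) simp
        moreover have "v x * r x - v z * r x = (v x - v z) * r x" by (simp add: left_diff_distrib)
        ultimately show ?thesis using True by (simp add: abs_mult)
      qed simp
    qed
    also have "\<dots> = norm b * h * (\<integral>x. \<bar>indicator (interior T) x * r x\<bar> \<partial>lebesgue_on \<Omega>)" by simp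
    also have "\<dots> \<le> norm b * h * (2 * h * sqrt (r2 T))"
    proof (rule mult_left_mono)
      have one: "(\<lambda>x. 1) \<in> L2 \<Omega>" by (rule L2_bounded(1)[OF mesh_lmeasurable, where B = 1]) auto
      have ar: "(\<lambda>x. \<bar>r x\<bar>) \<in> L2 \<Omega>" using r borel_measurable_abs by (auto simp: L2_iff)
      have sq: "(\<lambda>x. (indicator (interior T) x * 1)\<^sup>2) = (\<lambda>x::real^2. indicator (interior T) x :: real)"
        "(\<lambda>x. (indicator (interior T) x * \<bar>r x\<bar>)\<^sup>2) = (\<lambda>x. indicator (interior T) x * (r x)\<^sup>2)"
        by (auto simp: indicator_def)
      have "(\<integral>x. \<bar>indicator (interior T) x * r x\<bar> \<partial>lebesgue_on \<Omega>)
          = L2_inner \<Omega> (\<lambda>x. indicator (interior T) x * 1) (\<lambda>x. indicator (interior T) x * \<bar>r x\<bar>)"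
        unfolding L2_inner_def by (intro Bochner_Integration.integral_cong refl) (simp add: indicator_def)
      also have "\<dots> \<le> L2_norm \<Omega> (\<lambda>x. indicator (interior T) x * 1) * L2_norm \<Omega> (\<lambda>x. indicator (interior T) x * \<bar>r x\<bar>)"
        using L2_Cauchy_Schwarz[OF mesh_L2_cell[OF one, of T] mesh_L2_cell[OF ar, of T]] by linarith
      also have "\<dots> \<le> sqrt (4 * h\<^sup>2) * sqrt (r2 T)"
        unfolding L2_norm_eq sq r2_def[symmetric]
        by (intro mult_right_mono real_sqrt_le_mono mesh_cell_area T) (simp add: r20)
      finally show "(\<integral>x. \<bar>indicator (interior T) x * r x\<bar> \<partial>lebesgue_on \<Omega>) \<le> 2 * h * sqrt (r2 T)"
        using mesh_pos by (simp add: real_sqrt_mult)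
    qed (use mesh_pos in simp)
    also have "\<dots> = 2 * h * (norm b * h) * sqrt (r2 T)" by simp
    also have "\<dots> \<le> 2 * h * (4 * exp 4 / \<kappa> * sqrt (g2 T)) * sqrt (r2 T)"
    proof (intro mult_left_mono mult_right_mono)
      have "exp (-8) / 16 * \<kappa>\<^sup>2 * h\<^sup>2 * (norm b)\<^sup>2 \<le> g2 T"
        unfolding g2_def by (rule Y_space_gradient_on_cell[OF v g T aff])
      moreover have "exp (-8) / 16 * \<kappa>\<^sup>2 * h\<^sup>2 * (norm b)\<^sup>2 = (exp (-4) / 4 * \<kappa> * (norm b * h))\<^sup>2"
      proof -
        have "(exp (-4))\<^sup>2 = exp (-8 :: real)" by (simp add: power2_eq_square flip: exp_add)
        then show ?thesis by (simp add: power_mult_distrib power_divide)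
      qed
      ultimately have "exp (-4) / 4 * \<kappa> * (norm b * h) \<le> sqrt (g2 T)"
        by (intro real_le_rsqrt) simp
      then show "norm b * h \<le> 4 * exp 4 / \<kappa> * sqrt (g2 T)"
        using mesh_pos by (simp add: exp_minus field_simps)
    qed (use mesh_pos r20 in auto)
    finally show ?thesis by (simp add: mult_ac)
  qed
  have "\<bar>L2_inner \<Omega> v r\<bar> = \<bar>\<Sum>T\<in>\<T>. \<integral>x. indicator (interior T) x * (v x * r x) \<partial>lebesgue_on \<Omega>\<bar>"
    unfolding L2_inner_def by (subst mesh_integral_split[OF ivr]) simp
  also have "\<dots> \<le> (\<Sum>T\<in>\<T>. 8 * exp 4 / \<kappa> * h * (sqrt (g2 T) * sqrt (r2 T)))"
    by (rule order_trans[OF sum_abs sum_mono[OF cell]])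
  also have "\<dots> = 8 * exp 4 / \<kappa> * h * (\<Sum>T\<in>\<T>. sqrt (g2 T) * sqrt (r2 T))"
    by (simp add: sum_distrib_left)
  also have "\<dots> \<le> 8 * exp 4 / \<kappa> * h * (sqrt (\<integral>x. (norm (g x))\<^sup>2 \<partial>lebesgue_on \<Omega>) * L2_norm \<Omega> r)"
  proof (rule mult_left_mono)
    have "(\<Sum>T\<in>\<T>. sqrt (g2 T) * sqrt (r2 T)) \<le> L2_set (\<lambda>T. sqrt (g2 T)) \<T> * L2_set (\<lambda>T. sqrt (r2 T)) \<T>"
      using L2_set_mult_ineq[of "\<lambda>T. sqrt (g2 T)" "\<lambda>T. sqrt (r2 T)" \<T>] g20 r20 by simp
    also have "\<dots> = sqrt (\<Sum>T\<in>\<T>. g2 T) * sqrt (\<Sum>T\<in>\<T>. r2 T)" by (simp add: L2_set_def g20 r20)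
    also have "(\<Sum>T\<in>\<T>. g2 T) = (\<integral>x. (norm (g x))\<^sup>2 \<partial>lebesgue_on \<Omega>)"
      unfolding g2_def by (rule mesh_integral_split[OF ig, symmetric])
    also have "(\<Sum>T\<in>\<T>. r2 T) = (\<integral>x. (r x)\<^sup>2 \<partial>lebesgue_on \<Omega>)"
      unfolding r2_def by (rule mesh_integral_split[OF ir, symmetric])
    finally show "(\<Sum>T\<in>\<T>. sqrt (g2 T) * sqrt (r2 T))
        \<le> sqrt (\<integral>x. (norm (g x))\<^sup>2 \<partial>lebesgue_on \<Omega>) * L2_norm \<Omega> r"
      by (simp add: L2_norm_eq)
  qed (use mesh_pos in simp)
  finally show ?thesis by (simp add: mult.assoc)
qed

lemma Y_space_weak_grad:
  assumes "v \<in> Y_space \<Omega> \<T>"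
  shows "has_weak_gradient \<Omega> v (weak_grad \<Omega> v)"
proof -
  obtain G where "has_weak_gradient \<Omega> v G" by (rule Y_space_weak_gradient[OF assms])
  then show ?thesis unfolding weak_grad_def by (rule someI[where P = "has_weak_gradient \<Omega> v"])
qed

lemma Y_space_L2:
  assumes "v \<in> Y_space \<Omega> \<T>"
  shows "v \<in> L2 \<Omega>"
  using Y_space_weak_grad[OF assms] unfolding has_weak_gradient_def by (rule conjunct1)

end

section \<open>The elliptic operator\<close>

lemma bilinear_form_commute:
  assumes "elliptic_coefficients \<Omega> a c\<^sub>0"
  shows "bilinear_form \<Omega> a c\<^sub>0 y v = bilinear_form \<Omega> a c\<^sub>0 v y"
  unfolding bilinear_form_def
proof (rule Bochner_Integration.integral_cong)
  fix x assume "x \<in> space (lebesgue_on \<Omega>)"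
  then have "x \<in> closure \<Omega>" using closure_subset[of \<Omega>] by auto
  then have t: "transpose (a x) = a x" using assms unfolding elliptic_coefficients_def by blast
  have sym: "a x $ i $ j = a x $ j $ i" for i j
  proof -
    have "a x $ i $ j = transpose (a x) $ j $ i" by (simp add: transpose_def)
    then show ?thesis by (simp only: t)
  qed
  have "(\<Sum>i\<in>UNIV. \<Sum>j\<in>UNIV. a x $ i $ j * weak_grad \<Omega> y x $ j * weak_grad \<Omega> v x $ i)
      = (\<Sum>j\<in>UNIV. \<Sum>i\<in>UNIV. a x $ i $ j * weak_grad \<Omega> y x $ j * weak_grad \<Omega> v x $ i)"
    by (rule sum.swap)
  also have "\<dots> = (\<Sum>i\<in>UNIV. \<Sum>j\<in>UNIV. a x $ i $ j * weak_grad \<Omega> v x $ j * weak_grad \<Omega> y x $ i)"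
    by (intro sum.cong refl) (simp add: sym mult_ac)
  finally show "(\<Sum>i\<in>UNIV. \<Sum>j\<in>UNIV. a x $ i $ j * weak_grad \<Omega> y x $ j * weak_grad \<Omega> v x $ i) + c\<^sub>0 x * y x * v x
      = (\<Sum>i\<in>UNIV. \<Sum>j\<in>UNIV. a x $ i $ j * weak_grad \<Omega> v x $ j * weak_grad \<Omega> y x $ i) + c\<^sub>0 x * v x * y x"
    by (simp add: mult_ac)
qed simp

text \<open>
  The defining equivalence, applied to \<open>S w\<close> itself.
\<close>

lemma solution_operator_form:
  assumes "solution_operator \<Omega> a c\<^sub>0 V S" "w \<in> L2 \<Omega>"
  shows "S w \<in> V" "v \<in> V \<Longrightarrow> bilinear_form \<Omega> a c\<^sub>0 (S w) v = L2_inner \<Omega> w v"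
proof -
  show V: "S w \<in> V" using assms unfolding solution_operator_def by blast
  have "AE x in lebesgue_on \<Omega>. S w x = S w x" by simp
  then show "bilinear_form \<Omega> a c\<^sub>0 (S w) v = L2_inner \<Omega> w v" if "v \<in> V"
    using assms V that unfolding solution_operator_def by blast
qed

lemma solution_operator_symmetric:
  assumes S: "solution_operator \<Omega> a c\<^sub>0 V S" and a: "elliptic_coefficients \<Omega> a c\<^sub>0"
    and V: "V \<subseteq> L2 \<Omega>"
  shows "symmetric_L2 \<Omega> S"
  unfolding symmetric_L2_def
proof (intro conjI ballI)
  note form = solution_operator_form[OF S]
  show "S u \<in> L2 \<Omega>" if "u \<in> L2 \<Omega>" for u using form(1)[OF that] V by auto
  fix u v assume uv: "u \<in> L2 \<Omega>" "v \<in> L2 \<Omega>"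
  have "L2_inner \<Omega> u (S v) = bilinear_form \<Omega> a c\<^sub>0 (S u) (S v)"
    using form(2)[OF uv(1) form(1)[OF uv(2)]] by simp
  also have "\<dots> = bilinear_form \<Omega> a c\<^sub>0 (S v) (S u)" by (rule bilinear_form_commute[OF a])
  also have "\<dots> = L2_inner \<Omega> v (S u)" using form(2)[OF uv(2) form(1)[OF uv(1)]] by simp
  finally show "L2_inner \<Omega> (S u) v = L2_inner \<Omega> u (S v)" by (simp add: L2_inner_commute)
qed

text \<open>
  The weak gradient has to exist: otherwise \<^const>\<open>weak_grad\<close> is an arbitrary function, whose square
  need not be integrable.
\<close>

lemma bilinear_form_coercive:
  assumes \<Omega>: "open \<Omega>" "bounded \<Omega>" and a: "elliptic_coefficients \<Omega> a c\<^sub>0"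
  obtains \<theta> where "0 < \<theta>"
    "\<And>v. has_weak_gradient \<Omega> v (weak_grad \<Omega> v) \<Longrightarrow>
       \<theta> * (\<integral>x. (norm (weak_grad \<Omega> v x))\<^sup>2 \<partial>lebesgue_on \<Omega>) \<le> bilinear_form \<Omega> a c\<^sub>0 v v"
proof -
  have lm: "\<Omega> \<in> lmeasurable" and ls: "\<Omega> \<in> sets lebesgue"
    using \<Omega> by (auto intro: lmeasurable_open simp: fmeasurableD)
  obtain \<theta> where \<theta>: "0 < \<theta>" "\<And>x \<xi>. x \<in> closure \<Omega> \<Longrightarrow> \<theta> * (norm \<xi>)\<^sup>2 \<le> \<xi> \<bullet> (a x *v \<xi>)"
    using a unfolding elliptic_coefficients_def by blast
  have ac: "continuous_on (closure \<Omega>) a" and cL: "c\<^sub>0 \<in> Linf \<Omega>" and c0: "AE x in lebesgue_on \<Omega>. 0 \<le> c\<^sub>0 x"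
    using a unfolding elliptic_coefficients_def by blast+
  have aijc: "continuous_on (closure \<Omega>) (\<lambda>x. a x $ i $ j)" for i j
    by (intro continuous_on_component ac)
  have aijm: "(\<lambda>x. a x $ i $ j) \<in> borel_measurable (lebesgue_on \<Omega>)" for i j
    by (rule continuous_imp_measurable_on_sets_lebesgue[OF continuous_on_subset[OF aijc closure_subset] ls])
  have aijb: "\<exists>B. \<forall>x\<in>closure \<Omega>. \<bar>a x $ i $ j\<bar> \<le> B" for i j
  proof -
    have "compact ((\<lambda>x. a x $ i $ j) ` closure \<Omega>)"
      by (intro compact_continuous_image aijc) (use \<Omega> in \<open>simp add: compact_closure\<close>)
    then show ?thesis by (force dest!: compact_imp_bounded simp: bounded_iff)
  qed
  have cm: "c\<^sub>0 \<in> borel_measurable (lebesgue_on \<Omega>)" using cL by (simp add: Linf_def)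
  obtain C where C: "AE x in lebesgue_on \<Omega>. \<bar>c\<^sub>0 x\<bar> \<le> C"
  proof -
    let ?E = "esssup (lebesgue_on \<Omega>) (\<lambda>x. ereal \<bar>c\<^sub>0 x\<bar>)"
    have "?E \<noteq> \<infinity>" using cL by (simp add: Linf_def Linf_norm_def)
    then obtain n :: nat where n: "?E < ereal (real n)" by (auto simp: less_PInf_Ex_of_nat)
    have "AE x in lebesgue_on \<Omega>. ereal \<bar>c\<^sub>0 x\<bar> \<le> ?E" by (rule esssup_AE)
    then have "AE x in lebesgue_on \<Omega>. \<bar>c\<^sub>0 x\<bar> \<le> real n"
    proof eventually_elim
      case (elim x)
      then have "ereal \<bar>c\<^sub>0 x\<bar> \<le> ereal (real n)" using n by (rule order_trans[OF _ less_imp_le])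
      then show ?case by simp
    qed
    then show ?thesis by (rule that)
  qed
  have mult_int: "integrable (lebesgue_on \<Omega>) (\<lambda>x. k x * f x)"
    if "integrable (lebesgue_on \<Omega>) f" "k \<in> borel_measurable (lebesgue_on \<Omega>)"
      "AE x in lebesgue_on \<Omega>. \<bar>k x\<bar> \<le> B" for k f :: "real^2 \<Rightarrow> real" and B
  proof (rule Bochner_Integration.integrable_bound[where f = "\<lambda>x. B * f x"])
    show "integrable (lebesgue_on \<Omega>) (\<lambda>x. B * f x)" using that by simp
    show "(\<lambda>x. k x * f x) \<in> borel_measurable (lebesgue_on \<Omega>)"
      by (intro borel_measurable_times borel_measurable_integrable that)
    show "AE x in lebesgue_on \<Omega>. norm (k x * f x) \<le> norm (B * f x)"
      using that(3)
    proof eventually_elim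
      case (elim x)
      then have "\<bar>k x\<bar> \<le> \<bar>B\<bar>" by linarith
      then show ?case by (simp add: abs_mult mult_right_mono)
    qed
  qed
  have "\<theta> * (\<integral>x. (norm (weak_grad \<Omega> v x))\<^sup>2 \<partial>lebesgue_on \<Omega>) \<le> bilinear_form \<Omega> a c\<^sub>0 v v"
    if wg: "has_weak_gradient \<Omega> v (weak_grad \<Omega> v)" for v
  proof -
    define g where "g = weak_grad \<Omega> v"
    have vL: "v \<in> L2 \<Omega>" and gL: "(\<lambda>x. g x $ i) \<in> L2 \<Omega>" for i
      using wg by (auto simp: has_weak_gradient_def g_def)
    have n2: "(norm x)\<^sup>2 = (\<Sum>i\<in>UNIV. (x $ i)\<^sup>2)" for x :: "real^2"
      by (simp add: norm_vec_def L2_set_def sum_nonneg)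
    have quad: "(\<Sum>i\<in>UNIV. \<Sum>j\<in>UNIV. a x $ i $ j * g x $ j * g x $ i) = g x \<bullet> (a x *v g x)" for x
      by (simp add: inner_vec_def matrix_vector_mult_def sum_distrib_left mult_ac)
    have 1: "integrable (lebesgue_on \<Omega>) (\<lambda>x. \<Sum>i\<in>UNIV. \<Sum>j\<in>UNIV. a x $ i $ j * g x $ j * g x $ i)"
    proof (intro Bochner_Integration.integrable_sum)
      fix i j
      obtain B where B: "\<forall>x\<in>closure \<Omega>. \<bar>a x $ i $ j\<bar> \<le> B" using aijb by blast
      have "AE x in lebesgue_on \<Omega>. \<bar>a x $ i $ j\<bar> \<le> B"
        using AE_space
      proof eventually_elim
        case (elim x)
        then have "x \<in> closure \<Omega>" using closure_subset[of \<Omega>] by auto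
        then show ?case using B by blast
      qed
      from mult_int[OF L2_mult_integrable[OF gL gL] aijm this]
      show "integrable (lebesgue_on \<Omega>) (\<lambda>x. a x $ i $ j * g x $ j * g x $ i)" by (simp add: mult.assoc)
    qed
    have 2: "integrable (lebesgue_on \<Omega>) (\<lambda>x. c\<^sub>0 x * v x * v x)"
      using mult_int[OF L2_mult_integrable[OF vL vL] cm C] by (simp add: mult.assoc)
    have "\<theta> * (\<integral>x. (norm (g x))\<^sup>2 \<partial>lebesgue_on \<Omega>) = (\<integral>x. \<theta> * (norm (g x))\<^sup>2 \<partial>lebesgue_on \<Omega>)" by simp
    also have "\<dots> \<le> (\<integral>x. (\<Sum>i\<in>UNIV. \<Sum>j\<in>UNIV. a x $ i $ j * g x $ j * g x $ i) + c\<^sub>0 x * v x * v x \<partial>lebesgue_on \<Omega>)"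
    proof (rule integral_mono_AE)
      show "integrable (lebesgue_on \<Omega>) (\<lambda>x. \<theta> * (norm (g x))\<^sup>2)"
        unfolding n2 using gL by (intro integrable_mult_right Bochner_Integration.integrable_sum) (simp add: L2_iff)
      show "integrable (lebesgue_on \<Omega>) (\<lambda>x. (\<Sum>i\<in>UNIV. \<Sum>j\<in>UNIV. a x $ i $ j * g x $ j * g x $ i) + c\<^sub>0 x * v x * v x)"
        by (rule Bochner_Integration.integrable_add[OF 1 2])
      show "AE x in lebesgue_on \<Omega>. \<theta> * (norm (g x))\<^sup>2
          \<le> (\<Sum>i\<in>UNIV. \<Sum>j\<in>UNIV. a x $ i $ j * g x $ j * g x $ i) + c\<^sub>0 x * v x * v x"
        using c0 AE_space
      proof eventually_elim
        case (elim x)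
        then have "x \<in> closure \<Omega>" using closure_subset[of \<Omega>] by auto
        moreover have "0 \<le> c\<^sub>0 x * v x * v x" using elim by (simp add: mult.assoc)
        ultimately show ?case unfolding quad using \<theta>(2)[of x "g x"] by linarith
      qed
    qed
    finally show ?thesis by (simp add: bilinear_form_def g_def)
  qed
  with \<theta>(1) show ?thesis by (rule that)
qed

section \<open>Step functions have bounded variation\<close>

text \<open>
  A convex set moved by \<open>e\<close> stays inside its dilation by the factor \<open>1 + \<bar>e\<bar>/r\<close> about the centre
  of an inscribed disc of radius \<open>r\<close>, so it leaves the original set only by an area of order \<open>\<bar>e\<bar>\<close>.
\<close>

lemma convex_translation_area:
  fixes T :: "(real^2) set"
  assumes T: "compact T" "convex T" and r: "0 < r" "ball z r \<subseteq> T" and e: "norm e < r"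
  shows "measure lebesgue ((+) e ` T - T) \<le> 3 / r * norm e * measure lebesgue T"
proof -
  define s where "s = norm e / r"
  have s: "0 \<le> s" "s < 1" using r e by (auto simp: s_def)
  have zT: "z \<in> T" using r by (meson centre_in_ball subsetD)
  define c where "c = z - (1 + s) *\<^sub>R z"
  let ?D = "(\<lambda>x. (1 + s) *\<^sub>R x + c) ` T"
  have lm: "T \<in> lmeasurable" by (rule lmeasurable_compact[OF T(1)])
  have D: "compact ?D" by (intro compact_continuous_image continuous_intros T)
  have mem: "x \<in> ?D" if "z + (1 / (1 + s)) *\<^sub>R (x - z) \<in> T" for x
  proof (rule image_eqI[OF _ that])
    have "(1 + s) *\<^sub>R (z + (1 / (1 + s)) *\<^sub>R (x - z)) = (1 + s) *\<^sub>R z + (x - z)"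
      using s by (simp add: scaleR_add_right)
    then show "x = (1 + s) *\<^sub>R (z + (1 / (1 + s)) *\<^sub>R (x - z)) + c" by (simp add: c_def)
  qed
  have sub1: "(+) e ` T \<subseteq> ?D"
  proof
    fix x assume "x \<in> (+) e ` T"
    then obtain y where y: "y \<in> T" "x = e + y" by auto
    show "x \<in> ?D"
    proof (cases "s = 0")
      case True
      then have "e = 0" using r by (simp add: s_def)
      then show ?thesis using y True by (intro mem) (simp add: algebra_simps)
    next
      case False
      then have s0: "0 < s" "e \<noteq> 0" using s r by (auto simp: s_def)
      \<comment> \<open>\<open>z + e/s\<close> lies on the sphere of radius \<open>r\<close> about \<open>z\<close>, hence in the closed set \<open>T\<close>.\<close>
      have "norm ((1 / s) *\<^sub>R e) = r" using s0 r by (simp add: s_def)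
      then have "z + (1 / s) *\<^sub>R e \<in> cball z r" by (simp add: dist_norm)
      moreover have "cball z r \<subseteq> T"
        using r closure_minimal[OF r(2) compact_imp_closed[OF T(1)]] by simp
      ultimately have "z + (1 / s) *\<^sub>R e \<in> T" by auto
      then have "(1 / (1 + s)) *\<^sub>R y + (s / (1 + s)) *\<^sub>R (z + (1 / s) *\<^sub>R e) \<in> T"
        using s y(1) by (intro convexD[OF T(2)]) (auto simp: field_simps)
      also have "(1 / (1 + s)) *\<^sub>R y + (s / (1 + s)) *\<^sub>R (z + (1 / s) *\<^sub>R e)
          = z + (1 / (1 + s)) *\<^sub>R (x - z)"
      proof -
        have "(s / (1 + s)) *\<^sub>R (z + (1 / s) *\<^sub>R e) = z - (1 / (1 + s)) *\<^sub>R z + (1 / (1 + s)) *\<^sub>R e"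
        proof -
          have "s / (1 + s) = 1 - 1 / (1 + s)" "s / (1 + s) * (1 / s) = 1 / (1 + s)"
            using s0 by (simp_all add: field_simps)
          then show ?thesis by (simp only: scaleR_add_right scaleR_scaleR scaleR_diff_left scaleR_one)
        qed
        then show ?thesis by (simp add: y(2) scaleR_add_right scaleR_diff_right algebra_simps)
      qed
      finally show ?thesis by (rule mem)
    qed
  qed
  have sub2: "T \<subseteq> ?D"
  proof
    fix x assume x: "x \<in> T"
    have "(1 - 1 / (1 + s)) *\<^sub>R z + (1 / (1 + s)) *\<^sub>R x \<in> T"
      using s by (intro convexD[OF T(2) zT x]) (auto simp: field_simps)
    then show "x \<in> ?D" by (intro mem) (simp add: algebra_simps)
  qed
  have lmD: "?D \<in> lmeasurable" by (rule lmeasurable_compact[OF D])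
  have "measure lebesgue ((+) e ` T - T) \<le> measure lebesgue (?D - T)"
  proof (rule measure_mono_fmeasurable)
    show "(+) e ` T - T \<subseteq> ?D - T" using sub1 by blast
    show "(+) e ` T - T \<in> sets lebesgue"
      by (intro sets.Diff fmeasurableD[OF measurable_translation[OF lm]] fmeasurableD[OF lm])
    show "?D - T \<in> lmeasurable" by (rule fmeasurable_Diff[OF lmD fmeasurableD[OF lm]])
  qed
  also have "\<dots> = measure lebesgue ?D - measure lebesgue T"
    by (rule measurable_measure_Diff[OF lmD fmeasurableD[OF lm] sub2])
  also have "measure lebesgue ?D = (1 + s)\<^sup>2 * measure lebesgue T"
    using s by (subst measure_lebesgue_affine) simp
  also have "(1 + s)\<^sup>2 * measure lebesgue T - measure lebesgue T = (2 * s + s * s) * measure lebesgue T"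
    by (simp add: power2_eq_square algebra_simps)
  also have "\<dots> \<le> (3 * s) * measure lebesgue T"
    using s mult_left_mono[of s 1 s] by (intro mult_right_mono) auto
  finally show ?thesis by (simp add: s_def)
qed

text \<open>
  The difference quotients of the indicator function live on the two sides of the symmetric
  difference of \<open>T\<close> and its translate, which have the same area, of the order of the translation.
\<close>

lemma convex_indicator_variation:
  fixes T :: "(real^2) set"
  assumes T: "compact T" "convex T" and r: "0 < r" "ball z r \<subseteq> T"
    and \<phi>: "Ck 1 \<phi>" "compact (closure {x. \<phi> x \<noteq> 0})" "\<And>x. \<bar>\<phi> x\<bar> \<le> 1"
  shows "\<bar>\<integral>x. indicator T x * grad \<phi> x $ i \<partial>lborel\<bar> \<le> 6 / r * measure lebesgue T"
proof -
  let ?e = "axis i 1 :: real^2"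
  let ?u = "indicator T :: real^2 \<Rightarrow> real"
  have Tb: "T \<in> sets borel" by (rule borel_compact[OF T(1)])
  have lm: "T \<in> lmeasurable" by (rule lmeasurable_compact[OF T(1)])
  have fin: "emeasure lborel A < \<infinity>" if "compact A" for A :: "(real^2) set"
    using that by (rule emeasure_compact_finite)
  have iu: "integrable lborel ?u"
    using Tb fin[OF T(1)] by (intro integrable_real_indicator) auto
  have meas: "measure lborel A = measure lebesgue A" if "A \<in> sets borel" for A :: "(real^2) set"
    using that by (simp add: measure_completion)
  have bound: "\<bar>\<integral>x. (?u (x - s *\<^sub>R ?e) - ?u x) / s * \<phi> x \<partial>lborel\<bar> \<le> 6 / r * measure lebesgue T"
    if s: "0 < s" "s < r" for s
  proof -
    let ?T = "(+) (s *\<^sub>R ?e) ` T"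
    have cT: "compact ?T" by (rule compact_translation[OF T(1)])
    have lm': "?T \<in> lmeasurable" by (rule lmeasurable_compact[OF cT])
    have Tb': "?T \<in> sets borel" by (rule borel_compact[OF cT])
    have uT: "?u (x - s *\<^sub>R ?e) = indicator ?T x" for x
    proof -
      have "x - s *\<^sub>R ?e \<in> T \<longleftrightarrow> x \<in> ?T"
      proof
        assume "x - s *\<^sub>R ?e \<in> T"
        then show "x \<in> ?T" by (intro image_eqI[of _ _ "x - s *\<^sub>R ?e"]) simp_all
      qed auto
      then show ?thesis by (simp add: indicator_def)
    qed
    have ns: "norm (s *\<^sub>R ?e) = s" using s by (simp add: norm_axis_1)
    have a1: "measure lebesgue (?T - T) \<le> 3 / r * s * measure lebesgue T"
      using convex_translation_area[OF T r, of "s *\<^sub>R ?e"] s by (simp add: ns)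
    have "measure lebesgue (T - ?T) = measure lebesgue T - measure lebesgue (T \<inter> ?T)"
      using measurable_measure_Diff[OF lm fmeasurableD[OF fmeasurable.Int[OF lm lm']]] by (simp add: Diff_Int)
    moreover have "measure lebesgue (?T - T) = measure lebesgue ?T - measure lebesgue (T \<inter> ?T)"
      using measurable_measure_Diff[OF lm' fmeasurableD[OF fmeasurable.Int[OF lm lm']]] by (simp add: Diff_Int)
    moreover have "measure lebesgue ?T = measure lebesgue T" by (rule measure_translation)
    ultimately have a2: "measure lebesgue (T - ?T) = measure lebesgue (?T - T)" by simp
    have i1: "integrable lborel (\<lambda>x. indicator (?T - T) x + indicator (T - ?T) x :: real)"
    proof (intro Bochner_Integration.integrable_add integrable_real_indicator)
      show "emeasure lborel (?T - T) < \<infinity>"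
        by (rule le_less_trans[OF emeasure_mono fin[OF cT]]) (use Tb' in auto)
      show "emeasure lborel (T - ?T) < \<infinity>"
        by (rule le_less_trans[OF emeasure_mono fin[OF T(1)]]) (use Tb in auto)
    qed (use Tb Tb' in auto)
    have \<phi>m: "\<phi> \<in> borel_measurable borel"
      by (rule borel_measurable_continuous_onI[OF Ck_continuous[OF \<phi>(1)]])
    have le: "\<bar>(?u (x - s *\<^sub>R ?e) - ?u x) / s * \<phi> x\<bar>
        \<le> (1 / s) * (indicator (?T - T) x + indicator (T - ?T) x)" for x
    proof -
      have "\<bar>(?u (x - s *\<^sub>R ?e) - ?u x) / s * \<phi> x\<bar>
          = (1 / s) * (\<bar>indicator ?T x - indicator T x\<bar> * \<bar>\<phi> x\<bar>)"
        unfolding uT using s by (simp add: abs_mult)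
      also have "\<dots> \<le> (1 / s) * (\<bar>indicator ?T x - indicator T x\<bar> * 1)"
        using s \<phi>(3)[of x] by (intro mult_left_mono) auto
      also have "\<bar>indicator ?T x - indicator T x\<bar> * 1 = (indicator (?T - T) x + indicator (T - ?T) x :: real)"
        unfolding indicator_def by auto
      finally show ?thesis .
    qed
    have i2: "integrable lborel (\<lambda>x. (1 / s) * (indicator (?T - T) x + indicator (T - ?T) x) :: real)"
      by (rule integrable_mult_right[OF i1])
    have i3: "integrable lborel (\<lambda>x. (?u (x - s *\<^sub>R ?e) - ?u x) / s * \<phi> x)"
    proof (rule Bochner_Integration.integrable_bound[OF i2])
      have "(\<lambda>x. (indicator ?T x - indicator T x) / s * \<phi> x) \<in> borel_measurable borel"
        by (intro borel_measurable_times borel_measurable_divide borel_measurable_diff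
            borel_measurable_indicator borel_measurable_const \<phi>m Tb Tb')
      then show "(\<lambda>x. (?u (x - s *\<^sub>R ?e) - ?u x) / s * \<phi> x) \<in> borel_measurable lborel"
        unfolding uT by simp
      have "norm ((?u (x - s *\<^sub>R ?e) - ?u x) / s * \<phi> x)
        \<le> norm ((1 / s) * (indicator (?T - T) x + indicator (T - ?T) x))" for x
        unfolding real_norm_def using le[of x] by (rule order_trans) (use s in simp)
      then show "AE x in lborel. norm ((?u (x - s *\<^sub>R ?e) - ?u x) / s * \<phi> x)
        \<le> norm ((1 / s) * (indicator (?T - T) x + indicator (T - ?T) x))" by simp
    qed
    have "\<bar>\<integral>x. (?u (x - s *\<^sub>R ?e) - ?u x) / s * \<phi> x \<partial>lborel\<bar>
        \<le> (\<integral>x. (1 / s) * (indicator (?T - T) x + indicator (T - ?T) x) \<partial>lborel)"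
      by (rule order_trans[OF integral_abs_bound integral_mono[OF integrable_abs[OF i3] i2 le]])
    also have "\<dots> = (1 / s) * (measure lebesgue (?T - T) + measure lebesgue (T - ?T))"
    proof -
      have f1: "emeasure lborel (?T - T) < \<infinity>"
        by (rule le_less_trans[OF emeasure_mono fin[OF cT]]) (use Tb' in auto)
      have f2: "emeasure lborel (T - ?T) < \<infinity>"
        by (rule le_less_trans[OF emeasure_mono fin[OF T(1)]]) (use Tb in auto)
      have "(\<integral>x. indicator (?T - T) x + indicator (T - ?T) x \<partial>lborel)
          = measure lborel (?T - T) + measure lborel (T - ?T)"
      proof (subst Bochner_Integration.integral_add)
        show "integrable lborel (indicator (?T - T) :: _ \<Rightarrow> real)"
          using Tb Tb' f1 by (intro integrable_real_indicator) auto
        show "integrable lborel (indicator (T - ?T) :: _ \<Rightarrow> real)"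
          using Tb Tb' f2 by (intro integrable_real_indicator) auto
      qed simp
      moreover have "measure lborel (?T - T) = measure lebesgue (?T - T)"
        "measure lborel (T - ?T) = measure lebesgue (T - ?T)"
        by (rule meas[OF sets.Diff[OF Tb' Tb]], rule meas[OF sets.Diff[OF Tb Tb']])
      ultimately show ?thesis by (simp only: integral_mult_right_zero)
    qed
    also have "\<dots> = (1 / s) * (2 * measure lebesgue (?T - T))" by (simp only: a2 mult_2)
    also have "\<dots> \<le> (1 / s) * (2 * (3 / r * s * measure lebesgue T))"
      by (rule mult_left_mono[OF mult_left_mono[OF a1]]) (use s in simp_all)
    also have "\<dots> = (1 / s * s) * (6 / r * measure lebesgue T)" by simp
    also have "\<dots> = 6 / r * measure lebesgue T" using s by simp
    finally show ?thesis .
  qed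
  have "\<forall>\<^sub>F n in sequentially. quotient_step n < r"
    using quotient_step_tendsto r(1) by (rule order_tendstoD)
  then have "\<forall>\<^sub>F n in sequentially. \<bar>\<integral>x. (?u (x - quotient_step n *\<^sub>R ?e) - ?u x) / quotient_step n * \<phi> x \<partial>lborel\<bar>
      \<le> 6 / r * measure lebesgue T"
    by eventually_elim (intro bound, simp_all)
  then show ?thesis
    by (intro tendsto_upperbound[OF tendsto_rabs[OF integral_difference_quotient_tendsto[OF iu \<phi>(1,2)]]]) simp_all
qed

definition BV_test_field :: "(real^2) set \<Rightarrow> (real^2 \<Rightarrow> real^2) \<Rightarrow> bool" where
  "BV_test_field \<Omega> \<psi> \<longleftrightarrow> (\<forall>i. Ck 1 (\<lambda>y. \<psi> y $ i)) \<and> compactly_supported_in \<Omega> \<psi> \<and> (\<forall>x. norm (\<psi> x) \<le> 1)"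

definition divergence :: "(real^2 \<Rightarrow> real^2) \<Rightarrow> real^2 \<Rightarrow> real" where
  "divergence \<psi> x = (\<Sum>i\<in>UNIV. grad (\<lambda>y. \<psi> y $ i) x $ i)"

lemma BV_iff: "u \<in> BV \<Omega> \<longleftrightarrow> integrable (lebesgue_on \<Omega>) u \<and>
    (\<exists>M. \<forall>\<psi>. BV_test_field \<Omega> \<psi> \<longrightarrow> (\<integral>x. u x * divergence \<psi> x \<partial>lebesgue_on \<Omega>) \<le> M)"
  unfolding BV_def bdd_above_def BV_test_field_def divergence_def by blast

lemma BV_test_field_component:
  assumes "BV_test_field \<Omega> \<psi>"
  shows "Ck 1 (\<lambda>y. \<psi> y $ i)" "compact (closure {x. \<psi> x $ i \<noteq> 0})" "\<bar>\<psi> x $ i\<bar> \<le> 1"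
    "x \<notin> \<Omega> \<Longrightarrow> grad (\<lambda>y. \<psi> y $ i) x $ j = 0" "continuous_on UNIV (\<lambda>x. grad (\<lambda>y. \<psi> y $ i) x $ j)"
    "\<exists>B. \<forall>x. \<bar>grad (\<lambda>y. \<psi> y $ i) x $ j\<bar> \<le> B"
proof -
  show Ck: "Ck 1 (\<lambda>y. \<psi> y $ i)" using assms unfolding BV_test_field_def by blast
  then have d: "(\<lambda>y. \<psi> y $ i) differentiable (at x)" for x by simp
  show gc: "continuous_on UNIV (\<lambda>x. grad (\<lambda>y. \<psi> y $ i) x $ j)" using Ck by simp
  have K: "compact (closure {x. \<psi> x \<noteq> 0})" "closure {x. \<psi> x \<noteq> 0} \<subseteq> \<Omega>"
    using assms unfolding BV_test_field_def compactly_supported_in_def by blast+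
  have "{x. \<psi> x $ i \<noteq> 0} \<subseteq> {x. \<psi> x \<noteq> 0}" by auto
  then have sub: "closure {x. \<psi> x $ i \<noteq> 0} \<subseteq> closure {x. \<psi> x \<noteq> 0}" by (rule closure_mono)
  show c: "compact (closure {x. \<psi> x $ i \<noteq> 0})"
    using compact_Int_closed[OF K(1) closed_closure[of "{x. \<psi> x $ i \<noteq> 0}"]] sub
    by (simp add: Int_absorb1)
  have "norm (\<psi> x) \<le> 1" using assms unfolding BV_test_field_def by blast
  then show "\<bar>\<psi> x $ i\<bar> \<le> 1" using component_le_norm_cart[of "\<psi> x" i] by linarith
  show "grad (\<lambda>y. \<psi> y $ i) x $ j = 0" if "x \<notin> \<Omega>"
    by (rule grad_support[OF d]) (use that sub K in blast)
  have "compact ((\<lambda>x. grad (\<lambda>y. \<psi> y $ i) x $ j) ` closure {x. \<psi> x $ i \<noteq> 0})"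
    by (intro compact_continuous_image continuous_on_subset[OF gc] c) simp
  then obtain B where B: "\<And>x. x \<in> closure {x. \<psi> x $ i \<noteq> 0} \<Longrightarrow> \<bar>grad (\<lambda>y. \<psi> y $ i) x $ j\<bar> \<le> B"
    by (force dest!: compact_imp_bounded simp: bounded_iff)
  have "\<bar>grad (\<lambda>y. \<psi> y $ i) x $ j\<bar> \<le> max B 0" for x
  proof (cases "x \<in> closure {x. \<psi> x $ i \<noteq> 0}")
    case True
    then show ?thesis using B[of x] by linarith
  next
    case False
    then show ?thesis using grad_support[OF d False] by simp
  qed
  then show "\<exists>B. \<forall>x. \<bar>grad (\<lambda>y. \<psi> y $ i) x $ j\<bar> \<le> B" by blast
qed

lemma divergence_integrable:
  assumes \<psi>: "BV_test_field \<Omega> \<psi>" and \<Omega>: "\<Omega> \<in> sets lebesgue" and u: "integrable (lebesgue_on \<Omega>) u"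
  shows "integrable (lebesgue_on \<Omega>) (\<lambda>x. u x * grad (\<lambda>y. \<psi> y $ i) x $ j)"
    "integrable (lebesgue_on \<Omega>) (\<lambda>x. u x * divergence \<psi> x)"
proof -
  show *: "integrable (lebesgue_on \<Omega>) (\<lambda>x. u x * grad (\<lambda>y. \<psi> y $ i) x $ j)" for i j
  proof -
    obtain B where B: "\<And>x. \<bar>grad (\<lambda>y. \<psi> y $ i) x $ j\<bar> \<le> B"
      using BV_test_field_component(6)[OF \<psi>] by blast
    show ?thesis
    proof (rule Bochner_Integration.integrable_bound[where f = "\<lambda>x. B * u x"])
      show "integrable (lebesgue_on \<Omega>) (\<lambda>x. B * u x)" using u by simp
      show "(\<lambda>x. u x * grad (\<lambda>y. \<psi> y $ i) x $ j) \<in> borel_measurable (lebesgue_on \<Omega>)"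
        by (intro borel_measurable_times borel_measurable_integrable[OF u]
            continuous_lebesgue_on_measurable[OF BV_test_field_component(5)[OF \<psi>] \<Omega>])
      have "\<bar>u x * grad (\<lambda>y. \<psi> y $ i) x $ j\<bar> \<le> \<bar>B * u x\<bar>" for x
        using mult_left_mono[OF order_trans[OF B abs_ge_self], of "\<bar>u x\<bar>" x] by (simp add: abs_mult mult.commute)
      then show "AE x in lebesgue_on \<Omega>. norm (u x * grad (\<lambda>y. \<psi> y $ i) x $ j) \<le> norm (B * u x)" by simp
    qed
  qed
  show "integrable (lebesgue_on \<Omega>) (\<lambda>x. u x * divergence \<psi> x)"
    unfolding divergence_def sum_distrib_left by (intro Bochner_Integration.integrable_sum *)
qed

lemma BV_nonneg_combination:
  assumes \<Omega>: "\<Omega> \<in> sets lebesgue" and u: "u \<in> BV \<Omega>" and v: "v \<in> BV \<Omega>" and ab: "0 \<le> a" "0 \<le> b"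
  shows "(\<lambda>x. a * u x + b * v x) \<in> BV \<Omega>"
proof -
  obtain M N where M: "\<And>\<psi>. BV_test_field \<Omega> \<psi> \<Longrightarrow> (\<integral>x. u x * divergence \<psi> x \<partial>lebesgue_on \<Omega>) \<le> M"
    and N: "\<And>\<psi>. BV_test_field \<Omega> \<psi> \<Longrightarrow> (\<integral>x. v x * divergence \<psi> x \<partial>lebesgue_on \<Omega>) \<le> N"
    and i: "integrable (lebesgue_on \<Omega>) u" "integrable (lebesgue_on \<Omega>) v"
    using u v unfolding BV_iff by blast
  have "(\<integral>x. (a * u x + b * v x) * divergence \<psi> x \<partial>lebesgue_on \<Omega>) \<le> a * M + b * N"
    if \<psi>: "BV_test_field \<Omega> \<psi>" for \<psi>
  proof -
    have "(\<integral>x. (a * u x + b * v x) * divergence \<psi> x \<partial>lebesgue_on \<Omega>)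
        = (\<integral>x. a * (u x * divergence \<psi> x) + b * (v x * divergence \<psi> x) \<partial>lebesgue_on \<Omega>)"
      by (simp add: algebra_simps)
    also have "\<dots> = a * (\<integral>x. u x * divergence \<psi> x \<partial>lebesgue_on \<Omega>) + b * (\<integral>x. v x * divergence \<psi> x \<partial>lebesgue_on \<Omega>)"
      using divergence_integrable(2)[OF \<psi> \<Omega> i(1)] divergence_integrable(2)[OF \<psi> \<Omega> i(2)] by simp
    also have "\<dots> \<le> a * M + b * N" using M[OF \<psi>] N[OF \<psi>] ab by (intro add_mono mult_left_mono)
    finally show ?thesis .
  qed
  moreover have "integrable (lebesgue_on \<Omega>) (\<lambda>x. a * u x + b * v x)" using i by simp
  ultimately show ?thesis unfolding BV_iff by blast
qed

context regular_mesh
begin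

lemma U_space_BV:
  assumes u: "u \<in> U_space \<Omega> \<T>" and iu: "integrable (lebesgue_on \<Omega>) u"
  shows "u \<in> BV \<Omega>"
proof -
  have "\<forall>T\<in>\<T>. \<exists>c. AE x in lebesgue_on \<Omega>. x \<in> T \<longrightarrow> u x = c" using u unfolding U_space_def by blast
  from bchoice[OF this] obtain c
    where c: "\<And>T. T \<in> \<T> \<Longrightarrow> AE x in lebesgue_on \<Omega>. x \<in> T \<longrightarrow> u x = c T" by blast
  have r: "0 < \<kappa> * h" using mesh_pos by simp
  have "(\<integral>x. u x * divergence \<psi> x \<partial>lebesgue_on \<Omega>)
      \<le> (\<Sum>T\<in>\<T>. \<bar>c T\<bar> * (\<Sum>i\<in>(UNIV :: 2 set). 6 / (\<kappa> * h) * measure lebesgue T))"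
    if \<psi>: "BV_test_field \<Omega> \<psi>" for \<psi>
  proof -
    have cell: "(\<integral>x. indicator (interior T) x * (u x * divergence \<psi> x) \<partial>lebesgue_on \<Omega>)
        \<le> \<bar>c T\<bar> * (\<Sum>i\<in>(UNIV :: 2 set). 6 / (\<kappa> * h) * measure lebesgue T)" if T: "T \<in> \<T>" for T
    proof -
      obtain z where z: "ball z (\<kappa> * h) \<subseteq> T" using mesh_ball[OF T] by blast
      have Tb: "T \<in> sets borel" by (rule borel_compact[OF mesh_cell(1)[OF T]])
      let ?g = "\<lambda>i x. grad (\<lambda>y. \<psi> y $ i) x $ i"
      have gm: "(\<lambda>x. ?g i x) \<in> borel_measurable borel" for i
        by (rule borel_measurable_continuous_onI[OF BV_test_field_component(5)[OF \<psi>]])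
      have mT: "(\<lambda>x. indicator T x :: real) \<in> borel_measurable (lebesgue_on \<Omega>)"
        using Tb by (intro measurable_restrict_space1 measurable_completion) simp
      have i1: "integrable (lebesgue_on \<Omega>) (\<lambda>x. indicator T x :: real)"
      proof -
        interpret finite_measure "lebesgue_on \<Omega>" by (rule finite_measure_lebesgue_on[OF mesh_lmeasurable])
        have "AE x in lebesgue_on \<Omega>. norm (indicator T x :: real) \<le> 1" by (simp add: indicator_def)
        then show ?thesis using mT by (rule integrable_const_bound)
      qed
      have ig: "integrable (lebesgue_on \<Omega>) (\<lambda>x. indicator T x * ?g i x)" for i
        by (rule divergence_integrable(1)[OF \<psi> mesh_sets i1])
      have "(\<integral>x. indicator (interior T) x * (u x * divergence \<psi> x) \<partial>lebesgue_on \<Omega>)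
          = (\<integral>x. c T * (\<Sum>i\<in>UNIV. indicator T x * ?g i x) \<partial>lebesgue_on \<Omega>)"
      proof (rule integral_cong_AE)
        show "(\<lambda>x. indicator (interior T) x * (u x * divergence \<psi> x)) \<in> borel_measurable (lebesgue_on \<Omega>)"
          by (intro borel_measurable_integrable mesh_integrable_cell divergence_integrable(2)[OF \<psi> mesh_sets iu])
        show "(\<lambda>x. c T * (\<Sum>i\<in>UNIV. indicator T x * ?g i x)) \<in> borel_measurable (lebesgue_on \<Omega>)"
          by (intro borel_measurable_times borel_measurable_const borel_measurable_sum borel_measurable_integrable ig)
        show "AE x in lebesgue_on \<Omega>. indicator (interior T) x * (u x * divergence \<psi> x)
            = c T * (\<Sum>i\<in>UNIV. indicator T x * ?g i x)"
          using c[OF T] AE_lborel_imp_lebesgue_on[OF mesh_frontiers_null mesh_sets]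
        proof eventually_elim
          case (elim x)
          then have "x \<notin> frontier T" using T by blast
          then have "x \<in> interior T \<longleftrightarrow> x \<in> T"
            using interior_subset[of T] closure_subset[of T] by (auto simp: frontier_def)
          then have "(indicator (interior T) x :: real) = indicator T x" by (simp add: indicator_def)
          moreover have "indicator T x * u x = indicator T x * c T" using elim(1) by (auto simp: indicator_def)
          ultimately have "indicator (interior T) x * (u x * divergence \<psi> x) = c T * (indicator T x * divergence \<psi> x)"
            by (metis mult.assoc mult.commute)
          then show ?case by (simp only: divergence_def sum_distrib_left)
        qed
      qed
      also have "\<dots> = c T * (\<Sum>i\<in>UNIV. \<integral>x. indicator T x * ?g i x \<partial>lebesgue_on \<Omega>)"
        by (simp only: Bochner_Integration.integral_mult_right_zero Bochner_Integration.integral_sum[OF ig])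
      also have "\<dots> \<le> \<bar>c T\<bar> * (\<Sum>i\<in>UNIV. \<bar>\<integral>x. indicator T x * ?g i x \<partial>lebesgue_on \<Omega>\<bar>)"
      proof -
        have "c T * S \<le> \<bar>c T\<bar> * \<bar>S\<bar>" for S using abs_ge_self[of "c T * S"] by (simp only: abs_mult)
        then show ?thesis by (rule order_trans[OF _ mult_left_mono[OF sum_abs abs_ge_zero]])
      qed
      also have "\<dots> \<le> \<bar>c T\<bar> * (\<Sum>i\<in>(UNIV :: 2 set). 6 / (\<kappa> * h) * measure lebesgue T)"
      proof (intro mult_left_mono sum_mono)
        fix i
        have "(\<integral>x. indicator T x * ?g i x \<partial>lebesgue_on \<Omega>) = (\<integral>x. indicator T x * ?g i x \<partial>lborel)"
        proof (rule integral_lebesgue_on_lborel[OF _ mesh_sets])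
          show "(\<lambda>x. indicator T x * ?g i x) \<in> borel_measurable borel"
            using Tb gm by (intro borel_measurable_times borel_measurable_indicator)
          show "indicator T x * ?g i x = 0" if "x \<notin> \<Omega>" for x
            using BV_test_field_component(4)[OF \<psi> that] by simp
        qed
        then show "\<bar>\<integral>x. indicator T x * ?g i x \<partial>lebesgue_on \<Omega>\<bar> \<le> 6 / (\<kappa> * h) * measure lebesgue T"
          using convex_indicator_variation[OF mesh_cell(1)[OF T] mesh_cell(2)[OF T] r z
            BV_test_field_component(1,2)[OF \<psi>] BV_test_field_component(3)[OF \<psi>]] by simp
      qed simp
      finally show ?thesis .
    qed
    have "(\<integral>x. u x * divergence \<psi> x \<partial>lebesgue_on \<Omega>)
        = (\<Sum>T\<in>\<T>. \<integral>x. indicator (interior T) x * (u x * divergence \<psi> x) \<partial>lebesgue_on \<Omega>)"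
      by (rule mesh_integral_split[OF divergence_integrable(2)[OF \<psi> mesh_sets iu]])
    also have "\<dots> \<le> (\<Sum>T\<in>\<T>. \<bar>c T\<bar> * (\<Sum>i\<in>(UNIV :: 2 set). 6 / (\<kappa> * h) * measure lebesgue T))"
      by (rule sum_mono[OF cell])
    finally show ?thesis .
  qed
  then show ?thesis unfolding BV_iff using iu by blast
qed

section \<open>Cell means\<close>

definition cell_mean :: "(real^2 \<Rightarrow> real) \<Rightarrow> (real^2) set \<Rightarrow> real" where
  "cell_mean u T = (\<integral>x. indicator (interior T) x * u x \<partial>lebesgue_on \<Omega>)
     / (\<integral>x. indicator (interior T) x \<partial>lebesgue_on \<Omega>)"

definition cell_projection :: "(real^2 \<Rightarrow> real) \<Rightarrow> real^2 \<Rightarrow> real" where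
  "cell_projection u x = (\<Sum>T\<in>\<T>. indicator (interior T) x * cell_mean u T)"

lemma cell_indicator_integrable:
  "integrable (lebesgue_on \<Omega>) (\<lambda>x. indicator (interior T) x :: real)"
proof -
  interpret finite_measure "lebesgue_on \<Omega>" by (rule finite_measure_lebesgue_on[OF mesh_lmeasurable])
  show ?thesis
    by (rule integrable_const_bound[where B = 1]) (use indicator_interior_measurable in \<open>auto simp: indicator_def\<close>)
qed

lemma cell_area_zero:
  assumes "(\<integral>x. indicator (interior T) x \<partial>lebesgue_on \<Omega>) = (0::real)"
  shows "AE x in lebesgue_on \<Omega>. x \<notin> interior T"
proof -
  have "AE x in lebesgue_on \<Omega>. indicator (interior T) x = (0::real)"
    using assms cell_indicator_integrable by (subst (asm) integral_nonneg_eq_0_iff_AE) auto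
  then show ?thesis by eventually_elim (auto simp: indicator_def)
qed

text \<open>
  On a null cell the mean is \<open>0\<close>, by division by zero, and both sides vanish.
\<close>

lemma cell_mean_integral:
  "(\<integral>x. indicator (interior T) x * u x \<partial>lebesgue_on \<Omega>)
     = cell_mean u T * (\<integral>x. indicator (interior T) x \<partial>lebesgue_on \<Omega>)"
proof (cases "(\<integral>x. indicator (interior T) x \<partial>lebesgue_on \<Omega>) = (0::real)")
  case True
  have "(\<integral>x. indicator (interior T) x * u x \<partial>lebesgue_on \<Omega>) = 0"
    by (rule integral_eq_zero_AE) (use cell_area_zero[OF True] in \<open>eventually_elim, simp\<close>)
  then show ?thesis using True by simp
qed (simp add: cell_mean_def)

lemma cell_mean_bounds:
  assumes u: "integrable (lebesgue_on \<Omega>) u"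
    and b: "AE x in lebesgue_on \<Omega>. x \<in> interior T \<longrightarrow> l \<le> u x \<and> u x \<le> c"
    and pos: "(\<integral>x. indicator (interior T) x \<partial>lebesgue_on \<Omega>) \<noteq> (0::real)"
  shows "l \<le> cell_mean u T" "cell_mean u T \<le> c"
proof -
  let ?A = "(\<integral>x. indicator (interior T) x \<partial>lebesgue_on \<Omega>) :: real"
  have "0 \<le> ?A" by (intro Bochner_Integration.integral_nonneg) simp
  with pos have A: "0 < ?A" by linarith
  have iu: "integrable (lebesgue_on \<Omega>) (\<lambda>x. indicator (interior T) x * u x)"
    by (rule mesh_integrable_cell[OF u])
  have ic: "integrable (lebesgue_on \<Omega>) (\<lambda>x. indicator (interior T) x * k)" for k :: real
    by (rule integrable_mult_left[OF cell_indicator_integrable])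
  have bounds: "AE x in lebesgue_on \<Omega>. indicator (interior T) x * l \<le> indicator (interior T) x * u x"
    "AE x in lebesgue_on \<Omega>. indicator (interior T) x * u x \<le> indicator (interior T) x * c"
    using b by (eventually_elim, simp add: indicator_def)+
  have "l * ?A \<le> (\<integral>x. indicator (interior T) x * u x \<partial>lebesgue_on \<Omega>)"
    using integral_mono_AE[OF ic iu bounds(1)] by (simp add: mult.commute)
  then show "l \<le> cell_mean u T" using A by (simp add: cell_mean_def pos_le_divide_eq)
  have "(\<integral>x. indicator (interior T) x * u x \<partial>lebesgue_on \<Omega>) \<le> c * ?A"
    using integral_mono_AE[OF iu ic bounds(2)] by (simp add: mult.commute)
  then show "cell_mean u T \<le> c" using A by (simp add: cell_mean_def pos_divide_le_eq)
qed

lemma cell_projection_at: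
  "T \<in> \<T> \<Longrightarrow> x \<in> interior T \<Longrightarrow> cell_projection u x = cell_mean u T"
  unfolding cell_projection_def by (rule mesh_sum_at_cell)

lemma cell_projection_measurable: "cell_projection u \<in> borel_measurable (lebesgue_on \<Omega>)"
  unfolding cell_projection_def[abs_def]
  by (intro borel_measurable_sum borel_measurable_times indicator_interior_measurable borel_measurable_const)

lemma cell_projection_U_space: "cell_projection u \<in> U_space \<Omega> \<T>"
proof -
  have "AE x in lebesgue_on \<Omega>. x \<in> T \<longrightarrow> cell_projection u x = cell_mean u T" if T: "T \<in> \<T>" for T
    using mesh_unique_cell_AE
  proof eventually_elim
    case (elim x)
    then have "x \<in> T \<longrightarrow> x \<in> interior T" using T by blast
    then show ?case using cell_projection_at[OF T] by blast
  qed
  then show ?thesis unfolding U_space_def by blast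
qed

lemma cell_projection_U_ad:
  assumes u: "u \<in> U_ad \<Omega> u\<^sub>a u\<^sub>b" and ab: "u\<^sub>a < 0" "0 < u\<^sub>b"
  shows "cell_projection u \<in> U_ad \<Omega> u\<^sub>a u\<^sub>b"
proof -
  have uL: "u \<in> L2 \<Omega>" and ub: "AE x in lebesgue_on \<Omega>. u\<^sub>a \<le> u x \<and> u x \<le> u\<^sub>b"
    using u by (auto simp: U_ad_def)
  have m: "u\<^sub>a \<le> cell_mean u T \<and> cell_mean u T \<le> u\<^sub>b" for T
  proof (cases "(\<integral>x. indicator (interior T) x \<partial>lebesgue_on \<Omega>) = (0::real)")
    case True
    then show ?thesis using ab by (simp add: cell_mean_def)
  next
    case False
    have "AE x in lebesgue_on \<Omega>. x \<in> interior T \<longrightarrow> u\<^sub>a \<le> u x \<and> u x \<le> u\<^sub>b"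
      using ub by eventually_elim simp
    from cell_mean_bounds[OF L2_integrable[OF mesh_lmeasurable uL] this False] show ?thesis by simp
  qed
  have b: "AE x in lebesgue_on \<Omega>. u\<^sub>a \<le> cell_projection u x \<and> cell_projection u x \<le> u\<^sub>b"
    using mesh_unique_cell_AE
  proof eventually_elim
    case (elim x)
    then obtain T where "T \<in> \<T>" "x \<in> interior T" by blast
    then show ?case using m[of T] by (simp add: cell_projection_at)
  qed
  then have "AE x in lebesgue_on \<Omega>. \<bar>cell_projection u x\<bar> \<le> max (- u\<^sub>a) u\<^sub>b"
    by eventually_elim linarith
  then have "cell_projection u \<in> L2 \<Omega>"
    using ab by (intro L2_bounded(1)[OF mesh_lmeasurable cell_projection_measurable]) auto
  then show ?thesis using b by (simp add: U_ad_def)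
qed

lemma cell_projection_zero_mean:
  assumes u: "integrable (lebesgue_on \<Omega>) u" and T: "T \<in> \<T>"
  shows "(\<integral>x. indicator (interior T) x * (u x - cell_projection u x) \<partial>lebesgue_on \<Omega>) = 0"
proof -
  have "(\<integral>x. indicator (interior T) x * (u x - cell_projection u x) \<partial>lebesgue_on \<Omega>)
      = (\<integral>x. indicator (interior T) x * u x - indicator (interior T) x * cell_mean u T \<partial>lebesgue_on \<Omega>)"
    by (intro Bochner_Integration.integral_cong refl)
      (simp add: indicator_def cell_projection_at[OF T])
  also have "\<dots> = 0"
    using mesh_integrable_cell[OF u, of T] cell_indicator_integrable[of T] cell_mean_integral[of T u]
    by simp
  finally show ?thesis .
qed

end

section \<open>The integrand of the control cost\<close>

definition control_density :: "real \<Rightarrow> real \<Rightarrow> real \<Rightarrow> real \<Rightarrow> real \<Rightarrow> real" where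
  "control_density \<alpha> \<beta> q \<gamma> t = \<alpha> / 2 * t\<^sup>2 + \<beta> * h_fun q \<gamma> t powr q"

lemma control_density_minus: "control_density \<alpha> \<beta> q \<gamma> (- t) = control_density \<alpha> \<beta> q \<gamma> t"
  by (simp add: control_density_def h_fun_def)

locale sparse_control =
  fixes \<alpha> \<beta> q \<gamma> :: real
  assumes \<alpha>: "0 < \<alpha>" and \<beta>: "0 < \<beta>" and q: "0 < q" "q < 1" and \<gamma>: "1 < \<gamma>"
begin

abbreviation F :: "real \<Rightarrow> real" where "F \<equiv> control_density \<alpha> \<beta> q \<gamma>"

text \<open>
  The penalty \<open>h(t)\<^sup>q\<close> equals \<open>\<delta> \<bar>t\<bar>\<close> up to \<open>1/\<gamma>\<close> and \<open>(\<bar>t\<bar> - t\<^sub>0)\<^sup>q\<close> from there on.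
\<close>

definition \<delta> :: real where "\<delta> = q powr q * \<gamma> powr (1 - q)"
definition t\<^sub>0 :: real where "t\<^sub>0 = (1 - q) / \<gamma>"
definition s\<^sub>0 :: real where "s\<^sub>0 = (\<beta> / \<alpha> * q * (1 - q)) powr (1 / (2 - q))"

lemma t\<^sub>0_pos: "0 < t\<^sub>0" and s\<^sub>0_pos: "0 < s\<^sub>0" and t\<^sub>0_less: "t\<^sub>0 < 1 / \<gamma>"
  using \<alpha> \<beta> q \<gamma> by (auto simp: t\<^sub>0_def s\<^sub>0_def divide_strict_right_mono)

lemma h_fun_bounds: "0 \<le> h_fun q \<gamma> t" "h_fun q \<gamma> t \<le> 1 + \<bar>t\<bar>"
proof -
  show "0 \<le> h_fun q \<gamma> t"
    using q \<gamma> t\<^sub>0_less unfolding h_fun_def t\<^sub>0_def by auto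
  show "h_fun q \<gamma> t \<le> 1 + \<bar>t\<bar>"
  proof (cases "\<bar>t\<bar> \<le> 1 / \<gamma>")
    case True
    have "\<bar>t\<bar> powr (1 / q) \<le> (1 / \<gamma>) powr (1 / q)"
      using True q \<gamma> by (intro powr_mono2) auto
    then have "q * \<gamma> powr ((1 - q) / q) * \<bar>t\<bar> powr (1 / q) \<le> q * \<gamma> powr ((1 - q) / q) * (1 / \<gamma>) powr (1 / q)"
      using q by (intro mult_left_mono) auto
    also have "\<dots> = q * \<gamma> powr ((1 - q) / q - 1 / q)"
      using \<gamma> by (simp add: powr_divide powr_diff)
    also have "(1 - q) / q - 1 / q = - 1" using q by (simp add: field_simps)
    also have "q * \<gamma> powr (- 1) \<le> 1 * 1"
      using q \<gamma> by (intro mult_mono) (auto simp: powr_minus field_simps)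
    finally show ?thesis using True by (simp add: h_fun_def)
  next
    case False
    then show ?thesis using t\<^sub>0_pos by (simp add: h_fun_def t\<^sub>0_def)
  qed
qed

lemma h_fun_linear: "h_fun q \<gamma> t powr q = \<delta> * \<bar>t\<bar>" if "\<bar>t\<bar> \<le> 1 / \<gamma>"
proof -
  have "(q * \<gamma> powr ((1 - q) / q) * \<bar>t\<bar> powr (1 / q)) powr q
      = q powr q * (\<gamma> powr ((1 - q) / q)) powr q * (\<bar>t\<bar> powr (1 / q)) powr q"
    using q by (simp add: powr_mult)
  also have "\<dots> = \<delta> * \<bar>t\<bar>" using q by (simp add: powr_powr \<delta>_def)
  finally show ?thesis using that by (simp add: h_fun_def)
qed

lemma F_0: "F 0 = 0" and F_nonneg: "0 \<le> F t"
  using \<alpha> \<beta> \<gamma> h_fun_linear[of 0] by (auto simp: control_density_def)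

lemma F_bound:
  assumes "\<bar>t\<bar> \<le> R"
  shows "\<bar>F t\<bar> \<le> \<alpha> / 2 * R\<^sup>2 + \<beta> * (1 + R) powr q"
proof -
  have "t\<^sup>2 \<le> R\<^sup>2" using assms by (metis abs_ge_zero power2_abs power_mono)
  then have "\<alpha> / 2 * t\<^sup>2 \<le> \<alpha> / 2 * R\<^sup>2" using \<alpha> by (intro mult_left_mono) auto
  moreover have "h_fun q \<gamma> t powr q \<le> (1 + R) powr q"
    using h_fun_bounds[of t] assms q by (intro powr_mono2) auto
  then have "\<beta> * h_fun q \<gamma> t powr q \<le> \<beta> * (1 + R) powr q" using \<beta> by (intro mult_left_mono) auto
  ultimately show ?thesis using F_nonneg[of t] by (simp add: control_density_def)
qed

lemma F_measurable: "F \<in> borel_measurable borel"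
  unfolding control_density_def[abs_def] h_fun_def by measurable

lemma bounded_density_integrable:
  assumes \<Omega>: "\<Omega> \<in> lmeasurable" and u: "u \<in> borel_measurable (lebesgue_on \<Omega>)"
    and b: "AE x in lebesgue_on \<Omega>. \<bar>u x\<bar> \<le> R"
  shows "integrable (lebesgue_on \<Omega>) (\<lambda>x. F (u x))"
proof -
  interpret finite_measure "lebesgue_on \<Omega>" by (rule finite_measure_lebesgue_on[OF \<Omega>])
  have "AE x in lebesgue_on \<Omega>. norm (F (u x)) \<le> \<alpha> / 2 * R\<^sup>2 + \<beta> * (1 + R) powr q"
    using b by eventually_elim (simp only: real_norm_def, rule F_bound)
  then show ?thesis by (rule integrable_const_bound) (rule measurable_compose[OF u F_measurable])
qed

text \<open>
  The two branches of the penalty meet with slope \<open>\<delta>\<close> at \<open>1/\<gamma>\<close>, and the slope of the second one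
  decreases, whence the minimum.
\<close>

lemma penalty_has_derivative:
  assumes t: "t\<^sub>0 < t"
  shows "((\<lambda>t. h_fun q \<gamma> t powr q) has_real_derivative min \<delta> (q * (t - t\<^sub>0) powr (q - 1))) (at t)"
proof -
  let ?g = "\<lambda>t. h_fun q \<gamma> t powr q" and ?G = "\<lambda>t. (t - t\<^sub>0) powr q"
  let ?G' = "\<lambda>t. q * (t - t\<^sub>0) powr (q - 1)"
  have g1: "?g t = \<delta> * t" if "0 < t" "t \<le> 1 / \<gamma>" for t using h_fun_linear[of t] that by simp
  have t1: "1 / \<gamma> - t\<^sub>0 = q / \<gamma>" using \<gamma> by (simp add: t\<^sub>0_def field_simps)
  have G'1: "?G' (1 / \<gamma>) = \<delta>" and G1: "?G (1 / \<gamma>) = \<delta> * (1 / \<gamma>)"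
    unfolding t1 \<delta>_def using q \<gamma> by (simp_all add: powr_divide powr_diff)
  have g2: "?g t = ?G t" if "1 / \<gamma> \<le> t" for t
  proof (cases "t = 1 / \<gamma>")
    case True
    then show ?thesis using g1[of t] G1 \<gamma> by simp
  next
    case False
    then have "1 / \<gamma> < t" using that by simp
    moreover have "0 < 1 / \<gamma>" using \<gamma> by simp
    ultimately have "\<bar>t\<bar> = t" "\<not> \<bar>t\<bar> \<le> 1 / \<gamma>" by linarith+
    then show ?thesis by (simp add: h_fun_def t\<^sub>0_def)
  qed
  have dG: "(?G has_real_derivative ?G' t) (at t)" if "t\<^sub>0 < t" for t
    using that by (auto intro!: derivative_eq_intros)
  have G'mono: "?G' t \<le> ?G' s" if "t\<^sub>0 < s" "s \<le> t" for s t
    using that q by (intro mult_left_mono powr_mono2') auto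
  show ?thesis
  proof (cases t "1 / \<gamma>" rule: linorder_cases)
    case less
    then have "min \<delta> (?G' t) = \<delta>" using G'mono[OF t, of "1 / \<gamma>"] G'1 by simp
    moreover have "(?g has_real_derivative \<delta>) (at t)"
    proof (rule has_field_derivative_transform_within_open)
      show "((\<lambda>t. \<delta> * t) has_real_derivative \<delta>) (at t)" by (auto intro!: derivative_eq_intros)
    qed (use less t t\<^sub>0_pos g1 in \<open>auto intro: open_greaterThanLessThan[of 0 "1 / \<gamma>"]\<close>)
    ultimately show ?thesis by simp
  next
    case greater
    then have "min \<delta> (?G' t) = ?G' t" using G'mono[of "1 / \<gamma>" t] t\<^sub>0_less G'1 by simp
    moreover have "(?g has_real_derivative ?G' t) (at t)"
      by (rule has_field_derivative_transform_within_open[OF dG[OF t], where S = "{1 / \<gamma><..}"])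
        (use greater g2 in auto)
    ultimately show ?thesis by simp
  next
    case equal
    have "((\<lambda>y. (?g y - ?g t) / (y - t)) \<longlongrightarrow> \<delta>) (at_left t)"
    proof (rule Lim_transform_eventually[OF tendsto_const])
      have "\<forall>\<^sub>F y in at_left t. y \<in> {0<..<t}"
        using equal \<gamma> by (intro eventually_at_left_real) simp
      then show "\<forall>\<^sub>F y in at_left t. \<delta> = (?g y - ?g t) / (y - t)"
      proof eventually_elim
        case (elim y)
        have "?g y = \<delta> * y" by (rule g1) (use elim equal in simp_all)
        moreover have "?g t = \<delta> * t" by (rule g1) (use equal \<gamma> in simp_all)
        ultimately have "?g y - ?g t = \<delta> * (y - t)" by (simp add: right_diff_distrib)
        then show ?case using elim by simp
      qed
    qed
    moreover have "((\<lambda>y. (?g y - ?g t) / (y - t)) \<longlongrightarrow> \<delta>) (at_right t)"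
    proof (rule Lim_transform_eventually)
      have "((\<lambda>y. (?G y - ?G t) / (y - t)) \<longlongrightarrow> \<delta>) (at t)"
        using dG[OF t] G'1 equal by (simp add: has_field_derivative_iff)
      then show "((\<lambda>y. (?G y - ?G t) / (y - t)) \<longlongrightarrow> \<delta>) (at_right t)"
        by (rule tendsto_mono[OF at_le, rotated]) simp
      show "\<forall>\<^sub>F y in at_right t. (?G y - ?G t) / (y - t) = (?g y - ?g t) / (y - t)"
        using g2 equal by (auto simp: eventually_at_right_field intro!: exI[of _ "t + 1"])
    qed
    ultimately have "(?g has_real_derivative \<delta>) (at t)"
      by (simp add: has_field_derivative_iff filterlim_split_at)
    then show ?thesis using equal G'1 by simp
  qed
qed

text \<open>
  The threshold \<open>s\<^sub>0\<close> is the distance from \<open>t\<^sub>0\<close> at which the second derivative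
  \<open>\<alpha> - \<beta> q (1 - q) (t - t\<^sub>0)\<^bsup>q - 2\<^esup>\<close> of the nonlinear branch vanishes; beyond a larger distance it is
  bounded below by a positive constant.
\<close>

lemma F_convex_beyond_threshold:
  assumes C: "1 < C"
  defines "\<kappa> \<equiv> \<alpha> * (1 - C powr (q - 2))"
  shows "0 < \<kappa>" "convex_on {C * s\<^sub>0 + t\<^sub>0..} (\<lambda>t. F t - \<kappa> / 2 * t\<^sup>2)"
    "\<And>t. C * s\<^sub>0 + t\<^sub>0 \<le> t \<Longrightarrow> F differentiable (at t)"
proof -
  define G' where "G' t = q * (t - t\<^sub>0) powr (q - 1)" for t
  define m where "m = C * s\<^sub>0 + t\<^sub>0"
  have Cs: "0 < C * s\<^sub>0" using C s\<^sub>0_pos by simp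
  have m: "t\<^sub>0 < m" using Cs by (simp add: m_def)
  have "C powr (q - 2) < C powr 0" using C q by (intro powr_less_mono) auto
  then have "C powr (q - 2) < 1" using C by simp
  then show "0 < \<kappa>" using \<alpha> by (simp add: \<kappa>_def)
  have dF: "(F has_real_derivative (\<alpha> * t + \<beta> * min \<delta> (G' t))) (at t)" if "m \<le> t" for t
    unfolding control_density_def[abs_def] G'_def
    by (rule derivative_eq_intros penalty_has_derivative refl | use that m in simp)+
  show "F differentiable (at t)" if "C * s\<^sub>0 + t\<^sub>0 \<le> t" for t
    using dF[of t] that by (auto simp: m_def real_differentiable_def)
  have mono: "(\<alpha> - \<kappa>) * s + \<beta> * G' s \<le> (\<alpha> - \<kappa>) * t + \<beta> * G' t" if st: "m \<le> s" "s \<le> t" for s t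
  proof (rule DERIV_nonneg_imp_nondecreasing[OF st(2)])
    fix x assume x: "s \<le> x" "x \<le> t"
    then have xm: "C * s\<^sub>0 \<le> x - t\<^sub>0" using st by (simp add: m_def)
    have "((\<lambda>t. (\<alpha> - \<kappa>) * t + \<beta> * G' t) has_real_derivative
        (\<alpha> - \<kappa>) + \<beta> * (q * ((q - 1) * (x - t\<^sub>0) powr (q - 1 - 1)))) (at x)"
      unfolding G'_def using xm Cs by (auto intro!: derivative_eq_intros)
    moreover have "0 \<le> (\<alpha> - \<kappa>) + \<beta> * (q * ((q - 1) * (x - t\<^sub>0) powr (q - 1 - 1)))"
    proof -
      let ?X = "\<beta> / \<alpha> * q * (1 - q)"
      have X: "0 < ?X" using \<alpha> \<beta> q by simp
      have e: "1 / (2 - q) * (q - 2) = - 1" using q by (simp add: field_simps)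
      have "s\<^sub>0 powr (q - 2) = ?X powr (- 1)" unfolding s\<^sub>0_def powr_powr e ..
      then have s: "s\<^sub>0 powr (q - 2) = 1 / ?X" using X by (simp add: powr_minus divide_inverse)
      have "(x - t\<^sub>0) powr (q - 2) \<le> (C * s\<^sub>0) powr (q - 2)"
        using xm Cs q by (intro powr_mono2') auto
      also have "\<dots> = C powr (q - 2) * (1 / ?X)" using C s\<^sub>0_pos by (simp add: powr_mult s)
      finally have "\<beta> * q * (1 - q) * (x - t\<^sub>0) powr (q - 2) \<le> \<beta> * q * (1 - q) * (C powr (q - 2) * (1 / ?X))"
        using \<beta> q by (intro mult_left_mono) auto
      also have "\<dots> = \<alpha> * C powr (q - 2)" using \<alpha> \<beta> q by (simp add: field_simps)
      also have "\<dots> = \<alpha> - \<kappa>" by (simp add: \<kappa>_def right_diff_distrib)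
      finally show ?thesis by (simp add: algebra_simps)
    qed
    ultimately show "\<exists>y. ((\<lambda>t. (\<alpha> - \<kappa>) * t + \<beta> * G' t) has_real_derivative y) (at x) \<and> 0 \<le> y" by blast
  qed
  have "convex_on {m..} (\<lambda>t. F t - \<kappa> / 2 * t\<^sup>2)"
  proof (rule convex_on_realI)
    show "((\<lambda>t. F t - \<kappa> / 2 * t\<^sup>2) has_real_derivative (\<alpha> - \<kappa>) * t + \<beta> * min \<delta> (G' t)) (at t)"
      if "t \<in> {m..}" for t
      by (rule derivative_eq_intros dF refl | use that in \<open>simp add: algebra_simps\<close>)+
    show "(\<alpha> - \<kappa>) * s + \<beta> * min \<delta> (G' s) \<le> (\<alpha> - \<kappa>) * t + \<beta> * min \<delta> (G' t)"
      if "s \<in> {m..}" "t \<in> {m..}" "s \<le> t" for s t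
    proof -
      have "0 \<le> \<alpha> - \<kappa>" using \<alpha> by (simp add: \<kappa>_def right_diff_distrib)
      then have "(\<alpha> - \<kappa>) * s \<le> (\<alpha> - \<kappa>) * t" using that by (intro mult_left_mono) auto
      moreover have "\<beta> * min \<delta> (G' s) \<le> \<beta> * \<delta>" "\<beta> * min \<delta> (G' s) \<le> \<beta> * G' s"
        using \<beta> by auto
      ultimately show ?thesis using mono[of s t] that by (cases "\<delta> \<le> G' t") auto
    qed
  qed simp
  then show "convex_on {C * s\<^sub>0 + t\<^sub>0..} (\<lambda>t. F t - \<kappa> / 2 * t\<^sup>2)" by (simp add: m_def)
qed

lemma F_midpoint_beyond_threshold:
  assumes C: "1 < C" and s: "C * s\<^sub>0 + t\<^sub>0 \<le> s" and t: "C * s\<^sub>0 + t\<^sub>0 \<le> t"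
  shows "F ((s + t) / 2) \<le> (F s + F t) / 2 - \<alpha> * (1 - C powr (q - 2)) / 8 * (s - t)\<^sup>2"
proof -
  let ?\<kappa> = "\<alpha> * (1 - C powr (q - 2))"
  have "F ((1 / 2) *\<^sub>R s + (1 / 2) *\<^sub>R t) - ?\<kappa> / 2 * ((1 / 2) *\<^sub>R s + (1 / 2) *\<^sub>R t)\<^sup>2
      \<le> 1 / 2 * (F s - ?\<kappa> / 2 * s\<^sup>2) + 1 / 2 * (F t - ?\<kappa> / 2 * t\<^sup>2)"
    using convex_onD[OF F_convex_beyond_threshold(2)[OF C], of "1/2" s t] s t by simp
  moreover have "(1 / 2) *\<^sub>R s + (1 / 2) *\<^sub>R t = (s + t) / 2" by (simp add: field_simps)
  ultimately show ?thesis by (simp add: power2_eq_square field_simps)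
qed

text \<open>Near \<open>0\<close> the penalty is \<open>\<delta> \<bar>t\<bar>\<close>, so there the quadratic part gives the strong convexity.\<close>

lemma F_midpoint_strict:
  assumes C: "1 < C"
  obtains \<kappa> \<epsilon> where "0 < \<kappa>" "0 < \<epsilon>"
    "\<forall>s t. (t \<noteq> 0 \<longrightarrow> C * s\<^sub>0 + t\<^sub>0 \<le> \<bar>t\<bar>) \<longrightarrow> \<bar>s - t\<bar> \<le> \<epsilon> \<longrightarrow>
       F ((s + t) / 2) \<le> (F s + F t) / 2 - \<kappa> * (s - t)\<^sup>2"
proof -
  define C' where "C' = (1 + C) / 2"
  have C': "1 < C'" "C' < C" using C by (auto simp: C'_def)
  define \<kappa>\<^sub>1 where "\<kappa>\<^sub>1 = \<alpha> * (1 - C' powr (q - 2)) / 8"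
  have \<kappa>\<^sub>1: "0 < \<kappa>\<^sub>1" using F_convex_beyond_threshold(1)[OF C'(1)] by (simp add: \<kappa>\<^sub>1_def)
  define \<kappa> where "\<kappa> = min \<kappa>\<^sub>1 (\<alpha> / 8)"
  define \<epsilon> where "\<epsilon> = min ((C - C') * s\<^sub>0) (1 / \<gamma>)"
  have \<kappa>: "0 < \<kappa>" "\<kappa> \<le> \<kappa>\<^sub>1" "\<kappa> \<le> \<alpha> / 8" using \<kappa>\<^sub>1 \<alpha> by (auto simp: \<kappa>_def)
  have \<epsilon>: "0 < \<epsilon>" using C' s\<^sub>0_pos \<gamma> by (simp add: \<epsilon>_def)
  have pos: "F ((s + t) / 2) \<le> (F s + F t) / 2 - \<kappa> * (s - t)\<^sup>2"
    if "C * s\<^sub>0 + t\<^sub>0 \<le> t" "\<bar>s - t\<bar> \<le> \<epsilon>" for s t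
  proof -
    have "\<bar>s - t\<bar> \<le> C * s\<^sub>0 - C' * s\<^sub>0" using that(2) by (simp add: \<epsilon>_def left_diff_distrib)
    then have "C' * s\<^sub>0 + t\<^sub>0 \<le> s" using that(1) by linarith
    moreover have "C' * s\<^sub>0 + t\<^sub>0 \<le> t"
      using that(1) mult_right_mono[of C' C s\<^sub>0] C' s\<^sub>0_pos by linarith
    ultimately have "F ((s + t) / 2) \<le> (F s + F t) / 2 - \<kappa>\<^sub>1 * (s - t)\<^sup>2"
      using F_midpoint_beyond_threshold[OF C'(1), of s t] by (simp add: \<kappa>\<^sub>1_def)
    moreover have "\<kappa> * (s - t)\<^sup>2 \<le> \<kappa>\<^sub>1 * (s - t)\<^sup>2" using \<kappa> by (intro mult_right_mono) auto
    ultimately show ?thesis by linarith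
  qed
  have "F ((s + t) / 2) \<le> (F s + F t) / 2 - \<kappa> * (s - t)\<^sup>2"
    if t: "t \<noteq> 0 \<Longrightarrow> C * s\<^sub>0 + t\<^sub>0 \<le> \<bar>t\<bar>" and st: "\<bar>s - t\<bar> \<le> \<epsilon>" for s t
  proof (cases t "0::real" rule: linorder_cases)
    case equal
    then have s: "\<bar>s\<bar> \<le> 1 / \<gamma>" "\<bar>s / 2\<bar> \<le> 1 / \<gamma>" using st by (auto simp: \<epsilon>_def)
    have "F (s / 2) = \<alpha> / 8 * s\<^sup>2 + \<beta> * (\<delta> * \<bar>s\<bar>) / 2" "F s = \<alpha> / 2 * s\<^sup>2 + \<beta> * (\<delta> * \<bar>s\<bar>)"
      using h_fun_linear[OF s(1)] h_fun_linear[OF s(2)]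
      by (simp_all add: control_density_def power_divide)
    moreover have "\<kappa> * s\<^sup>2 \<le> \<alpha> / 8 * s\<^sup>2" using \<kappa> by (intro mult_right_mono) auto
    ultimately have "F (s / 2) \<le> F s / 2 - \<kappa> * s\<^sup>2" by linarith
    then show ?thesis using equal F_0 by simp
  next
    case greater
    then show ?thesis using pos[of t s] t st by simp
  next
    case less
    have "F ((- s + - t) / 2) \<le> (F (- s) + F (- t)) / 2 - \<kappa> * (- s - - t)\<^sup>2"
      using less t st by (intro pos) auto
    moreover have "(- s + - t) / 2 = - ((s + t) / 2)" by (simp add: field_simps)
    moreover have "(- s - - t)\<^sup>2 = (s - t)\<^sup>2" by (simp add: power2_commute)
    ultimately show ?thesis by (simp only: control_density_minus)
  qed
  then show ?thesis by (intro that[OF \<kappa>(1) \<epsilon>]) blast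
qed

text \<open>
  The tangent of the convex branch of \<open>F\<close> on the side of \<open>0\<close> on which \<open>c\<close> lies. Convexity on a
  slightly larger half-line makes \<open>c\<close> an interior point, even at the threshold.
\<close>

lemma F_above_tangent:
  assumes C: "1 < C" and c: "C * s\<^sub>0 + t\<^sub>0 \<le> \<bar>c\<bar>"
  obtains k where "\<forall>t. C * s\<^sub>0 + t\<^sub>0 \<le> \<bar>t\<bar> \<longrightarrow> 0 < c * t \<longrightarrow> F c + k * (t - c) \<le> F t"
proof -
  define C' where "C' = (1 + C) / 2"
  have C': "1 < C'" "C' < C" using C by (auto simp: C'_def)
  define m where "m = C' * s\<^sub>0 + t\<^sub>0"
  have less: "m < C * s\<^sub>0 + t\<^sub>0" using C' s\<^sub>0_pos by (simp add: m_def)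
  let ?\<kappa> = "\<alpha> * (1 - C' powr (q - 2))"
  have "convex_on {m..} (\<lambda>t. ?\<kappa> / 2 * t\<^sup>2)"
  proof (rule convex_on_realI)
    show "((\<lambda>t. ?\<kappa> / 2 * t\<^sup>2) has_real_derivative ?\<kappa> * t) (at t)" for t
      by (rule derivative_eq_intros refl | simp)+
    show "?\<kappa> * s \<le> ?\<kappa> * t" if "s \<le> t" for s t
      using that F_convex_beyond_threshold(1)[OF C'(1)] by (intro mult_left_mono) auto
  qed simp
  from convex_on_add[OF F_convex_beyond_threshold(2)[OF C'(1), folded m_def] this]
  have cF: "convex_on {m..} F" by simp
  have pos: "\<exists>k. \<forall>t. C * s\<^sub>0 + t\<^sub>0 \<le> t \<longrightarrow> F c + k * (t - c) \<le> F t" if "C * s\<^sub>0 + t\<^sub>0 \<le> c" for c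
  proof -
    have "C' * s\<^sub>0 + t\<^sub>0 \<le> c" using that less by (simp add: m_def)
    then obtain k where "(F has_real_derivative k) (at c)"
      using F_convex_beyond_threshold(3)[OF C'(1)] by (auto simp: real_differentiable_def)
    then have k: "(F has_real_derivative k) (at c within {m..})" by (rule has_field_derivative_at_within)
    have "F t - F c \<ge> k * (t - c)" if "C * s\<^sub>0 + t\<^sub>0 \<le> t" for t
      by (rule convex_on_imp_above_tangent[OF cF _ _ _ k])
        (use that \<open>C * s\<^sub>0 + t\<^sub>0 \<le> c\<close> less in auto)
    then show ?thesis by (intro exI[of _ k]) (simp add: algebra_simps)
  qed
  show ?thesis
  proof (cases "0 < c")
    case True
    then obtain k where "\<forall>t. C * s\<^sub>0 + t\<^sub>0 \<le> t \<longrightarrow> F c + k * (t - c) \<le> F t" using pos[of c] c by auto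
    with True show ?thesis by (intro that[of k]) (simp add: zero_less_mult_iff)
  next
    case False
    then obtain k where k: "\<forall>t. C * s\<^sub>0 + t\<^sub>0 \<le> t \<longrightarrow> F (- c) + k * (t - - c) \<le> F t"
      using pos[of "- c"] c by auto
    show ?thesis
    proof (rule that[of "- k"], intro allI impI)
      fix t assume t: "C * s\<^sub>0 + t\<^sub>0 \<le> \<bar>t\<bar>" "0 < c * t"
      then have "t < 0" using False by (auto simp: zero_less_mult_iff)
      then have "F (- c) + k * (- t - - c) \<le> F (- t)" using k[THEN spec, of "- t"] t by simp
      then show "F c + - k * (t - c) \<le> F t" by (simp add: control_density_minus algebra_simps)
    qed
  qed
qed

end

section \<open>Discretization errors\<close>

lemma symmetric_L2_diff_scale:
  assumes A: "symmetric_L2 \<Omega> A" and B: "symmetric_L2 \<Omega> B"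
  shows "symmetric_L2 \<Omega> (\<lambda>u x. c * (A u x - B u x))"
  unfolding symmetric_L2_def
proof (intro conjI ballI)
  note AL = symmetric_L2_in[OF A] and BL = symmetric_L2_in[OF B]
  show "(\<lambda>x. c * (A u x - B u x)) \<in> L2 \<Omega>" if "u \<in> L2 \<Omega>" for u
    by (intro L2_scale L2_diff AL BL that)
  fix u v assume u: "u \<in> L2 \<Omega>" and v: "v \<in> L2 \<Omega>"
  have "L2_inner \<Omega> (\<lambda>x. c * (A u x - B u x)) v = c * (L2_inner \<Omega> u (A v) - L2_inner \<Omega> u (B v))"
    by (simp only: L2_inner_scale_left L2_inner_diff_left[OF AL[OF u] BL[OF u] v]
        symmetric_L2_inner[OF A u v] symmetric_L2_inner[OF B u v])
  also have "\<dots> = L2_inner \<Omega> u (\<lambda>x. c * (A v x - B v x))"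
    unfolding L2_inner_commute[of \<Omega> u]
    by (simp only: L2_inner_scale_left L2_inner_diff_left[OF AL[OF v] BL[OF v] u])
  finally show "L2_inner \<Omega> (\<lambda>x. c * (A u x - B u x)) v = L2_inner \<Omega> u (\<lambda>x. c * (A v x - B v x))" .
qed

lemma H1_norm_nonneg: "0 \<le> H1_norm \<Omega> u"
  unfolding H1_norm_def by (intro real_sqrt_ge_zero add_nonneg_nonneg Bochner_Integration.integral_nonneg) simp_all

lemma H10_subset_L2: "H10 \<Omega> \<subseteq> L2 \<Omega>"
  unfolding H10_def H1_def has_weak_gradient_def by blast

text \<open>
  The uniform boundedness principle for the symmetric operators \<open>(S - S\<^sub>h) / h\<^sup>2\<close>.
\<close>

lemma pointwise_order_implies_uniform_order:
  assumes \<Omega>: "\<Omega> \<in> lmeasurable" and H: "H \<subseteq> {0<..}"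
    and S: "symmetric_L2 \<Omega> S" and Sh: "\<And>h. h \<in> H \<Longrightarrow> symmetric_L2 \<Omega> (S\<^sub>h h)"
    and err: "\<And>u. u \<in> L2 \<Omega> \<Longrightarrow> \<exists>c. \<forall>h\<in>H. L2_norm \<Omega> (\<lambda>x. S u x - S\<^sub>h h u x) \<le> c * h\<^sup>2"
  shows "\<exists>K>0. \<forall>h\<in>H. \<forall>u\<in>L2 \<Omega>. L2_norm \<Omega> (\<lambda>x. S u x - S\<^sub>h h u x) \<le> K * h\<^sup>2 * L2_norm \<Omega> u"
proof -
  define D where "D h u = (\<lambda>x. (1 / h\<^sup>2) * (S u x - S\<^sub>h h u x))" for h u
  have D: "symmetric_L2 \<Omega> (D h)" if "h \<in> H" for h
    unfolding D_def by (rule symmetric_L2_diff_scale[OF S Sh[OF that]])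
  have norm: "L2_norm \<Omega> (D h u) = L2_norm \<Omega> (\<lambda>x. S u x - S\<^sub>h h u x) / h\<^sup>2" for h u
    unfolding D_def L2_norm_scale by simp
  have pos: "0 < h\<^sup>2" if "h \<in> H" for h using that H by auto
  have "\<exists>c. \<forall>h\<in>H. L2_norm \<Omega> (D h u) \<le> c" if u: "u \<in> L2 \<Omega>" for u
  proof -
    obtain c where "\<And>h. h \<in> H \<Longrightarrow> L2_norm \<Omega> (\<lambda>x. S u x - S\<^sub>h h u x) \<le> c * h\<^sup>2" using err[OF u] by blast
    then have "L2_norm \<Omega> (D h u) \<le> c" if "h \<in> H" for h
      using that pos[OF that] by (simp add: norm pos_divide_le_eq)
    then show ?thesis by blast
  qed
  from symmetric_L2_uniformly_bounded[where A = D and I = H, OF \<Omega> D this]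
  obtain K where K: "0 < K" "\<And>h u. h \<in> H \<Longrightarrow> u \<in> L2 \<Omega> \<Longrightarrow> L2_norm \<Omega> (D h u) \<le> K * L2_norm \<Omega> u"
    by blast
  have "L2_norm \<Omega> (\<lambda>x. S u x - S\<^sub>h h u x) \<le> K * h\<^sup>2 * L2_norm \<Omega> u" if h: "h \<in> H" "u \<in> L2 \<Omega>" for h u
    using K(2)[OF h] pos[OF h(1)] by (simp add: norm pos_divide_le_eq mult_ac)
  with K(1) show ?thesis by blast
qed

text \<open>
  The last estimate is obtained by pairing \<open>S r\<close> with itself: \<open>\<parallel>S r\<parallel>\<^sup>2 = (r, S w)\<close> for \<open>w = S r\<close>, and
  \<open>S w\<close> may be replaced by \<open>S\<^sub>h w\<close> at the price of \<open>O(h\<^sup>2)\<close>. The pairing of \<open>S\<^sub>h w\<close> with \<open>r\<close> gains a factor \<open>h\<close>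
  times the norm of the gradient of \<open>S\<^sub>h w\<close>, which the energy identity
  \<open>a(S\<^sub>h w, S\<^sub>h w) = (w, S\<^sub>h w)\<close> controls.
\<close>

lemma finite_element_estimates:
  assumes \<Omega>: "open \<Omega>" "bounded \<Omega>" and a: "elliptic_coefficients \<Omega> a c\<^sub>0"
    and S: "solution_operator \<Omega> a c\<^sub>0 (H10 \<Omega>) S"
    and H: "H \<subseteq> {0<..}" and mesh: "\<And>h. h \<in> H \<Longrightarrow> regular_mesh \<Omega> (\<T> h) \<kappa> h"
    and Sh: "\<And>h. h \<in> H \<Longrightarrow> solution_operator \<Omega> a c\<^sub>0 (Y_space \<Omega> (\<T> h)) (S\<^sub>h h)"
    and err: "\<And>u. u \<in> L2 \<Omega> \<Longrightarrow> \<exists>c. \<forall>h\<in>H. L2_norm \<Omega> (\<lambda>x. S u x - S\<^sub>h h u x) \<le> c * h\<^sup>2"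
  obtains K where "0 < K" "\<forall>u\<in>L2 \<Omega>. L2_norm \<Omega> (S u) \<le> K * L2_norm \<Omega> u"
    "\<forall>h\<in>H. \<forall>u\<in>L2 \<Omega>. L2_norm \<Omega> (\<lambda>x. S u x - S\<^sub>h h u x) \<le> K * h\<^sup>2 * L2_norm \<Omega> u"
    "\<forall>h\<in>H. \<forall>r\<in>L2 \<Omega>. h \<le> 1 \<longrightarrow>
       (\<forall>T\<in>\<T> h. (\<integral>x. indicator (interior T) x * r x \<partial>lebesgue_on \<Omega>) = 0) \<longrightarrow>
       L2_norm \<Omega> (S r) \<le> K * h * L2_norm \<Omega> r"
proof -
  have lm: "\<Omega> \<in> lmeasurable" using \<Omega> by (auto intro: lmeasurable_open)
  have symS: "symmetric_L2 \<Omega> S" by (rule solution_operator_symmetric[OF S a H10_subset_L2])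
  have YL: "Y_space \<Omega> (\<T> h) \<subseteq> L2 \<Omega>" if "h \<in> H" for h
    using regular_mesh.Y_space_L2[OF mesh[OF that]] by blast
  have symSh: "symmetric_L2 \<Omega> (S\<^sub>h h)" if "h \<in> H" for h
    by (rule solution_operator_symmetric[OF Sh[OF that] a YL[OF that]])
  from pointwise_order_implies_uniform_order[OF lm H symS symSh err]
  obtain K\<^sub>1 where K\<^sub>1: "0 < K\<^sub>1" "\<And>h u. h \<in> H \<Longrightarrow> u \<in> L2 \<Omega> \<Longrightarrow>
      L2_norm \<Omega> (\<lambda>x. S u x - S\<^sub>h h u x) \<le> K\<^sub>1 * h\<^sup>2 * L2_norm \<Omega> u"
    by blast
  have "\<exists>K>0. \<forall>i\<in>(UNIV :: unit set). \<forall>u\<in>L2 \<Omega>. L2_norm \<Omega> (S u) \<le> K * L2_norm \<Omega> u"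
    by (rule symmetric_L2_uniformly_bounded[OF lm symS]) auto
  then obtain K\<^sub>0 where K\<^sub>0: "0 < K\<^sub>0" "\<And>u. u \<in> L2 \<Omega> \<Longrightarrow> L2_norm \<Omega> (S u) \<le> K\<^sub>0 * L2_norm \<Omega> u" by blast
  obtain \<theta> where \<theta>: "0 < \<theta>" "\<And>v. has_weak_gradient \<Omega> v (weak_grad \<Omega> v) \<Longrightarrow>
       \<theta> * (\<integral>x. (norm (weak_grad \<Omega> v x))\<^sup>2 \<partial>lebesgue_on \<Omega>) \<le> bilinear_form \<Omega> a c\<^sub>0 v v"
    by (rule bilinear_form_coercive[OF \<Omega> a]) blast
  define K\<^sub>2 where "K\<^sub>2 = K\<^sub>0 + K\<^sub>1"
  have K\<^sub>2: "0 < K\<^sub>2" using K\<^sub>0(1) K\<^sub>1(1) by (simp add: K\<^sub>2_def)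
  have Sh_bound: "L2_norm \<Omega> (S\<^sub>h h w) \<le> K\<^sub>2 * L2_norm \<Omega> w" if h: "h \<in> H" "h \<le> 1" and w: "w \<in> L2 \<Omega>" for h w
  proof -
    have SL: "S w \<in> L2 \<Omega>" and ShL: "S\<^sub>h h w \<in> L2 \<Omega>"
      using symmetric_L2_in[OF symS w] symmetric_L2_in[OF symSh[OF h(1)] w] by auto
    have "L2_norm \<Omega> (S\<^sub>h h w) = L2_norm \<Omega> (\<lambda>x. S w x - (S w x - S\<^sub>h h w x))" by simp
    also have "\<dots> \<le> L2_norm \<Omega> (S w) + L2_norm \<Omega> (\<lambda>x. S w x - S\<^sub>h h w x)"
      by (rule L2_triangle_diff[OF SL L2_diff[OF SL ShL]])
    also have "\<dots> \<le> K\<^sub>0 * L2_norm \<Omega> w + K\<^sub>1 * h\<^sup>2 * L2_norm \<Omega> w"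
      by (rule add_mono[OF K\<^sub>0(2)[OF w] K\<^sub>1(2)[OF h(1) w]])
    also have "K\<^sub>1 * h\<^sup>2 * L2_norm \<Omega> w \<le> K\<^sub>1 * 1 * L2_norm \<Omega> w"
      using h H K\<^sub>1(1) by (intro mult_right_mono mult_left_mono) (auto simp: L2_norm_nonneg power_le_one)
    finally show ?thesis by (simp add: K\<^sub>2_def distrib_right)
  qed
  define B where "B = 8 * exp 4 / \<kappa> * sqrt (K\<^sub>2 / \<theta>)"
  have pairing: "\<bar>L2_inner \<Omega> (S\<^sub>h h w) r\<bar> \<le> B * h * L2_norm \<Omega> w * L2_norm \<Omega> r"
    if h: "h \<in> H" "h \<le> 1" and w: "w \<in> L2 \<Omega>" and r: "r \<in> L2 \<Omega>"
      and mean: "\<And>T. T \<in> \<T> h \<Longrightarrow> (\<integral>x. indicator (interior T) x * r x \<partial>lebesgue_on \<Omega>) = 0" for h w r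
  proof -
    interpret regular_mesh \<Omega> "\<T> h" \<kappa> h by (rule mesh[OF h(1)])
    note form = solution_operator_form[OF Sh[OF h(1)] w]
    let ?v = "S\<^sub>h h w"
    let ?g = "\<integral>x. (norm (weak_grad \<Omega> ?v x))\<^sup>2 \<partial>lebesgue_on \<Omega>"
    have g: "has_weak_gradient \<Omega> ?v (weak_grad \<Omega> ?v)" by (rule Y_space_weak_grad[OF form(1)])
    have vL: "?v \<in> L2 \<Omega>" by (rule Y_space_L2[OF form(1)])
    have "\<theta> * ?g \<le> bilinear_form \<Omega> a c\<^sub>0 ?v ?v" by (rule \<theta>(2)[OF g])
    also have "\<dots> = L2_inner \<Omega> w ?v" by (rule form(2)[OF form(1)])
    also have "\<dots> \<le> L2_norm \<Omega> w * L2_norm \<Omega> ?v" using L2_Cauchy_Schwarz[OF w vL] by linarith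
    also have "\<dots> \<le> L2_norm \<Omega> w * (K\<^sub>2 * L2_norm \<Omega> w)"
      by (rule mult_left_mono[OF Sh_bound[OF h w] L2_norm_nonneg])
    finally have "?g \<le> K\<^sub>2 / \<theta> * (L2_norm \<Omega> w)\<^sup>2"
      using \<theta>(1) by (simp add: pos_le_divide_eq power2_eq_square mult_ac)
    then have "sqrt ?g \<le> sqrt (K\<^sub>2 / \<theta> * (L2_norm \<Omega> w)\<^sup>2)" by (rule real_sqrt_le_mono)
    also have "\<dots> = sqrt (K\<^sub>2 / \<theta>) * L2_norm \<Omega> w"
      by (simp only: real_sqrt_mult real_sqrt_abs abs_of_nonneg[OF L2_norm_nonneg])
    finally have sq: "sqrt ?g \<le> sqrt (K\<^sub>2 / \<theta>) * L2_norm \<Omega> w" .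
    have "\<bar>L2_inner \<Omega> ?v r\<bar> \<le> 8 * exp 4 / \<kappa> * h * sqrt ?g * L2_norm \<Omega> r"
      by (rule Y_space_zero_mean_pairing[OF form(1) g vL r mean])
    also have "\<dots> \<le> 8 * exp 4 / \<kappa> * h * (sqrt (K\<^sub>2 / \<theta>) * L2_norm \<Omega> w) * L2_norm \<Omega> r"
      using mesh_pos by (intro mult_right_mono mult_left_mono sq L2_norm_nonneg) simp
    finally show ?thesis by (simp add: B_def mult_ac)
  qed
  have zero_mean: "L2_norm \<Omega> (S r) \<le> (B + K\<^sub>1) * h * L2_norm \<Omega> r"
    if h: "h \<in> H" "h \<le> 1" and r: "r \<in> L2 \<Omega>"
      and mean: "\<And>T. T \<in> \<T> h \<Longrightarrow> (\<integral>x. indicator (interior T) x * r x \<partial>lebesgue_on \<Omega>) = 0" for h r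
  proof -
    define w where "w = S r"
    have w: "w \<in> L2 \<Omega>" unfolding w_def by (rule symmetric_L2_in[OF symS r])
    have Sw: "S w \<in> L2 \<Omega>" and Shw: "S\<^sub>h h w \<in> L2 \<Omega>"
      using symmetric_L2_in[OF symS w] symmetric_L2_in[OF symSh[OF h(1)] w] by auto
    have h0: "0 < h" "h\<^sup>2 \<le> h" using h H by (auto simp: power2_eq_square mult_left_le)
    have "(L2_norm \<Omega> w)\<^sup>2 = L2_inner \<Omega> (S r) w" unfolding L2_norm_sq_inner by (simp add: w_def)
    also have "\<dots> = L2_inner \<Omega> r (S w)" by (rule symmetric_L2_inner[OF symS r w])
    also have "\<dots> = L2_inner \<Omega> (\<lambda>x. S w x - S\<^sub>h h w x) r + L2_inner \<Omega> (S\<^sub>h h w) r"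
      unfolding L2_inner_diff_left[OF Sw Shw r] by (simp add: L2_inner_commute[of _ r])
    also have "\<dots> \<le> K\<^sub>1 * h\<^sup>2 * L2_norm \<Omega> w * L2_norm \<Omega> r + B * h * L2_norm \<Omega> w * L2_norm \<Omega> r"
    proof (rule add_mono)
      have "L2_inner \<Omega> (\<lambda>x. S w x - S\<^sub>h h w x) r \<le> L2_norm \<Omega> (\<lambda>x. S w x - S\<^sub>h h w x) * L2_norm \<Omega> r"
        using L2_Cauchy_Schwarz[OF L2_diff[OF Sw Shw] r] by linarith
      also have "\<dots> \<le> K\<^sub>1 * h\<^sup>2 * L2_norm \<Omega> w * L2_norm \<Omega> r"
        by (rule mult_right_mono[OF K\<^sub>1(2)[OF h(1) w] L2_norm_nonneg])
      finally show "L2_inner \<Omega> (\<lambda>x. S w x - S\<^sub>h h w x) r \<le> K\<^sub>1 * h\<^sup>2 * L2_norm \<Omega> w * L2_norm \<Omega> r" .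
      show "L2_inner \<Omega> (S\<^sub>h h w) r \<le> B * h * L2_norm \<Omega> w * L2_norm \<Omega> r"
        using pairing[OF h w r mean] by linarith
    qed
    also have "K\<^sub>1 * h\<^sup>2 * L2_norm \<Omega> w * L2_norm \<Omega> r \<le> K\<^sub>1 * h * L2_norm \<Omega> w * L2_norm \<Omega> r"
      using K\<^sub>1(1) h0 by (intro mult_right_mono mult_left_mono L2_norm_nonneg) auto
    finally have "L2_norm \<Omega> w * L2_norm \<Omega> w \<le> L2_norm \<Omega> w * ((B + K\<^sub>1) * h * L2_norm \<Omega> r)"
      by (simp add: power2_eq_square distrib_right distrib_left mult_ac)
    moreover have "0 \<le> B"
      using regular_mesh.mesh_pos(1)[OF mesh[OF h(1)]] K\<^sub>2 \<theta>(1) by (simp add: B_def)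
    then have "0 \<le> (B + K\<^sub>1) * h * L2_norm \<Omega> r" using K\<^sub>1(1) h0 by (simp add: L2_norm_nonneg)
    ultimately show ?thesis
      using L2_norm_nonneg[of \<Omega> w] by (cases "L2_norm \<Omega> w = 0") (auto simp: w_def)
  qed
  define K where "K = max K\<^sub>0 (max K\<^sub>1 (B + K\<^sub>1))"
  have K: "K\<^sub>0 \<le> K" "K\<^sub>1 \<le> K" "B + K\<^sub>1 \<le> K" by (auto simp: K_def)
  show ?thesis
  proof (rule that)
    show "0 < K" using K(1) K\<^sub>0(1) by linarith
    show "\<forall>u\<in>L2 \<Omega>. L2_norm \<Omega> (S u) \<le> K * L2_norm \<Omega> u"
    proof
      fix u assume "u \<in> L2 \<Omega>"
      from K\<^sub>0(2)[OF this] show "L2_norm \<Omega> (S u) \<le> K * L2_norm \<Omega> u"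
        using mult_right_mono[OF K(1) L2_norm_nonneg[of \<Omega> u]] by linarith
    qed
    show "\<forall>h\<in>H. \<forall>u\<in>L2 \<Omega>. L2_norm \<Omega> (\<lambda>x. S u x - S\<^sub>h h u x) \<le> K * h\<^sup>2 * L2_norm \<Omega> u"
    proof (intro ballI)
      fix h u assume "h \<in> H" "u \<in> L2 \<Omega>"
      from K\<^sub>1(2)[OF this] show "L2_norm \<Omega> (\<lambda>x. S u x - S\<^sub>h h u x) \<le> K * h\<^sup>2 * L2_norm \<Omega> u"
        by (rule order_trans) (intro mult_right_mono K(2) L2_norm_nonneg zero_le_power2)
    qed
    show "\<forall>h\<in>H. \<forall>r\<in>L2 \<Omega>. h \<le> 1 \<longrightarrow>
        (\<forall>T\<in>\<T> h. (\<integral>x. indicator (interior T) x * r x \<partial>lebesgue_on \<Omega>) = 0) \<longrightarrow>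
        L2_norm \<Omega> (S r) \<le> K * h * L2_norm \<Omega> r"
    proof (intro ballI impI)
      fix h r assume h: "h \<in> H" "h \<le> 1" and r: "r \<in> L2 \<Omega>"
        and mean: "\<forall>T\<in>\<T> h. (\<integral>x. indicator (interior T) x * r x \<partial>lebesgue_on \<Omega>) = 0"
      have "0 \<le> h" using h(1) H by auto
      then have "(B + K\<^sub>1) * h * L2_norm \<Omega> r \<le> K * h * L2_norm \<Omega> r"
        by (intro mult_right_mono K(3) L2_norm_nonneg)
      then show "L2_norm \<Omega> (S r) \<le> K * h * L2_norm \<Omega> r"
        using zero_mean[OF h r bspec[OF mean]] by linarith
    qed
  qed
qed

text \<open>Jensen's inequality cell by cell, for integrands that need not be convex globally.\<close>

lemma (in regular_mesh) cell_projection_Jensen: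
  assumes u: "integrable (lebesgue_on \<Omega>) u"
    and Fu: "integrable (lebesgue_on \<Omega>) (\<lambda>x. F (u x))"
    and FPu: "integrable (lebesgue_on \<Omega>) (\<lambda>x. F (cell_projection u x))"
    and tangent: "\<And>T. T \<in> \<T> \<Longrightarrow> \<exists>k::real. AE x in lebesgue_on \<Omega>. x \<in> interior T \<longrightarrow>
        F (cell_mean u T) + k * (u x - cell_mean u T) \<le> (F (u x) :: real)"
  shows "(\<integral>x. F (cell_projection u x) \<partial>lebesgue_on \<Omega>) \<le> (\<integral>x. F (u x) \<partial>lebesgue_on \<Omega>)"
proof -
  have "(\<integral>x. indicator (interior T) x * F (cell_projection u x) \<partial>lebesgue_on \<Omega>)
      \<le> (\<integral>x. indicator (interior T) x * F (u x) \<partial>lebesgue_on \<Omega>)" if T: "T \<in> \<T>" for T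
  proof -
    obtain k where k: "AE x in lebesgue_on \<Omega>. x \<in> interior T \<longrightarrow>
        F (cell_mean u T) + k * (u x - cell_mean u T) \<le> F (u x)" using tangent[OF T] by blast
    let ?m = "cell_mean u T"
    have i1: "integrable (lebesgue_on \<Omega>) (\<lambda>x. indicator (interior T) x * u x)"
      by (rule mesh_integrable_cell[OF u])
    have i2: "integrable (lebesgue_on \<Omega>) (\<lambda>x. indicator (interior T) x :: real)"
      by (rule cell_indicator_integrable)
    have "(\<integral>x. indicator (interior T) x * F (cell_projection u x) \<partial>lebesgue_on \<Omega>)
        = (\<integral>x. F ?m * indicator (interior T) x \<partial>lebesgue_on \<Omega>)"
      by (intro Bochner_Integration.integral_cong refl) (simp add: indicator_def cell_projection_at[OF T])
    also have "\<dots> = F ?m * (\<integral>x. indicator (interior T) x \<partial>lebesgue_on \<Omega>)"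
      by (rule Bochner_Integration.integral_mult_right_zero)
    also have "\<dots> = (\<integral>x. F ?m * indicator (interior T) x
        + k * (indicator (interior T) x * u x - ?m * indicator (interior T) x) \<partial>lebesgue_on \<Omega>)"
    proof -
      have "(\<integral>x. F ?m * indicator (interior T) x
          + k * (indicator (interior T) x * u x - ?m * indicator (interior T) x) \<partial>lebesgue_on \<Omega>)
        = F ?m * (\<integral>x. indicator (interior T) x \<partial>lebesgue_on \<Omega>)
          + k * ((\<integral>x. indicator (interior T) x * u x \<partial>lebesgue_on \<Omega>)
                 - ?m * (\<integral>x. indicator (interior T) x \<partial>lebesgue_on \<Omega>))"
        by (simp only: Bochner_Integration.integral_add[OF integrable_mult_right[OF i2]
              integrable_mult_right[OF Bochner_Integration.integrable_diff[OF i1 integrable_mult_right[OF i2]]]]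
            Bochner_Integration.integral_diff[OF i1 integrable_mult_right[OF i2]]
            Bochner_Integration.integral_mult_right_zero)
      then show ?thesis by (simp only: cell_mean_integral[of T u] diff_self mult_zero_right add_0_right)
    qed
    also have "\<dots> \<le> (\<integral>x. indicator (interior T) x * F (u x) \<partial>lebesgue_on \<Omega>)"
    proof (rule integral_mono_AE)
      show "AE x in lebesgue_on \<Omega>. F ?m * indicator (interior T) x
          + k * (indicator (interior T) x * u x - ?m * indicator (interior T) x)
          \<le> indicator (interior T) x * F (u x)"
        using k by eventually_elim (simp add: indicator_def)
      show "integrable (lebesgue_on \<Omega>) (\<lambda>x. indicator (interior T) x * F (u x))"
        by (rule mesh_integrable_cell[OF Fu])
      show "integrable (lebesgue_on \<Omega>) (\<lambda>x. F ?m * indicator (interior T) x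
          + k * (indicator (interior T) x * u x - ?m * indicator (interior T) x))"
        by (intro Bochner_Integration.integrable_add integrable_mult_right Bochner_Integration.integrable_diff i1 i2)
    qed
    finally show ?thesis .
  qed
  then show ?thesis
    unfolding mesh_integral_split[OF Fu] mesh_integral_split[OF FPu] by (rule sum_mono)
qed

text \<open>
  If a step function is uniformly close to \<open>u\<close>, then \<open>u\<close> cannot jump across the gap \<open>(0, m)\<close> within
  a cell: it vanishes there, or has one sign \<open>\<sigma>\<close> and modulus at least \<open>m\<close>.
\<close>

lemma (in regular_mesh) cell_dichotomy:
  assumes gap: "AE x in lebesgue_on \<Omega>. u x \<noteq> 0 \<longrightarrow> m \<le> \<bar>u x\<bar>"
    and v: "v \<in> U_space \<Omega> \<T>" and close: "AE x in lebesgue_on \<Omega>. \<bar>v x - u x\<bar> \<le> \<epsilon>"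
    and \<epsilon>: "\<epsilon> < m / 2" and T: "T \<in> \<T>"
  shows "(AE x in lebesgue_on \<Omega>. x \<in> interior T \<longrightarrow> u x = 0) \<or>
    (\<exists>\<sigma>. \<bar>\<sigma>\<bar> = 1 \<and> (AE x in lebesgue_on \<Omega>. x \<in> interior T \<longrightarrow> m \<le> \<sigma> * u x))"
proof -
  obtain c where c: "AE x in lebesgue_on \<Omega>. x \<in> T \<longrightarrow> v x = c" using v T unfolding U_space_def by blast
  have all: "AE x in lebesgue_on \<Omega>. x \<in> interior T \<longrightarrow> (u x = 0 \<or> m \<le> \<bar>u x\<bar>) \<and> \<bar>c - u x\<bar> \<le> \<epsilon>"
    using gap close c
  proof eventually_elim
    case (elim x)
    then show ?case using interior_subset[of T] by auto
  qed
  show ?thesis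
  proof (cases "\<bar>c\<bar> < m / 2")
    case True
    have "AE x in lebesgue_on \<Omega>. x \<in> interior T \<longrightarrow> u x = 0"
      using all
    proof eventually_elim
      case (elim x)
      show ?case
      proof
        assume "x \<in> interior T"
        with elim have "u x = 0 \<or> m \<le> \<bar>u x\<bar>" "\<bar>c - u x\<bar> \<le> \<epsilon>" by auto
        then show "u x = 0" using True \<epsilon> by linarith
      qed
    qed
    then show ?thesis ..
  next
    case False
    define \<sigma> :: real where "\<sigma> = (if 0 \<le> c then 1 else -1)"
    have "AE x in lebesgue_on \<Omega>. x \<in> interior T \<longrightarrow> m \<le> \<sigma> * u x"
      using all
    proof eventually_elim
      case (elim x)
      show ?case
      proof
        assume "x \<in> interior T"
        with elim have "u x = 0 \<or> m \<le> \<bar>u x\<bar>" "\<bar>c - u x\<bar> \<le> \<epsilon>" by auto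
        then show "m \<le> \<sigma> * u x" using False \<epsilon> by (auto simp: \<sigma>_def split: if_splits)
      qed
    qed
    moreover have "\<bar>\<sigma>\<bar> = 1" by (simp add: \<sigma>_def)
    ultimately show ?thesis by blast
  qed
qed

text \<open>
  Although \<open>F\<close> is not convex, Jensen's inequality applies on each cell: there \<open>u\<close> vanishes, or its
  values lie on one side of the gap, where \<open>F\<close> is convex.
\<close>

lemma (in sparse_control) cell_projection_density_le:
  assumes mesh: "regular_mesh \<Omega> \<T> \<kappa> h" and C: "1 < C"
    and u: "u \<in> L2 \<Omega>" "AE x in lebesgue_on \<Omega>. \<bar>u x\<bar> \<le> R"
    and Pu: "AE x in lebesgue_on \<Omega>. \<bar>regular_mesh.cell_projection \<Omega> \<T> u x\<bar> \<le> R"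
    and gap: "AE x in lebesgue_on \<Omega>. u x \<noteq> 0 \<longrightarrow> C * s\<^sub>0 + t\<^sub>0 \<le> \<bar>u x\<bar>"
    and v: "v \<in> U_space \<Omega> \<T>" and close: "AE x in lebesgue_on \<Omega>. \<bar>v x - u x\<bar> \<le> \<epsilon>"
    and \<epsilon>: "\<epsilon> < (C * s\<^sub>0 + t\<^sub>0) / 2"
  shows "(\<integral>x. F (regular_mesh.cell_projection \<Omega> \<T> u x) \<partial>lebesgue_on \<Omega>) \<le> (\<integral>x. F (u x) \<partial>lebesgue_on \<Omega>)"
proof -
  interpret regular_mesh \<Omega> \<T> \<kappa> h by (rule mesh)
  have m: "0 < C * s\<^sub>0 + t\<^sub>0" using C s\<^sub>0_pos t\<^sub>0_pos by (simp add: add_pos_pos)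
  have iu: "integrable (lebesgue_on \<Omega>) u" by (rule L2_integrable[OF mesh_lmeasurable u(1)])
  show ?thesis
  proof (rule cell_projection_Jensen[OF iu])
    show "integrable (lebesgue_on \<Omega>) (\<lambda>x. F (u x))"
      by (rule bounded_density_integrable[OF mesh_lmeasurable L2_measurable[OF u(1)] u(2)])
    show "integrable (lebesgue_on \<Omega>) (\<lambda>x. F (cell_projection u x))"
      by (rule bounded_density_integrable[OF mesh_lmeasurable cell_projection_measurable Pu])
    fix T assume T: "T \<in> \<T>"
    let ?c = "cell_mean u T"
    show "\<exists>k::real. AE x in lebesgue_on \<Omega>. x \<in> interior T \<longrightarrow> F ?c + k * (u x - ?c) \<le> F (u x)"
    proof (cases "(\<integral>x. indicator (interior T) x \<partial>lebesgue_on \<Omega>) = (0::real)")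
      case True
      have "AE x in lebesgue_on \<Omega>. x \<in> interior T \<longrightarrow> F ?c + 0 * (u x - ?c) \<le> F (u x)"
        using cell_area_zero[OF True] by eventually_elim blast
      then show ?thesis by blast
    next
      case False
      from cell_dichotomy[OF gap v close \<epsilon> T] consider
        (zero) "AE x in lebesgue_on \<Omega>. x \<in> interior T \<longrightarrow> u x = 0"
        | (signed) \<sigma> where "\<bar>\<sigma>\<bar> = 1" "AE x in lebesgue_on \<Omega>. x \<in> interior T \<longrightarrow> C * s\<^sub>0 + t\<^sub>0 \<le> \<sigma> * u x"
        by blast
      then show ?thesis
      proof cases
        case zero
        have "(\<integral>x. indicator (interior T) x * u x \<partial>lebesgue_on \<Omega>) = 0"
          by (rule integral_eq_zero_AE) (use zero in \<open>eventually_elim, simp add: indicator_def\<close>)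
        then have "?c = 0" by (simp add: cell_mean_def)
        then have "F ?c + 0 * (t - ?c) \<le> F t" for t using F_0 F_nonneg[of t] by simp
        then show ?thesis by (intro exI[of _ 0]) simp
      next
        case (signed \<sigma>)
        have "AE x in lebesgue_on \<Omega>. x \<in> interior T \<longrightarrow> C * s\<^sub>0 + t\<^sub>0 \<le> \<sigma> * u x \<and> \<sigma> * u x \<le> R"
          using signed(2) u(2)
        proof eventually_elim
          case (elim x)
          have "\<sigma> * u x \<le> \<bar>\<sigma> * u x\<bar>" by (rule abs_ge_self)
          then show ?case using elim signed(1) by (auto simp: abs_mult)
        qed
        from cell_mean_bounds(1)[OF integrable_mult_right[OF iu] this False]
        have "C * s\<^sub>0 + t\<^sub>0 \<le> cell_mean (\<lambda>x. \<sigma> * u x) T" .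
        also have "cell_mean (\<lambda>x. \<sigma> * u x) T = \<sigma> * ?c"
          unfolding cell_mean_def mult.left_commute[of _ \<sigma>] Bochner_Integration.integral_mult_right_zero
          by simp
        finally have c: "C * s\<^sub>0 + t\<^sub>0 \<le> \<sigma> * ?c" .
        have abs_ge: "C * s\<^sub>0 + t\<^sub>0 \<le> \<bar>t\<bar>" if "C * s\<^sub>0 + t\<^sub>0 \<le> \<sigma> * t" for t
          using that signed(1) abs_ge_self[of "\<sigma> * t"] by (simp add: abs_mult)
        obtain k where k: "\<forall>t. C * s\<^sub>0 + t\<^sub>0 \<le> \<bar>t\<bar> \<longrightarrow> 0 < ?c * t \<longrightarrow> F ?c + k * (t - ?c) \<le> F t"
          by (rule F_above_tangent[OF C abs_ge[OF c]])
        have "AE x in lebesgue_on \<Omega>. x \<in> interior T \<longrightarrow> F ?c + k * (u x - ?c) \<le> F (u x)"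
          using signed(2)
        proof eventually_elim
          case (elim x)
          show ?case
          proof
            assume "x \<in> interior T"
            then have t: "C * s\<^sub>0 + t\<^sub>0 \<le> \<sigma> * u x" using elim by blast
            have "0 < \<sigma> * ?c" "0 < \<sigma> * u x" using c t m by linarith+
            then have "0 < (\<sigma> * ?c) * (\<sigma> * u x)" by (rule mult_pos_pos)
            also have "(\<sigma> * ?c) * (\<sigma> * u x) = (\<sigma> * \<sigma>) * (?c * u x)" by (simp only: mult_ac)
            also have "\<sigma> * \<sigma> = 1" using signed(1) by (metis abs_mult_self_eq mult_1)
            finally have "0 < ?c * u x" by simp
            then show "F ?c + k * (u x - ?c) \<le> F (u x)" using k abs_ge[OF t] by blast
          qed
        qed
        then show ?thesis by blast
      qed
    qed
  qed
qed

section \<open>The error estimate\<close>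

lemma L2_norm_sq_diff_le:
  assumes "a \<in> L2 \<Omega>" "b \<in> L2 \<Omega>"
  shows "(L2_norm \<Omega> a)\<^sup>2 - (L2_norm \<Omega> b)\<^sup>2
    \<le> L2_norm \<Omega> (\<lambda>x. a x - b x) * (2 * L2_norm \<Omega> b + L2_norm \<Omega> (\<lambda>x. a x - b x))"
proof -
  let ?d = "L2_norm \<Omega> (\<lambda>x. a x - b x)"
  have "L2_norm \<Omega> a \<le> L2_norm \<Omega> b + ?d"
    using L2_triangle[OF assms(2) L2_diff[OF assms]] by simp
  then have "(L2_norm \<Omega> a)\<^sup>2 \<le> (L2_norm \<Omega> b + ?d)\<^sup>2" by (rule power_mono) (rule L2_norm_nonneg)
  then show ?thesis by (simp add: power2_eq_square algebra_simps)
qed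

lemma Lp_subset_L2:
  assumes \<Omega>: "\<Omega> \<in> lmeasurable" and p: "2 \<le> p" and u: "u \<in> Lp p \<Omega>"
  shows "u \<in> L2 \<Omega>"
proof -
  interpret finite_measure "lebesgue_on \<Omega>" by (rule finite_measure_lebesgue_on[OF \<Omega>])
  have m: "u \<in> borel_measurable (lebesgue_on \<Omega>)" and i: "integrable (lebesgue_on \<Omega>) (\<lambda>x. \<bar>u x\<bar> powr p)"
    using u by (auto simp: Lp_def)
  have "(u x)\<^sup>2 \<le> 1 + \<bar>u x\<bar> powr p" for x
  proof (cases "\<bar>u x\<bar> \<le> 1")
    case True
    then have "(u x)\<^sup>2 \<le> 1" by (simp add: abs_square_le_1)
    then show ?thesis using powr_ge_zero[of "\<bar>u x\<bar>" p] by linarith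
  next
    case False
    then have "\<bar>u x\<bar> powr 2 \<le> \<bar>u x\<bar> powr p" using p by (intro powr_mono) auto
    then show ?thesis by (simp add: abs_powr_2)
  qed
  then have le: "norm ((u x)\<^sup>2) \<le> norm (1 + \<bar>u x\<bar> powr p)" for x
    unfolding real_norm_def by (metis abs_ge_self abs_power2 order_trans)
  have "integrable (lebesgue_on \<Omega>) (\<lambda>x. (u x)\<^sup>2)"
  proof (rule Bochner_Integration.integrable_bound)
    show "integrable (lebesgue_on \<Omega>) (\<lambda>x. 1 + \<bar>u x\<bar> powr p)" using i by simp
    show "(\<lambda>x. (u x)\<^sup>2) \<in> borel_measurable (lebesgue_on \<Omega>)" by (rule borel_measurable_power[OF m])
    show "AE x in lebesgue_on \<Omega>. norm ((u x)\<^sup>2) \<le> norm (1 + \<bar>u x\<bar> powr p)" using le by (rule AE_I2)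
  qed
  then show ?thesis using m by (simp add: L2_iff)
qed

lemma symmetric_L2_norm_diff:
  assumes S: "symmetric_L2 \<Omega> S" and u: "u \<in> L2 \<Omega>" and v: "v \<in> L2 \<Omega>"
  shows "L2_norm \<Omega> (\<lambda>x. S u x - S v x) = L2_norm \<Omega> (S (\<lambda>x. u x - v x))"
proof (rule L2_norm_cong_AE)
  show "AE x in lebesgue_on \<Omega>. S u x - S v x = S (\<lambda>x. u x - v x) x"
    using symmetric_L2_linear[OF S u v, of 1 "-1"] by eventually_elim simp
  show "(\<lambda>x. S u x - S v x) \<in> L2 \<Omega>" by (intro L2_diff symmetric_L2_in[OF S] u v)
  show "S (\<lambda>x. u x - v x) \<in> L2 \<Omega>" by (intro L2_diff symmetric_L2_in[OF S] u v)
qed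

context sparse_control
begin

lemma cost_eq:
  assumes \<Omega>: "\<Omega> \<in> lmeasurable" and u: "u \<in> L2 \<Omega>" and b: "AE x in lebesgue_on \<Omega>. \<bar>u x\<bar> \<le> R"
  shows "cost \<Omega> f y\<^sub>d \<alpha> \<beta> q \<gamma> S u
    = 1 / 2 * (L2_norm \<Omega> (\<lambda>x. S u x + S f x - y\<^sub>d x))\<^sup>2 + (\<integral>x. F (u x) \<partial>lebesgue_on \<Omega>)"
proof -
  have um: "u \<in> borel_measurable (lebesgue_on \<Omega>)" by (rule L2_measurable[OF u])
  have iF: "integrable (lebesgue_on \<Omega>) (\<lambda>x. F (u x))" by (rule bounded_density_integrable[OF \<Omega> um b])
  have i2: "integrable (lebesgue_on \<Omega>) (\<lambda>x. (u x)\<^sup>2)" using u by (simp add: L2_iff)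
  have "\<beta> * Upsilon \<Omega> q \<gamma> u = (\<integral>x. F (u x) - \<alpha> / 2 * (u x)\<^sup>2 \<partial>lebesgue_on \<Omega>)"
    unfolding Upsilon_def control_density_def
    by (simp only: add_diff_cancel_left' Bochner_Integration.integral_mult_right_zero)
  also have "\<dots> = (\<integral>x. F (u x) \<partial>lebesgue_on \<Omega>) - \<alpha> / 2 * (\<integral>x. (u x)\<^sup>2 \<partial>lebesgue_on \<Omega>)"
    by (simp only: Bochner_Integration.integral_diff[OF iF integrable_mult_right[OF i2]]
        Bochner_Integration.integral_mult_right_zero)
  finally show ?thesis unfolding cost_def L2_norm_sq[of \<Omega> u] by linarith
qed

text \<open>
  Quadratic growth. A quadratic gain in the density at the midpoint of \<open>u\<close> and \<open>v\<close> puts its cost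
  below the mean of theirs by \<open>\<kappa> \<parallel>u - v\<parallel>\<^sup>2\<close>, as the tracking term is convex; but the midpoint does not
  cost less than \<open>u\<close>.
\<close>

lemma cost_growth:
  assumes \<Omega>: "\<Omega> \<in> lmeasurable" and S: "symmetric_L2 \<Omega> S" and z: "(\<lambda>x. S f x - y\<^sub>d x) \<in> L2 \<Omega>"
    and u: "u \<in> L2 \<Omega>" "AE x in lebesgue_on \<Omega>. \<bar>u x\<bar> \<le> R"
    and v: "v \<in> L2 \<Omega>" "AE x in lebesgue_on \<Omega>. \<bar>v x\<bar> \<le> R"
    and mid: "cost \<Omega> f y\<^sub>d \<alpha> \<beta> q \<gamma> S u \<le> cost \<Omega> f y\<^sub>d \<alpha> \<beta> q \<gamma> S (\<lambda>x. 1 / 2 * u x + 1 / 2 * v x)"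
    and conv: "AE x in lebesgue_on \<Omega>. F ((v x + u x) / 2) \<le> (F (v x) + F (u x)) / 2 - \<kappa> * (v x - u x)\<^sup>2"
  shows "2 * \<kappa> * (L2_norm \<Omega> (\<lambda>x. u x - v x))\<^sup>2 \<le> cost \<Omega> f y\<^sub>d \<alpha> \<beta> q \<gamma> S v - cost \<Omega> f y\<^sub>d \<alpha> \<beta> q \<gamma> S u"
proof -
  let ?w = "\<lambda>x. 1 / 2 * u x + 1 / 2 * v x"
  have w: "?w \<in> L2 \<Omega>" by (rule L2_lin[OF u(1) v(1)])
  have wb: "AE x in lebesgue_on \<Omega>. \<bar>?w x\<bar> \<le> R"
    using u(2) v(2) by eventually_elim (auto simp: abs_le_iff)
  have Fw: "(\<integral>x. F (?w x) \<partial>lebesgue_on \<Omega>)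
      \<le> 1 / 2 * (\<integral>x. F (v x) \<partial>lebesgue_on \<Omega>) + 1 / 2 * (\<integral>x. F (u x) \<partial>lebesgue_on \<Omega>)
        - \<kappa> * (L2_norm \<Omega> (\<lambda>x. u x - v x))\<^sup>2"
  proof -
    have id: "integrable (lebesgue_on \<Omega>) (\<lambda>x. (u x - v x)\<^sup>2)" using L2_diff[OF u(1) v(1)] by (simp add: L2_iff)
    have iu: "integrable (lebesgue_on \<Omega>) (\<lambda>x. 1 / 2 * F (u x))"
      and iv: "integrable (lebesgue_on \<Omega>) (\<lambda>x. 1 / 2 * F (v x))"
      and iw: "integrable (lebesgue_on \<Omega>) (\<lambda>x. F (?w x))"
      and i\<kappa>: "integrable (lebesgue_on \<Omega>) (\<lambda>x. \<kappa> * (u x - v x)\<^sup>2)"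
      by (rule integrable_mult_right[OF bounded_density_integrable[OF \<Omega> L2_measurable[OF u(1)] u(2)]],
          rule integrable_mult_right[OF bounded_density_integrable[OF \<Omega> L2_measurable[OF v(1)] v(2)]],
          rule bounded_density_integrable[OF \<Omega> L2_measurable[OF w] wb],
          rule integrable_mult_right[OF id])
    note ivu = Bochner_Integration.integrable_add[OF iv iu]
    note i = Bochner_Integration.integrable_diff[OF ivu i\<kappa>]
    have "(\<integral>x. F (?w x) \<partial>lebesgue_on \<Omega>)
        \<le> (\<integral>x. 1 / 2 * F (v x) + 1 / 2 * F (u x) - \<kappa> * (u x - v x)\<^sup>2 \<partial>lebesgue_on \<Omega>)"
    proof (rule integral_mono_AE[OF iw i])
      show "AE x in lebesgue_on \<Omega>. F (?w x) \<le> 1 / 2 * F (v x) + 1 / 2 * F (u x) - \<kappa> * (u x - v x)\<^sup>2"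
        using conv
      proof eventually_elim
        case (elim x)
        have e: "?w x = (v x + u x) / 2" "(u x - v x)\<^sup>2 = (v x - u x)\<^sup>2"
          by (simp, rule power2_commute)
        show ?case unfolding e using elim by (simp add: add_divide_distrib)
      qed
    qed
    also have "\<dots> = 1 / 2 * (\<integral>x. F (v x) \<partial>lebesgue_on \<Omega>) + 1 / 2 * (\<integral>x. F (u x) \<partial>lebesgue_on \<Omega>)
        - \<kappa> * (\<integral>x. (u x - v x)\<^sup>2 \<partial>lebesgue_on \<Omega>)"
      unfolding Bochner_Integration.integral_diff[OF ivu i\<kappa>] Bochner_Integration.integral_add[OF iv iu]
        Bochner_Integration.integral_mult_right_zero ..
    finally show ?thesis unfolding L2_norm_sq .
  qed
  have track: "(L2_norm \<Omega> (\<lambda>x. S ?w x + S f x - y\<^sub>d x))\<^sup>2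
      \<le> 1 / 2 * (L2_norm \<Omega> (\<lambda>x. S u x + S f x - y\<^sub>d x))\<^sup>2 + 1 / 2 * (L2_norm \<Omega> (\<lambda>x. S v x + S f x - y\<^sub>d x))\<^sup>2"
  proof -
    let ?a = "\<lambda>x. S u x + (S f x - y\<^sub>d x)" and ?b = "\<lambda>x. S v x + (S f x - y\<^sub>d x)"
    have aL: "?a \<in> L2 \<Omega>" and bL: "?b \<in> L2 \<Omega>"
      by (rule L2_add[OF symmetric_L2_in[OF S u(1)] z], rule L2_add[OF symmetric_L2_in[OF S v(1)] z])
    have "AE x in lebesgue_on \<Omega>. S ?w x + (S f x - y\<^sub>d x) = 1 / 2 * ?a x + 1 / 2 * ?b x"
      using symmetric_L2_linear[OF S u(1) v(1), of "1/2" "1/2"]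
    proof eventually_elim
      case (elim x)
      show ?case unfolding elim by (simp add: field_simps)
    qed
    then have mean: "L2_norm \<Omega> (\<lambda>x. S ?w x + (S f x - y\<^sub>d x)) = L2_norm \<Omega> (\<lambda>x. 1 / 2 * ?a x + 1 / 2 * ?b x)"
      by (rule L2_norm_cong_AE[OF _ L2_add[OF symmetric_L2_in[OF S w] z] L2_lin[OF aL bL]])
    have "(L2_norm \<Omega> (\<lambda>x. S ?w x + (S f x - y\<^sub>d x)))\<^sup>2
        = 1 / 4 * (L2_norm \<Omega> ?a)\<^sup>2 + 1 / 2 * L2_inner \<Omega> ?a ?b + 1 / 4 * (L2_norm \<Omega> ?b)\<^sup>2"
      unfolding mean L2_norm_lin_sq[OF aL bL] by (simp add: power2_eq_square)
    also have "\<dots> \<le> 1 / 2 * (L2_norm \<Omega> ?a)\<^sup>2 + 1 / 2 * (L2_norm \<Omega> ?b)\<^sup>2"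
    proof -
      have "0 \<le> (L2_norm \<Omega> ?a - L2_norm \<Omega> ?b)\<^sup>2" by simp
      then have "2 * (L2_norm \<Omega> ?a * L2_norm \<Omega> ?b) \<le> (L2_norm \<Omega> ?a)\<^sup>2 + (L2_norm \<Omega> ?b)\<^sup>2"
        by (simp add: power2_diff)
      then show ?thesis using L2_Cauchy_Schwarz[OF aL bL] by linarith
    qed
    finally show ?thesis by (simp only: add_diff_eq)
  qed
  show ?thesis
    using mid Fw track unfolding cost_eq[OF \<Omega> u] cost_eq[OF \<Omega> v] cost_eq[OF \<Omega> w wb] by linarith
qed

end

theorem theorem5:
  fixes \<Omega> :: "(real^2) set"
    and a :: "real^2 \<Rightarrow> real^2^2"
    and c\<^sub>0 f y\<^sub>d y\<^sub>f u_bar y_bar :: "real^2 \<Rightarrow> real"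
    and p \<alpha> \<beta> q \<gamma> u\<^sub>a u\<^sub>b s_star :: real
    and S S_adj :: "(real^2 \<Rightarrow> real) \<Rightarrow> (real^2 \<Rightarrow> real)"
    and H :: "real set"
    and \<T> :: "real \<Rightarrow> (real^2) set set"
    and S\<^sub>h :: "real \<Rightarrow> (real^2 \<Rightarrow> real) \<Rightarrow> (real^2 \<Rightarrow> real)"
    and u_bar\<^sub>h y_bar\<^sub>h :: "real \<Rightarrow> real^2 \<Rightarrow> real"
  assumes domain: "open \<Omega>" "bounded \<Omega>" "starlike \<Omega>"
    and data: "2 < p" "y\<^sub>d \<in> Lp p \<Omega>" "f \<in> L2 \<Omega>"
    and params: "0 < \<alpha>" "0 < \<beta>" "0 < q" "q < 1" "1 < \<gamma>" "u\<^sub>a < 0" "0 < u\<^sub>b"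
    and coeffs: "elliptic_coefficients \<Omega> a c\<^sub>0"
    and S: "solution_operator \<Omega> a c\<^sub>0 (H10 \<Omega>) S"
    and S_adj: "L2_adjoint \<Omega> S S_adj"
    and S_bounded: "bounded_L2_Linf \<Omega> S" "bounded_L2_Linf \<Omega> S_adj"
    and y\<^sub>f: "y\<^sub>f = S f"
    and H: "H \<subseteq> {0<..}" "0 islimpt H"
    and mesh: "mesh_family \<Omega> H \<T>"
    and S\<^sub>h: "\<forall>h\<in>H. solution_operator \<Omega> a c\<^sub>0 (Y_space \<Omega> (\<T> h)) (S\<^sub>h h)"
    and S\<^sub>h_f: "\<forall>h\<in>H. AE x in lebesgue_on \<Omega>. S\<^sub>h h f x = y\<^sub>f x"
    and fem_error: "\<forall>u\<in>L2 \<Omega>. \<exists>c\<^sub>A>0. \<forall>h\<in>H.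
        L2_norm \<Omega> (\<lambda>x. S u x - S\<^sub>h h u x) + h * H1_norm \<Omega> (\<lambda>x. S u x - S\<^sub>h h u x) \<le> c\<^sub>A * h\<^sup>2"
    and u_bar: "is_arg_min (cost \<Omega> f y\<^sub>d \<alpha> \<beta> q \<gamma> S) (\<lambda>u. u \<in> U_ad \<Omega> u\<^sub>a u\<^sub>b \<inter> BV \<Omega>) u_bar"
    and y_bar: "y_bar = (\<lambda>x. S u_bar x + y\<^sub>f x)"
    and u_bar\<^sub>h: "\<forall>h\<in>H. is_arg_min (cost \<Omega> f y\<^sub>d \<alpha> \<beta> q \<gamma> (S\<^sub>h h))
        (\<lambda>u. u \<in> U_ad \<Omega> u\<^sub>a u\<^sub>b \<inter> U_space \<Omega> (\<T> h)) (u_bar\<^sub>h h)"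
    and y_bar\<^sub>h: "\<forall>h\<in>H. y_bar\<^sub>h h = (\<lambda>x. S\<^sub>h h (u_bar\<^sub>h h) x + y\<^sub>f x)"
    and u_bar\<^sub>h_lim: "((\<lambda>h. Linf_norm \<Omega> (\<lambda>x. u_bar\<^sub>h h x - u_bar x)) \<longlongrightarrow> 0) (at 0 within H)"
    and s_star: "s_star = (\<beta> / \<alpha> * q * (1 - q)) powr (1 / (2 - q))"
    and A: "\<exists>C>1. AE x in lebesgue_on \<Omega>. u_bar x \<noteq> 0 \<longrightarrow> \<bar>u_bar x\<bar> \<ge> C * s_star + (1 - q) / \<gamma>"
    and B: "\<exists>c_star>0. \<forall>h\<in>H. (\<Sum>T\<in>T_star \<Omega> u_bar (\<T> h). measure lebesgue T) \<le> c_star * h"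
  shows "\<exists>c>0. \<forall>\<^sub>F h in at 0 within H.
           L2_norm \<Omega> (\<lambda>x. u_bar x - u_bar\<^sub>h h x) + L2_norm \<Omega> (\<lambda>x. y_bar x - y_bar\<^sub>h h x)
             \<le> c * h powr (1 / 2)"
proof -
  interpret sparse_control \<alpha> \<beta> q \<gamma> by unfold_locales (use params in auto)
  have lm: "\<Omega> \<in> lmeasurable" and ls: "\<Omega> \<in> sets lebesgue"
    using domain by (auto intro: lmeasurable_open simp: fmeasurableD)
  obtain C where C: "1 < C"
    and gap': "AE x in lebesgue_on \<Omega>. u_bar x \<noteq> 0 \<longrightarrow> \<bar>u_bar x\<bar> \<ge> C * s_star + (1 - q) / \<gamma>"
    using A by blast
  define m where "m = C * s\<^sub>0 + t\<^sub>0"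
  have m: "0 < m" using C s\<^sub>0_pos t\<^sub>0_pos by (simp add: m_def add_pos_pos)
  have gap: "AE x in lebesgue_on \<Omega>. u_bar x \<noteq> 0 \<longrightarrow> m \<le> \<bar>u_bar x\<bar>"
    using gap' by (simp add: m_def s\<^sub>0_def t\<^sub>0_def s_star)
  obtain \<kappa> \<epsilon> where \<kappa>: "0 < \<kappa>" and \<epsilon>: "0 < \<epsilon>" and strict:
    "\<forall>s t. (t \<noteq> 0 \<longrightarrow> m \<le> \<bar>t\<bar>) \<longrightarrow> \<bar>s - t\<bar> \<le> \<epsilon> \<longrightarrow> F ((s + t) / 2) \<le> (F s + F t) / 2 - \<kappa> * (s - t)\<^sup>2"
    by (rule F_midpoint_strict[OF C, folded m_def])
  obtain \<kappa>' where mesh': "\<And>h. h \<in> H \<Longrightarrow> regular_mesh \<Omega> (\<T> h) \<kappa>' h"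
    using mesh_family_regular[OF domain(1,2) mesh H(1)] by blast
  have Sh: "solution_operator \<Omega> a c\<^sub>0 (Y_space \<Omega> (\<T> h)) (S\<^sub>h h)" if "h \<in> H" for h
    using S\<^sub>h that by blast
  have err: "\<exists>c. \<forall>h\<in>H. L2_norm \<Omega> (\<lambda>x. S u x - S\<^sub>h h u x) \<le> c * h\<^sup>2" if u: "u \<in> L2 \<Omega>" for u
  proof -
    obtain c where c: "\<And>h. h \<in> H \<Longrightarrow> L2_norm \<Omega> (\<lambda>x. S u x - S\<^sub>h h u x)
        + h * H1_norm \<Omega> (\<lambda>x. S u x - S\<^sub>h h u x) \<le> c * h\<^sup>2" using fem_error u by blast
    have "L2_norm \<Omega> (\<lambda>x. S u x - S\<^sub>h h u x) \<le> c * h\<^sup>2" if h: "h \<in> H" for h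
    proof -
      have "0 \<le> h * H1_norm \<Omega> (\<lambda>x. S u x - S\<^sub>h h u x)"
        using h H(1) by (intro mult_nonneg_nonneg H1_norm_nonneg) auto
      then show ?thesis using c[OF h] by linarith
    qed
    then show ?thesis by blast
  qed
  obtain K where K: "0 < K" and K_S: "\<forall>u\<in>L2 \<Omega>. L2_norm \<Omega> (S u) \<le> K * L2_norm \<Omega> u"
    and K_err: "\<forall>h\<in>H. \<forall>u\<in>L2 \<Omega>. L2_norm \<Omega> (\<lambda>x. S u x - S\<^sub>h h u x) \<le> K * h\<^sup>2 * L2_norm \<Omega> u"
    and K_mean: "\<forall>h\<in>H. \<forall>r\<in>L2 \<Omega>. h \<le> 1 \<longrightarrow>
       (\<forall>T\<in>\<T> h. (\<integral>x. indicator (interior T) x * r x \<partial>lebesgue_on \<Omega>) = 0) \<longrightarrow>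
       L2_norm \<Omega> (S r) \<le> K * h * L2_norm \<Omega> r"
    by (rule finite_element_estimates[OF domain(1,2) coeffs S H(1) mesh' Sh err])
  have symS: "symmetric_L2 \<Omega> S" by (rule solution_operator_symmetric[OF S coeffs H10_subset_L2])
  have symSh: "symmetric_L2 \<Omega> (S\<^sub>h h)" if "h \<in> H" for h
    by (rule solution_operator_symmetric[OF Sh[OF that] coeffs])
      (use regular_mesh.Y_space_L2[OF mesh'[OF that]] in blast)
  define z where "z = (\<lambda>x. S f x - y\<^sub>d x)"
  have ydL: "y\<^sub>d \<in> L2 \<Omega>" by (rule Lp_subset_L2[OF lm _ data(2)]) (use data(1) in simp)
  have zL: "z \<in> L2 \<Omega>"
    unfolding z_def by (intro L2_diff symmetric_L2_in[OF symS] data(3) ydL)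
  define Z where "Z = L2_norm \<Omega> z"
  define R where "R = max (- u\<^sub>a) u\<^sub>b"
  have R0: "0 \<le> R" using params by (simp add: R_def)
  define N where "N = R * sqrt (measure lebesgue \<Omega>)"
  have N0: "0 \<le> N" using R0 by (simp add: N_def)
  have ad: "u \<in> L2 \<Omega>" "AE x in lebesgue_on \<Omega>. \<bar>u x\<bar> \<le> R" "L2_norm \<Omega> u \<le> N"
    if "u \<in> U_ad \<Omega> u\<^sub>a u\<^sub>b" for u
  proof -
    show uL: "u \<in> L2 \<Omega>" using that by (simp add: U_ad_def)
    have "AE x in lebesgue_on \<Omega>. u\<^sub>a \<le> u x \<and> u x \<le> u\<^sub>b" using that by (simp add: U_ad_def)
    then show b: "AE x in lebesgue_on \<Omega>. \<bar>u x\<bar> \<le> R" by eventually_elim (auto simp: R_def abs_le_iff)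
    show "L2_norm \<Omega> u \<le> N" unfolding N_def by (rule L2_bounded(2)[OF lm L2_measurable[OF uL] b R0])
  qed
  have ub: "u_bar \<in> U_ad \<Omega> u\<^sub>a u\<^sub>b" "u_bar \<in> BV \<Omega>"
    and ub_min: "\<And>w. w \<in> U_ad \<Omega> u\<^sub>a u\<^sub>b \<Longrightarrow> w \<in> BV \<Omega> \<Longrightarrow>
      cost \<Omega> f y\<^sub>d \<alpha> \<beta> q \<gamma> S u_bar \<le> cost \<Omega> f y\<^sub>d \<alpha> \<beta> q \<gamma> S w"
    using u_bar unfolding is_arg_min_def by (auto simp: not_less)
  define Q where "Q u = 1 / 2 * (L2_norm \<Omega> (\<lambda>x. S u x + z x))\<^sup>2" for u
  define Q\<^sub>h where "Q\<^sub>h h u = 1 / 2 * (L2_norm \<Omega> (\<lambda>x. S\<^sub>h h u x + z x))\<^sup>2" for h u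
  define \<Phi> where "\<Phi> u = (\<integral>x. F (u x) \<partial>lebesgue_on \<Omega>)" for u :: "real^2 \<Rightarrow> real"
  have cost_Q: "cost \<Omega> f y\<^sub>d \<alpha> \<beta> q \<gamma> S u = Q u + \<Phi> u" if "u \<in> U_ad \<Omega> u\<^sub>a u\<^sub>b" for u
    unfolding cost_eq[OF lm ad(1,2)[OF that]] Q_def \<Phi>_def z_def by (simp add: add_diff_eq)
  have cost_Q\<^sub>h: "cost \<Omega> f y\<^sub>d \<alpha> \<beta> q \<gamma> (S\<^sub>h h) u = Q\<^sub>h h u + \<Phi> u" if u: "u \<in> U_ad \<Omega> u\<^sub>a u\<^sub>b" and h: "h \<in> H" for u h
  proof -
    have "AE x in lebesgue_on \<Omega>. S\<^sub>h h u x + S\<^sub>h h f x - y\<^sub>d x = S\<^sub>h h u x + z x"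
      using bspec[OF S\<^sub>h_f h] by eventually_elim (simp add: z_def y\<^sub>f)
    then have "L2_norm \<Omega> (\<lambda>x. S\<^sub>h h u x + S\<^sub>h h f x - y\<^sub>d x) = L2_norm \<Omega> (\<lambda>x. S\<^sub>h h u x + z x)"
      by (rule L2_norm_cong_AE)
        (intro L2_add L2_diff symmetric_L2_in[OF symSh[OF h]] ad(1)[OF u] data(3) ydL zL)+
    then show ?thesis unfolding cost_eq[OF lm ad(1,2)[OF u]] Q\<^sub>h_def \<Phi>_def by simp
  qed
  \<comment> \<open>\<open>E\<close> bounds the states \<open>S u\<close>, and \<open>M h\<close> will bound each of three differences of tracking costs.\<close>
  define E where "E = K * N"
  have E0: "0 \<le> E" using K N0 by (simp add: E_def)
  define M where "M = E * (6 * E + 2 * Z)"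
  have Z0: "0 \<le> Z" by (simp add: Z_def L2_norm_nonneg)
  have M0: "0 \<le> M" using E0 Z0 by (simp add: M_def)
  have S_N: "L2_norm \<Omega> (S u) \<le> E" if "u \<in> U_ad \<Omega> u\<^sub>a u\<^sub>b" for u
    using bspec[OF K_S ad(1)[OF that]] mult_left_mono[OF ad(3)[OF that] less_imp_le[OF K]] unfolding E_def by linarith
  have Sz: "(\<lambda>x. S u x + z x) \<in> L2 \<Omega>" "L2_norm \<Omega> (\<lambda>x. S u x + z x) \<le> E + Z"
    if "u \<in> U_ad \<Omega> u\<^sub>a u\<^sub>b" for u
    using L2_triangle[OF symmetric_L2_in[OF symS ad(1)[OF that]] zL] S_N[OF that]
      L2_add[OF symmetric_L2_in[OF symS ad(1)[OF that]] zL] by (simp_all add: Z_def)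
  have half_sq: "1 / 2 * (L2_norm \<Omega> b)\<^sup>2 - 1 / 2 * (L2_norm \<Omega> c)\<^sup>2 \<le> M * h"
    if bc: "b \<in> L2 \<Omega>" "c \<in> L2 \<Omega>" and d: "L2_norm \<Omega> (\<lambda>x. b x - c x) \<le> 2 * (E * h)"
      and c: "L2_norm \<Omega> c \<le> 2 * E + Z" and h: "0 < h" "h \<le> 1" for b c h
  proof -
    let ?d = "L2_norm \<Omega> (\<lambda>x. b x - c x)"
    have "E * h \<le> E" using h E0 by (simp add: mult_left_le)
    then have "2 * (E * h) \<le> 2 * E" by simp
    then have "?d \<le> 2 * E" by (rule order_trans[OF d])
    moreover have "2 * L2_norm \<Omega> c \<le> 2 * (2 * E + Z)" using c by simp
    ultimately have "2 * L2_norm \<Omega> c + ?d \<le> 2 * (2 * E + Z) + 2 * E" by (rule add_mono[rotated])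
    then have "?d * (2 * L2_norm \<Omega> c + ?d) \<le> (2 * (E * h)) * (2 * (2 * E + Z) + 2 * E)"
      using E0 h by (intro mult_mono[OF d]) (auto simp: L2_norm_nonneg)
    also have "\<dots> = 2 * (M * h)" by (simp add: M_def algebra_simps)
    finally show ?thesis using L2_norm_sq_diff_le[OF bc] by linarith
  qed
  define c where "c = (1 + K) * sqrt (3 * M / (2 * \<kappa>)) + E + 1"
  have c0: "0 < c" using K E0 M0 \<kappa> by (simp add: c_def add_nonneg_pos)
  \<comment> \<open>Within \<open>\<epsilon>\<close> the density is strongly convex; less than half the gap \<open>m\<close> rules out crossing it.\<close>
  define \<epsilon>' where "\<epsilon>' = min \<epsilon> (m / 4)"
  have \<epsilon>': "0 < \<epsilon>'" "\<epsilon>' \<le> \<epsilon>" "\<epsilon>' < m / 2" using \<epsilon> m by (auto simp: \<epsilon>'_def)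
  have estimate: "L2_norm \<Omega> (\<lambda>x. u_bar x - u_bar\<^sub>h h x) + L2_norm \<Omega> (\<lambda>x. y_bar x - y_bar\<^sub>h h x) \<le> c * h powr (1 / 2)"
    if h: "h \<in> H" "h \<le> 1" and close: "AE x in lebesgue_on \<Omega>. \<bar>u_bar\<^sub>h h x - u_bar x\<bar> \<le> \<epsilon>'" for h
  proof -
    interpret regular_mesh \<Omega> "\<T> h" \<kappa>' h by (rule mesh'[OF h(1)])
    define v where "v = u_bar\<^sub>h h"
    define w where "w = cell_projection u_bar"
    have h0: "0 < h" by (rule mesh_pos(2))
    have v_in: "v \<in> U_ad \<Omega> u\<^sub>a u\<^sub>b" "v \<in> U_space \<Omega> (\<T> h)"
      and v_min: "\<And>w. w \<in> U_ad \<Omega> u\<^sub>a u\<^sub>b \<Longrightarrow> w \<in> U_space \<Omega> (\<T> h) \<Longrightarrow>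
        cost \<Omega> f y\<^sub>d \<alpha> \<beta> q \<gamma> (S\<^sub>h h) v \<le> cost \<Omega> f y\<^sub>d \<alpha> \<beta> q \<gamma> (S\<^sub>h h) w"
      using bspec[OF u_bar\<^sub>h h(1)] unfolding is_arg_min_def v_def by (auto simp: not_less)
    have w_in: "w \<in> U_ad \<Omega> u\<^sub>a u\<^sub>b" "w \<in> U_space \<Omega> (\<T> h)"
      unfolding w_def using cell_projection_U_ad[OF ub(1) params(6,7)] cell_projection_U_space by auto
    note uL = ad[OF ub(1)] and vL = ad[OF v_in(1)] and wL = ad[OF w_in(1)]
    have growth: "2 * \<kappa> * (L2_norm \<Omega> (\<lambda>x. u_bar x - v x))\<^sup>2
        \<le> cost \<Omega> f y\<^sub>d \<alpha> \<beta> q \<gamma> S v - cost \<Omega> f y\<^sub>d \<alpha> \<beta> q \<gamma> S u_bar"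
    proof (rule cost_growth[OF lm symS zL[unfolded z_def] uL(1,2) vL(1,2)])
      have "(\<lambda>x. 1 / 2 * u_bar x + 1 / 2 * v x) \<in> U_ad \<Omega> u\<^sub>a u\<^sub>b"
      proof -
        have "AE x in lebesgue_on \<Omega>. u\<^sub>a \<le> u_bar x \<and> u_bar x \<le> u\<^sub>b" "AE x in lebesgue_on \<Omega>. u\<^sub>a \<le> v x \<and> v x \<le> u\<^sub>b"
          using ub(1) v_in(1) by (auto simp: U_ad_def)
        then have "AE x in lebesgue_on \<Omega>. u\<^sub>a \<le> 1 / 2 * u_bar x + 1 / 2 * v x \<and> 1 / 2 * u_bar x + 1 / 2 * v x \<le> u\<^sub>b"
          by eventually_elim linarith
        then show ?thesis unfolding U_ad_def using L2_lin[OF uL(1) vL(1)] by blast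
      qed
      moreover have "(\<lambda>x. 1 / 2 * u_bar x + 1 / 2 * v x) \<in> BV \<Omega>"
        by (rule BV_nonneg_combination[OF ls ub(2) U_space_BV[OF v_in(2) L2_integrable[OF lm vL(1)]]]) simp_all
      ultimately show "cost \<Omega> f y\<^sub>d \<alpha> \<beta> q \<gamma> S u_bar \<le> cost \<Omega> f y\<^sub>d \<alpha> \<beta> q \<gamma> S (\<lambda>x. 1 / 2 * u_bar x + 1 / 2 * v x)"
        by (rule ub_min)
      show "AE x in lebesgue_on \<Omega>. F ((v x + u_bar x) / 2) \<le> (F (v x) + F (u_bar x)) / 2 - \<kappa> * (v x - u_bar x)\<^sup>2"
        using gap close
      proof eventually_elim
        case (elim x)
        have "\<bar>v x - u_bar x\<bar> \<le> \<epsilon>" using elim(2) \<epsilon>'(2) by (simp add: v_def)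
        then show ?case using strict elim(1) by blast
      qed
    qed
    have jensen: "\<Phi> w \<le> \<Phi> u_bar"
      unfolding \<Phi>_def w_def
    proof (rule cell_projection_density_le[OF mesh'[OF h(1)] C uL(1,2)])
      show "AE x in lebesgue_on \<Omega>. \<bar>cell_projection u_bar x\<bar> \<le> R" using wL(2) by (simp only: w_def)
      show "AE x in lebesgue_on \<Omega>. u_bar x \<noteq> 0 \<longrightarrow> C * s\<^sub>0 + t\<^sub>0 \<le> \<bar>u_bar x\<bar>" using gap by (simp only: m_def)
      show "v \<in> U_space \<Omega> (\<T> h)" by (rule v_in(2))
      show "AE x in lebesgue_on \<Omega>. \<bar>v x - u_bar x\<bar> \<le> \<epsilon>'" using close by (simp only: v_def)
      show "\<epsilon>' < (C * s\<^sub>0 + t\<^sub>0) / 2" using \<epsilon>'(3) by (simp only: m_def)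
    qed
    have hh: "h\<^sup>2 \<le> h" using h(2) h0 by (simp add: power2_eq_square mult_left_le)
    have fem: "L2_norm \<Omega> (\<lambda>x. S u x - S\<^sub>h h u x) \<le> E * h" if u: "u \<in> U_ad \<Omega> u\<^sub>a u\<^sub>b" for u
    proof -
      have "K * h\<^sup>2 * L2_norm \<Omega> u \<le> K * h * N"
        using K h0 hh ad(3)[OF u] by (intro mult_mono mult_left_mono) (auto simp: L2_norm_nonneg)
      also have "\<dots> = E * h" by (simp add: E_def)
      finally show ?thesis by (rule order_trans[OF bspec[OF bspec[OF K_err h(1)] ad(1)[OF u]]])
    qed
    have Eh: "0 \<le> E * h" "E * h \<le> E" using E0 h0 h(2) by (auto simp: mult_left_le)
    have Shz: "(\<lambda>x. S\<^sub>h h u x + z x) \<in> L2 \<Omega>" if "u \<in> U_ad \<Omega> u\<^sub>a u\<^sub>b" for u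
      by (intro L2_add symmetric_L2_in[OF symSh[OF h(1)]] ad(1)[OF that] zL)
    have fem_z: "L2_norm \<Omega> (\<lambda>x. (S u x + z x) - (S\<^sub>h h u x + z x)) \<le> E * h"
      "L2_norm \<Omega> (\<lambda>x. (S\<^sub>h h u x + z x) - (S u x + z x)) \<le> E * h" if u: "u \<in> U_ad \<Omega> u\<^sub>a u\<^sub>b" for u
      using fem[OF u] L2_norm_minus_commute[of \<Omega> "S u" "S\<^sub>h h u"] by simp_all
    \<comment> \<open>The first two differences are discretization errors at \<open>v\<close> and at \<open>w\<close>; the third is due to
      the difference \<open>u_bar - w\<close>, whose cell means vanish.\<close>
    have "Q v - Q\<^sub>h h v \<le> M * h"
      unfolding Q_def Q\<^sub>h_def
    proof (rule half_sq[OF Sz(1)[OF v_in(1)] Shz[OF v_in(1)] _ _ h0 h(2)])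
      show "L2_norm \<Omega> (\<lambda>x. (S v x + z x) - (S\<^sub>h h v x + z x)) \<le> 2 * (E * h)"
        using fem_z(1)[OF v_in(1)] Eh by linarith
      have "L2_norm \<Omega> (\<lambda>x. (S v x + z x) + ((S\<^sub>h h v x + z x) - (S v x + z x)))
          \<le> L2_norm \<Omega> (\<lambda>x. S v x + z x) + L2_norm \<Omega> (\<lambda>x. (S\<^sub>h h v x + z x) - (S v x + z x))"
        by (rule L2_triangle[OF Sz(1)[OF v_in(1)] L2_diff[OF Shz[OF v_in(1)] Sz(1)[OF v_in(1)]]])
      also have "(\<lambda>x. (S v x + z x) + ((S\<^sub>h h v x + z x) - (S v x + z x))) = (\<lambda>x. S\<^sub>h h v x + z x)"
        by (rule ext) simp
      finally show "L2_norm \<Omega> (\<lambda>x. S\<^sub>h h v x + z x) \<le> 2 * E + Z"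
        using fem_z(2)[OF v_in(1)] Sz(2)[OF v_in(1)] Eh by linarith
    qed
    moreover have "Q\<^sub>h h w - Q w \<le> M * h"
      unfolding Q_def Q\<^sub>h_def
    proof (rule half_sq[OF Shz[OF w_in(1)] Sz(1)[OF w_in(1)] _ _ h0 h(2)])
      show "L2_norm \<Omega> (\<lambda>x. (S\<^sub>h h w x + z x) - (S w x + z x)) \<le> 2 * (E * h)"
        using fem_z(2)[OF w_in(1)] Eh by linarith
      show "L2_norm \<Omega> (\<lambda>x. S w x + z x) \<le> 2 * E + Z" using Sz(2)[OF w_in(1)] E0 by linarith
    qed
    moreover have "Q w - Q u_bar \<le> M * h"
      unfolding Q_def
    proof (rule half_sq[OF Sz(1)[OF w_in(1)] Sz(1)[OF ub(1)] _ _ h0 h(2)])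
      define r where "r = (\<lambda>x. u_bar x - w x)"
      have r: "r \<in> L2 \<Omega>" unfolding r_def by (rule L2_diff[OF uL(1) wL(1)])
      have rN: "L2_norm \<Omega> r \<le> 2 * N"
        using L2_triangle_diff[OF uL(1) wL(1)] uL(3) wL(3) unfolding r_def by linarith
      have "L2_norm \<Omega> (\<lambda>x. (S w x + z x) - (S u_bar x + z x)) = L2_norm \<Omega> (\<lambda>x. S u_bar x - S w x)"
        using L2_norm_minus_commute[of \<Omega> "S w" "S u_bar"] by simp
      also have "\<dots> = L2_norm \<Omega> (S r)" unfolding r_def by (rule symmetric_L2_norm_diff[OF symS uL(1) wL(1)])
      also have "\<dots> \<le> K * h * L2_norm \<Omega> r"
      proof -
        have "\<forall>T\<in>\<T> h. (\<integral>x. indicator (interior T) x * r x \<partial>lebesgue_on \<Omega>) = 0"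
          unfolding r_def w_def by (intro ballI cell_projection_zero_mean L2_integrable[OF lm uL(1)])
        then show ?thesis using bspec[OF bspec[OF K_mean h(1)] r] h(2) by blast
      qed
      also have "\<dots> \<le> K * h * (2 * N)" using K h0 by (intro mult_left_mono[OF rN]) simp
      finally show "L2_norm \<Omega> (\<lambda>x. (S w x + z x) - (S u_bar x + z x)) \<le> 2 * (E * h)" by (simp add: E_def mult_ac)
      show "L2_norm \<Omega> (\<lambda>x. S u_bar x + z x) \<le> 2 * E + Z" using Sz(2)[OF ub(1)] E0 by linarith
    qed
    moreover have "Q\<^sub>h h v + \<Phi> v \<le> Q\<^sub>h h w + \<Phi> w"
      using v_min[OF w_in] by (simp only: cost_Q\<^sub>h[OF v_in(1) h(1)] cost_Q\<^sub>h[OF w_in(1) h(1)])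
    ultimately have "2 * \<kappa> * (L2_norm \<Omega> (\<lambda>x. u_bar x - v x))\<^sup>2 \<le> 3 * M * h"
      using growth jensen unfolding cost_Q[OF v_in(1)] cost_Q[OF ub(1)] by linarith
    then have "(L2_norm \<Omega> (\<lambda>x. u_bar x - v x))\<^sup>2 \<le> 3 * M / (2 * \<kappa>) * h"
      using \<kappa> by (simp add: pos_le_divide_eq mult_ac)
    then have "L2_norm \<Omega> (\<lambda>x. u_bar x - v x) \<le> sqrt (3 * M / (2 * \<kappa>) * h)" by (rule real_le_rsqrt)
    then have d: "L2_norm \<Omega> (\<lambda>x. u_bar x - v x) \<le> sqrt (3 * M / (2 * \<kappa>)) * sqrt h"
      by (simp only: real_sqrt_mult)
    have "L2_norm \<Omega> (\<lambda>x. y_bar x - y_bar\<^sub>h h x)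
        = L2_norm \<Omega> (\<lambda>x. (S u_bar x - S v x) + (S v x - S\<^sub>h h v x))"
      using bspec[OF y_bar\<^sub>h h(1)] by (simp add: y_bar v_def)
    also have "\<dots> \<le> L2_norm \<Omega> (\<lambda>x. S u_bar x - S v x) + L2_norm \<Omega> (\<lambda>x. S v x - S\<^sub>h h v x)"
      by (intro L2_triangle L2_diff symmetric_L2_in[OF symS] symmetric_L2_in[OF symSh[OF h(1)]] uL vL)
    also have "L2_norm \<Omega> (\<lambda>x. S u_bar x - S v x) \<le> K * L2_norm \<Omega> (\<lambda>x. u_bar x - v x)"
      unfolding symmetric_L2_norm_diff[OF symS uL(1) vL(1)] by (rule bspec[OF K_S L2_diff[OF uL(1) vL(1)]])
    finally have y: "L2_norm \<Omega> (\<lambda>x. y_bar x - y_bar\<^sub>h h x) \<le> K * L2_norm \<Omega> (\<lambda>x. u_bar x - v x) + E * h"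
      using fem[OF v_in(1)] by linarith
    have "h \<le> sqrt h" using hh h0 by (intro real_le_rsqrt)
    then have "E * h \<le> E * sqrt h" by (rule mult_left_mono[OF _ E0])
    moreover have "K * L2_norm \<Omega> (\<lambda>x. u_bar x - v x) \<le> K * (sqrt (3 * M / (2 * \<kappa>)) * sqrt h)"
      by (rule mult_left_mono[OF d less_imp_le[OF K]])
    moreover have "c * sqrt h = sqrt (3 * M / (2 * \<kappa>)) * sqrt h + K * (sqrt (3 * M / (2 * \<kappa>)) * sqrt h)
        + E * sqrt h + sqrt h"
      by (simp add: c_def distrib_right mult.assoc)
    moreover have "0 \<le> sqrt h" using h0 by simp
    ultimately have "L2_norm \<Omega> (\<lambda>x. u_bar x - v x) + L2_norm \<Omega> (\<lambda>x. y_bar x - y_bar\<^sub>h h x) \<le> c * sqrt h"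
      using d y by linarith
    then show ?thesis using h0 by (simp only: v_def powr_half_sqrt[OF less_imp_le])
  qed
  have "\<forall>\<^sub>F h in at 0 within H. Linf_norm \<Omega> (\<lambda>x. u_bar\<^sub>h h x - u_bar x) < ereal \<epsilon>'"
    by (rule order_tendstoD(2)[OF u_bar\<^sub>h_lim]) (use \<epsilon>'(1) in simp)
  moreover have "\<forall>\<^sub>F h in at 0 within H. h \<in> H \<and> h \<le> 1"
    unfolding eventually_at by (intro exI[of _ 1]) (auto simp: dist_real_def)
  ultimately have "\<forall>\<^sub>F h in at 0 within H.
      L2_norm \<Omega> (\<lambda>x. u_bar x - u_bar\<^sub>h h x) + L2_norm \<Omega> (\<lambda>x. y_bar x - y_bar\<^sub>h h x) \<le> c * h powr (1 / 2)"
  proof eventually_elim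
    case (elim h)
    have "AE x in lebesgue_on \<Omega>. ereal \<bar>u_bar\<^sub>h h x - u_bar x\<bar> \<le> Linf_norm \<Omega> (\<lambda>x. u_bar\<^sub>h h x - u_bar x)"
      unfolding Linf_norm_def by (rule esssup_AE)
    then have "AE x in lebesgue_on \<Omega>. \<bar>u_bar\<^sub>h h x - u_bar x\<bar> \<le> \<epsilon>'"
    proof eventually_elim
      case (elim x)
      then have "ereal \<bar>u_bar\<^sub>h h x - u_bar x\<bar> \<le> ereal \<epsilon>'"
        using \<open>Linf_norm \<Omega> (\<lambda>x. u_bar\<^sub>h h x - u_bar x) < ereal \<epsilon>'\<close> by (rule order_trans[OF _ less_imp_le])
      then show ?case by simp
    qed
    then show ?case using elim(2) by (intro estimate) auto
  qed
  with c0 show ?thesis by blast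
qed

end
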